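(* Let $\rho>0$ and $c\in L^\infty(B_\rho^+)$. Suppose that $u\in C^{2s+\alpha}(B_\rho)\cap\mathscr A_s(\mathbb{R}^n)$ for some $\alpha>0$ with $2s+\alpha$ not an integer, $u\geq0$ in $\mathbb{R}^n_+$, and $(-\Delta)^su+cu=0$ in $B_\rho^+$. Then there exists $C_\rho>0$ depending only on $n$, $s$, $\|c\|_{L^\infty(B_\rho^+)}$ and $\rho$ such that $$\sup_{x\in B^+_{\rho/2}}\frac{u(x)}{x_1}\leq C_\rho\inf_{x\in B^+_{\rho/2}}\frac{u(x)}{x_1}.$$ Moreover, both $\sup_{B^+_{\rho/2}}\frac{u(x)}{x_1}$ and $\inf_{B^+_{\rho/2}}\frac{u(x)}{x_1}$ are comparable to $\|u\|_{\mathscr A_s(\mathbb{R}^n)}$ (bounded above and below by positive constants with the same dependence times $\|u\|_{\mathscr A_s(\mathbb{R}^n)}$).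
   Context: Fix $n\geq1$, $s\in(0,1)$. For $x\in\mathbb{R}^n$ write $x=(x_1,x')$, $x_\ast=(-x_1,x')$; $u$ is antisymmetric if $u(x_\ast)=-u(x)$ for all $x$. $\mathbb{R}^n_+=\{x_1>0\}$, $B_r^+=B_r\cap\mathbb{R}^n_+$. $\mathscr A_s(\mathbb{R}^n)$ is the set of antisymmetric $u\in L^1_{loc}(\mathbb{R}^n)$ with $\|u\|_{\mathscr A_s(\mathbb{R}^n)}:=\int_{\mathbb{R}^n_+}\frac{x_1|u(x)|}{1+|x|^{n+2s+2}}dx<\infty$. For non-integer $\beta>0$, $C^\beta=C^{\lfloor\beta\rfloor,\beta-\lfloor\beta\rfloor}$. With $c_{n,s}=\frac{s4^s\Gamma(\frac{n+2s}{2})}{\pi^{n/2}\Gamma(1-s)}$, for $u\in\mathscr A_s(\mathbb{R}^n)$ that is $C^{2s+\alpha}$ near $x\in\mathbb{R}^n_+$, $(-\Delta)^su(x):=c_{n,s}\lim_{\varepsilon\to0^+}\int_{\mathbb{R}^n_+\setminus B_\varepsilon(x)}\big(|x-y|^{-n-2s}-|x_\ast-y|^{-n-2s}\big)(u(x)-u(y))dy+\frac{c_{1,s}}{s}u(x)x_1^{-2s}$; equations are understood pointwise with this definition. *)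

theory Defs
  imports "HOL-Analysis.Analysis"
begin

(* R^n is modelled as real^'n with 'n a finite, well-ordered index type;
   n = CARD('n) and the "first" coordinate x_1 is the one at the least index. *)

definition idx1 :: "'n::{finite,wellorder}" where
  "idx1 = (LEAST i. True)"

definition x1 :: "real^'n::{finite,wellorder} \<Rightarrow> real" where
  "x1 x = x $ (idx1::'n::{finite,wellorder})"

definition reflect :: "real^'n::{finite,wellorder} \<Rightarrow> real^'n::{finite,wellorder}" where
  "reflect x = (\<chi> i::'n::{finite,wellorder}. if i = idx1 then - (x $ i) else x $ i)"

definition antisymmetric :: "(real^'n::{finite,wellorder} \<Rightarrow> real) \<Rightarrow> bool" where
  "antisymmetric u \<longleftrightarrow> (\<forall>x. u (reflect x) = - u x)"

definition halfspace :: "(real^'n::{finite,wellorder}) set" where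
  "halfspace = {x. x1 x > 0}"

definition As_weight :: "real \<Rightarrow> (real^'n::{finite,wellorder} \<Rightarrow> real) \<Rightarrow> real^'n::{finite,wellorder} \<Rightarrow> real" where
  "As_weight s u x = x1 x * \<bar>u x\<bar> / (1 + norm x powr (real CARD('n) + 2 * s + 2))"

definition L1_loc :: "(real^'n::{finite,wellorder} \<Rightarrow> real) \<Rightarrow> bool" where
  "L1_loc u \<longleftrightarrow> (\<forall>K. compact K \<longrightarrow> set_integrable lebesgue K u)"

definition in_As :: "real \<Rightarrow> (real^'n::{finite,wellorder} \<Rightarrow> real) \<Rightarrow> bool" where
  "in_As s u \<longleftrightarrow> antisymmetric u \<and> L1_loc u \<and> set_integrable lebesgue halfspace (As_weight s u)"

definition As_norm :: "real \<Rightarrow> (real^'n::{finite,wellorder} \<Rightarrow> real) \<Rightarrow> real" where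
  "As_norm s u = set_lebesgue_integral lebesgue halfspace (As_weight s u)"

definition partial :: "'n::{finite,wellorder} \<Rightarrow> (real^'n::{finite,wellorder} \<Rightarrow> real) \<Rightarrow> real^'n::{finite,wellorder} \<Rightarrow> real" where
  "partial i f x = deriv (\<lambda>t. f (x + t *\<^sub>R axis i 1)) 0"

fun pds :: "'n::{finite,wellorder} list \<Rightarrow> (real^'n::{finite,wellorder} \<Rightarrow> real) \<Rightarrow> real^'n::{finite,wellorder} \<Rightarrow> real" where
  "pds [] f = f"
| "pds (i # is) f = partial i (pds is f)"

definition Ck_on :: "nat \<Rightarrow> (real^'n::{finite,wellorder}) set \<Rightarrow> (real^'n::{finite,wellorder} \<Rightarrow> real) \<Rightarrow> bool" where
  "Ck_on k U f \<longleftrightarrow>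
     (\<forall>is. length is < k \<longrightarrow> (\<forall>i. \<forall>x\<in>U. (\<lambda>t. pds is f (x + t *\<^sub>R axis i 1)) differentiable (at 0))) \<and>
     (\<forall>is. length is \<le> k \<longrightarrow> continuous_on U (pds is f))"

definition Holder_on :: "nat \<Rightarrow> real \<Rightarrow> (real^'n::{finite,wellorder}) set \<Rightarrow> (real^'n::{finite,wellorder} \<Rightarrow> real) \<Rightarrow> bool" where
  "Holder_on k g U f \<longleftrightarrow> Ck_on k U f \<and>
     (\<forall>is. length is \<le> k \<longrightarrow> bounded (pds is f ` U)) \<and>
     (\<forall>is. length is = k \<longrightarrow> (\<exists>L. \<forall>x\<in>U. \<forall>y\<in>U. \<bar>pds is f x - pds is f y\<bar> \<le> L * dist x y powr g))"

(* C^beta for non-integer beta > 0 *)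
definition C_beta :: "real \<Rightarrow> (real^'n::{finite,wellorder}) set \<Rightarrow> (real^'n::{finite,wellorder} \<Rightarrow> real) \<Rightarrow> bool" where
  "C_beta \<beta> U f \<longleftrightarrow> Holder_on (nat \<lfloor>\<beta>\<rfloor>) (\<beta> - of_int \<lfloor>\<beta>\<rfloor>) U f"

definition c_ns :: "nat \<Rightarrow> real \<Rightarrow> real" where
  "c_ns n s = s * 4 powr s * Gamma ((real n + 2 * s) / 2) / (pi powr (real n / 2) * Gamma (1 - s))"

(* the antisymmetric fractional Laplacian, pointwise, for x in the half-space *)
definition fraclap :: "real \<Rightarrow> (real^'n::{finite,wellorder} \<Rightarrow> real) \<Rightarrow> real^'n::{finite,wellorder} \<Rightarrow> real" where
  "fraclap s u x =
     c_ns CARD('n) s *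
       Lim (at_right 0) (\<lambda>\<epsilon>. set_lebesgue_integral lebesgue (halfspace - ball x \<epsilon>)
          (\<lambda>y. (norm (x - y) powr (- (real CARD('n) + 2 * s)) - norm (reflect x - y) powr (- (real CARD('n) + 2 * s)))
               * (u x - u y)))
     + c_ns 1 s / s * u x * x1 x powr (- 2 * s)"

definition Linf_on :: "(real^'n::{finite,wellorder}) set \<Rightarrow> (real^'n::{finite,wellorder} \<Rightarrow> real) \<Rightarrow> bool" where
  "Linf_on B c \<longleftrightarrow> set_borel_measurable lebesgue B c \<and> (\<exists>M. AE x in lebesgue. x \<in> B \<longrightarrow> \<bar>c x\<bar> \<le> M)"

definition Linf_norm :: "(real^'n::{finite,wellorder}) set \<Rightarrow> (real^'n::{finite,wellorder} \<Rightarrow> real) \<Rightarrow> real" where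
  "Linf_norm B c = Inf {M. M \<ge> 0 \<and> (AE x in lebesgue. x \<in> B \<longrightarrow> \<bar>c x\<bar> \<le> M)}"

end

theory Submission
  imports Defs "HOL-Probability.Distributions"
begin


text \<open>With \<open>p = n + 2 s\<close>, the operator is a zero-order term plus the principal value of the integral of
  \<open>ker p x y * (u x - u y)\<close> over the half-space, and a nonnegative solution satisfies \<open>\<bar>L u\<bar> \<le> M u\<close>. It is enough to
  squeeze \<open>u / x1\<close> between multiples of the weighted mass of \<open>u\<close>, and both bounds come from touching \<open>u\<close> with a
  barrier.

  Lower bound: touch from below with \<open>x1\<close> times a difference of two Gaussians that is positive exactly in a ball.
  At the contact point \<open>a\<close> the operator applied to the difference \<open>W \<ge> 0\<close> is minus the integral of \<open>ker p a y * W y\<close>,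
  and the kernel dominates \<open>x1 a\<close> times the weight, whereas the operator applied to the barrier is \<open>O(x1 a)\<close>.

  Upper bound: touch from above with \<open>V x1 y (R - \<bar>y\<bar>\<^sup>2) ^ (- N)\<close>, where \<open>N = n + 2\<close>. On a ball whose radius is a small
  multiple \<open>\<theta>\<close> of the distance to the sphere the barrier is nearly a constant multiple of \<open>x1\<close>, so a small mass
  forces \<open>u\<close> to lie well below it on most of that ball; this gain is of order \<open>\<theta> powr (- 2 s)\<close> and beats every error.

  As \<open>u\<close> is only Hoelder continuous, \<open>u / x1\<close> is not known to be bounded near the hyperplane, and the contact
  point could escape there. Adding a positive constant to \<open>u\<close> or to the barrier prevents this; on odd extensions the
  constant has a zero-order term of the favourable sign, and it is sent to zero at the end.\<close>

section \<open>The reflection and the kernel\<close>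

text \<open>Each contact inequality is finally divided by \<open>x1 a\<close>, so every term, error
  terms included, must carry this factor with a constant independent of the contact point
  \<open>a\<close>; this shapes most of the estimates. Gaussians are the test functions because a
  shift multiplies them by exponentials of inner products, in which a reflection changes a single
  term. In the upper bound the operator is never applied to the algebraic barrier: a Gaussian with
  the same value at \<open>a\<close> replaces it, and the mismatch, to first order a multiple of
  \<open>a \<bullet> z\<close>, is integrated against the kernel. Its absolute integral diverges as
  the truncation is removed if s >= 1/2, so cancellations are needed. The exponent n + 2 comes from
  scaling: on radius \<open>r\<close> the gain is of order \<open>V * r powr (- 2 * s)\<close>,
  while the far field costs the mass times \<open>r powr (- p - 2)\<close>; comparing the two bounds
  \<open>V * r ^ (n + 2)\<close>, and \<open>r\<close> is proportional to the factor whose power is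
  in the barrier. The Hoelder data of \<open>u\<close> serve only for existence and continuity of
  the principal value, so they do not enter the constants.\<close>

lemma x1_inner: "x1 x = x \<bullet> axis idx1 1"
  by (simp add: x1_def inner_axis)

lemma x1_simps [simp]:
  "x1 (x + y) = x1 x + x1 y" "x1 (x - y) = x1 x - x1 y" "x1 (- x) = - x1 x"
  "x1 (c *\<^sub>R x) = c * x1 x" "x1 0 = 0"
  by (simp_all add: x1_def)

lemma abs_x1_le_norm: "\<bar>x1 x\<bar> \<le> norm x"
  unfolding x1_def by (rule component_le_norm_cart)

lemma continuous_on_x1 [continuous_intros]: "continuous_on A f \<Longrightarrow> continuous_on A (\<lambda>x. x1 (f x))"
  unfolding x1_inner by (intro continuous_intros)

lemma borel_measurable_x1 [measurable]: "x1 \<in> borel_measurable borel"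
  unfolding x1_inner[abs_def] by measurable

lemma reflect_eq: "reflect x = x - (2 * x1 x) *\<^sub>R axis idx1 1"
  unfolding reflect_def x1_def by (auto simp: vec_eq_iff axis_def)

lemma reflect_simps [simp]:
  "reflect (x + y) = reflect x + reflect y" "reflect (x - y) = reflect x - reflect y"
  "reflect (- x) = - reflect x" "reflect (c *\<^sub>R x) = c *\<^sub>R reflect x" "reflect 0 = 0"
  "reflect (reflect x) = x"
  by (simp_all add: reflect_def vec_eq_iff)

lemma x1_reflect [simp]: "x1 (reflect x) = - x1 x"
  by (simp add: x1_def reflect_def)

lemma inner_reflect: "reflect x \<bullet> y = x \<bullet> y - 2 * x1 x * x1 y"
  unfolding reflect_eq inner_diff_left inner_scaleR_left x1_inner[of y]
  by (subst inner_commute[of "axis idx1 1" y]) simp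

lemma inner_reflect_reflect [simp]: "reflect x \<bullet> reflect y = x \<bullet> y"
proof -
  have "reflect x \<bullet> reflect y = x \<bullet> reflect y + 2 * x1 x * x1 y"
    by (simp add: inner_reflect)
  also have "x \<bullet> reflect y = reflect y \<bullet> x" by (rule inner_commute)
  also have "\<dots> = x \<bullet> y - 2 * x1 x * x1 y"
    using inner_commute[of x y] by (simp add: inner_reflect)
  finally show ?thesis by simp
qed

lemma norm_reflect [simp]: "norm (reflect x) = norm x"
  by (simp add: norm_eq_sqrt_inner)

lemma borel_measurable_reflect [measurable]: "reflect \<in> borel_measurable borel"
  unfolding reflect_eq[abs_def] x1_inner by measurable

lemma open_halfspace: "open halfspace"
  unfolding halfspace_def x1_inner by (simp add: open_halfspace_component_gt open_Collect_less continuous_intros)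

lemma sets_halfspace [measurable]: "halfspace \<in> sets borel"
  by (rule borel_open[OF open_halfspace])

text \<open>Reflection alters only the cross term of the expanded square. The kernel therefore
  compares the values of one function, \<open>t powr (- p / 2)\<close>, at two arguments that differ
  by \<open>4 * x1 a * x1 y\<close>; the two-sided estimates below rest on this.\<close>

lemma norm_reflect_diff_sq:
  "(norm (reflect a - y))\<^sup>2 = (norm (a - y))\<^sup>2 + 4 * x1 a * x1 y"
proof -
  have "(norm (reflect a - y))\<^sup>2 = reflect a \<bullet> reflect a - 2 * (reflect a \<bullet> y) + y \<bullet> y"
    using inner_commute[of y "reflect a"]
    by (simp add: power2_norm_eq_inner inner_diff_left inner_diff_right del: inner_reflect_reflect)
  also have "\<dots> = a \<bullet> a - 2 * (a \<bullet> y) + y \<bullet> y + 4 * x1 a * x1 y"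
    by (simp add: inner_reflect[of a y])
  also have "a \<bullet> a - 2 * (a \<bullet> y) + y \<bullet> y = (norm (a - y))\<^sup>2"
    using inner_commute[of y a]
    by (simp add: power2_norm_eq_inner inner_diff_left inner_diff_right)
  finally show ?thesis .
qed

lemma norm_reflect_diff: "norm (reflect a - y) = norm (a - reflect y)"
  by (metis norm_reflect reflect_simps(2) reflect_simps(6))

text \<open>This is the kernel of \<open>fraclap\<close> for p = n + 2 s. Since
  \<open>0 powr q = 0\<close>, its value at \<open>y = a\<close> is negative for
  \<open>x1 a > 0\<close> instead of infinite, which is why the sign statement excludes that
  point.\<close>

definition ker :: "real \<Rightarrow> real^'n::{finite,wellorder} \<Rightarrow> real^'n::{finite,wellorder} \<Rightarrow> real" where
  "ker p a y = norm (a - y) powr (- p) - norm (reflect a - y) powr (- p)"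

lemma borel_measurable_ker [measurable]: "ker p a \<in> borel_measurable borel"
  unfolding ker_def by measurable

context
  fixes a y :: "real^'n::{finite,wellorder}" and p :: real
  assumes a: "x1 a > 0" and y: "x1 y > 0" and p: "p > 1"
begin

lemma norm_le_norm_reflect_diff: "norm (a - y) \<le> norm (reflect a - y)"
  by (rule power2_le_imp_le) (use a y in \<open>simp_all add: norm_reflect_diff_sq\<close>)

lemma norm_reflect_diff_pos: "norm (reflect a - y) > 0"
proof -
  have "(norm (reflect a - y))\<^sup>2 > 0"
    unfolding norm_reflect_diff_sq using a y by (intro add_nonneg_pos) auto
  thus ?thesis by simp
qed

lemma ker_nonneg: "y \<noteq> a \<Longrightarrow> ker p a y \<ge> 0"
  unfolding ker_def using norm_le_norm_reflect_diff p by (simp add: powr_mono2')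

lemma ker_le: "ker p a y \<le> norm (a - y) powr (- p)"
  unfolding ker_def by simp

text \<open>Mean value theorem for \<open>t powr (- p / 2)\<close> over an interval of length
  \<open>4 * x1 a * x1 y\<close>, the derivative being largest in size at the left end. This is the
  source of the factor \<open>x1 a\<close> in the far field.\<close>

lemma ker_le2:
  assumes "y \<noteq> a"
  shows "ker p a y \<le> 2 * p * x1 a * x1 y * norm (a - y) powr (- p - 2)"
proof -
  define t d where "t = (norm (a - y))\<^sup>2" and "d = 4 * x1 a * x1 y"
  have t: "t > 0" "d > 0" using assms a y by (auto simp: t_def d_def)
  have pw: "norm v powr q = ((norm v)\<^sup>2) powr (q / 2)" for v :: "real^'n::{finite,wellorder}" and q
    by (simp flip: powr_numeral add: powr_powr)
  let ?f = "\<lambda>x. x powr (- p / 2)"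
  have "\<exists>z. t < z \<and> z < t + d \<and> ?f (t + d) - ?f t = (t + d - t) * (- p / 2 * z powr (- p / 2 - 1))"
    using t by (intro MVT2) (auto intro!: derivative_eq_intros)
  then obtain z where z: "t < z" "?f (t + d) - ?f t = d * (- p / 2 * z powr (- p / 2 - 1))" by auto
  have "z powr (- p / 2 - 1) \<le> t powr (- p / 2 - 1)"
    using z t p by (intro powr_mono2') auto
  hence "?f t - ?f (t + d) \<le> d * (p / 2) * t powr (- p / 2 - 1)"
  proof -
    have "d * (p / 2) * z powr (- p / 2 - 1) \<le> d * (p / 2) * t powr (- p / 2 - 1)"
      using \<open>z powr _ \<le> _\<close> t p by (intro mult_left_mono) auto
    thus ?thesis using z(2) by (simp add: algebra_simps)
  qed
  moreover have "ker p a y = ?f t - ?f (t + d)"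
    unfolding ker_def pw[of _ "- p"] norm_reflect_diff_sq t_def d_def by simp
  moreover have "norm (a - y) powr (- p - 2) = t powr (- p / 2 - 1)"
    unfolding pw[of _ "- p - 2"] t_def by (simp add: diff_divide_distrib)
  ultimately show ?thesis by (simp add: d_def mult_ac)
qed

text \<open>In terms of the relative increment \<open>x = d / (t + d)\<close> the kernel equals
  \<open>t powr (- p / 2)\<close> times \<open>1 - (1 - x) powr (p / 2)\<close>, so a lower bound
  linear in \<open>x\<close> is enough.\<close>

lemma ker_ge:
  assumes "y \<noteq> a"
  shows "ker p a y \<ge> 2 * x1 a * x1 y * norm (a - y) powr (- p) * norm (reflect a - y) powr (-2)"
proof -
  define t d where "t = (norm (a - y))\<^sup>2" and "d = 4 * x1 a * x1 y"
  have t: "t > 0" "d > 0" using assms a y by (auto simp: t_def d_def)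
  have pw: "norm v powr q = ((norm v)\<^sup>2) powr (q / 2)" for v :: "real^'n::{finite,wellorder}" and q
    by (simp flip: powr_numeral add: powr_powr)
  define x where "x = d / (t + d)"
  have x: "0 < x" "x < 1" using t by (auto simp: x_def)
  \<comment> \<open>As \<open>1 - x\<close> lies between 0 and 1 and \<open>p > 1\<close>, the
    exponent may be lowered to 1/2, where the square root lies below its tangent at
    \<open>x = 0\<close>.\<close>
  have "(1 - x) powr (p / 2) \<le> (1 - x) powr (1/2)"
    using p x by (intro powr_mono') auto
  also have "\<dots> \<le> 1 - x / 2"
  proof -
    have "sqrt (1 - x) \<le> 1 - x / 2"
      using x by (intro real_le_lsqrt) (auto simp: power2_eq_square algebra_simps)
    thus ?thesis using x by (simp add: powr_half_sqrt)
  qed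
  finally have *: "1 - (1 - x) powr (p / 2) \<ge> x / 2" by simp
  have "ker p a y = t powr (- p / 2) - (t + d) powr (- p / 2)"
    unfolding ker_def pw[of _ "- p"] norm_reflect_diff_sq t_def d_def by simp
  also have "(t + d) powr (- p / 2) = t powr (- p / 2) * (1 - x) powr (p / 2)"
  proof -
    have *: "t = (t + d) * (1 - x)" using t by (simp add: x_def field_simps)
    have "t powr (- p / 2) = (t + d) powr (- p / 2) * (1 - x) powr (- p / 2)"
      using powr_mult[of "t + d" "1 - x" "- p / 2"] t x unfolding *[symmetric] by simp
    moreover have "(1 - x) powr (- p / 2) * (1 - x) powr (p / 2) = 1"
      using x by (simp flip: powr_add)
    ultimately show ?thesis by (simp add: mult.assoc)
  qed
  finally have "ker p a y = t powr (- p / 2) * (1 - (1 - x) powr (p / 2))"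
    by (simp add: algebra_simps)
  also have "\<dots> \<ge> t powr (- p / 2) * (x / 2)"
    by (intro mult_left_mono *) simp
  finally have "ker p a y \<ge> t powr (- p / 2) * (x / 2)" .
  moreover have "norm (reflect a - y) powr (-2) = 1 / (t + d)"
  proof -
    have "norm (reflect a - y) powr (-2) = (t + d) powr (- 1)"
      using pw[of "reflect a - y" "-2"] unfolding norm_reflect_diff_sq t_def d_def by simp
    thus ?thesis using t powr_minus_divide[of "t + d" 1] by simp
  qed
  moreover have "norm (a - y) powr (- p) = t powr (- p / 2)"
    unfolding pw[of _ "- p"] t_def by simp
  moreover have "t powr (- p / 2) * (x / 2) = 2 * x1 a * x1 y * t powr (- p / 2) * (1 / (t + d))"
  proof -
    define R where "R = 1 / (t + d)"
    have "x = d * R" unfolding x_def R_def by simp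
    thus ?thesis unfolding R_def[symmetric] by (simp add: d_def)
  qed
  ultimately show ?thesis by simp
qed

end


section \<open>Radial and half-space integrals\<close>

lemma distr_reflect_lborel: "distr lborel borel (reflect :: real^'n::{finite,wellorder} \<Rightarrow> _) = lborel"
proof -
  define c :: "real^'n::{finite,wellorder} \<Rightarrow> real" where "c = (\<lambda>j. if j = axis idx1 1 then -1 else 1)"
  have T: "(\<lambda>x. 0 + (\<Sum>j\<in>Basis. (c j * (x \<bullet> j)) *\<^sub>R j)) = (reflect :: real^'n::{finite,wellorder} \<Rightarrow> _)"
  proof
    fix x :: "real^'n::{finite,wellorder}"
    have "(\<Sum>j\<in>Basis. (c j * (x \<bullet> j)) *\<^sub>R j) =
      (\<Sum>j\<in>Basis. (x \<bullet> j) *\<^sub>R j - (if j = axis idx1 1 then (2 * (x \<bullet> j)) *\<^sub>R j else 0))"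
      by (intro sum.cong) (auto simp: c_def simp flip: scaleR_diff_left)
    also have "\<dots> = x - (2 * (x \<bullet> axis idx1 1)) *\<^sub>R axis idx1 1"
      by (simp add: sum_subtractf euclidean_representation axis_in_Basis_iff)
    finally show "0 + (\<Sum>j\<in>Basis. (c j * (x \<bullet> j)) *\<^sub>R j) = reflect x"
      by (simp add: reflect_eq x1_inner)
  qed
  have "(\<Prod>j\<in>Basis. \<bar>c j\<bar>) = 1"
    by (intro prod.neutral) (auto simp: c_def)
  moreover have "lborel = density (distr lborel borel (\<lambda>x. 0 + (\<Sum>j\<in>Basis. (c j * (x \<bullet> j)) *\<^sub>R j))) (\<lambda>_. (\<Prod>j\<in>Basis. \<bar>c j\<bar>))"
    by (rule lborel_affine_euclidean) (auto simp: c_def)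
  ultimately show ?thesis unfolding T by (simp add: density_1)
qed

lemma
  fixes f :: "real^'n::{finite,wellorder} \<Rightarrow> real"
  assumes [measurable]: "f \<in> borel_measurable borel"
  shows integral_reflect: "(\<integral>x. f (reflect x) \<partial>lborel) = (\<integral>x. f x \<partial>lborel)"
    and integrable_reflect: "integrable lborel (\<lambda>x. f (reflect x)) \<longleftrightarrow> integrable lborel f"
proof -
  show "(\<integral>x. f (reflect x) \<partial>lborel) = (\<integral>x. f x \<partial>lborel)"
    by (subst (2) distr_reflect_lborel[symmetric]) (simp add: integral_distr)
  show "integrable lborel (\<lambda>x. f (reflect x)) \<longleftrightarrow> integrable lborel f"
    by (subst (2) distr_reflect_lborel[symmetric]) (simp add: integrable_distr_eq)
qed

lemma
  fixes f :: "'a::euclidean_space \<Rightarrow> real"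
  assumes [measurable]: "f \<in> borel_measurable borel"
  shows integral_uminus: "(\<integral>x. f (- x) \<partial>lborel) = (\<integral>x. f x \<partial>lborel)"
    and integrable_uminus: "integrable lborel (\<lambda>x. f (- x)) \<longleftrightarrow> integrable lborel f"
    and integral_shift: "(\<integral>x. f (t + x) \<partial>lborel) = (\<integral>x. f x \<partial>lborel)"
    and integrable_shift: "integrable lborel (\<lambda>x. f (t + x)) \<longleftrightarrow> integrable lborel f"
proof -
  have m: "lborel = distr lborel borel (\<lambda>x::'a. - x)"
    using lborel_affine[of "- 1" "0::'a"] by (simp add: density_1)
  show "(\<integral>x. f (- x) \<partial>lborel) = (\<integral>x. f x \<partial>lborel)"
    by (subst (2) m) (simp add: integral_distr)
  show "integrable lborel (\<lambda>x. f (- x)) \<longleftrightarrow> integrable lborel f"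
    by (subst (2) m) (simp add: integrable_distr_eq)
  have m: "lborel = distr lborel borel (\<lambda>x::'a. t + x)"
    using lborel_affine[of 1 t] by (simp add: density_1)
  show "(\<integral>x. f (t + x) \<partial>lborel) = (\<integral>x. f x \<partial>lborel)"
    by (subst (2) m) (simp add: integral_distr)
  show "integrable lborel (\<lambda>x. f (t + x)) \<longleftrightarrow> integrable lborel f"
    by (subst (2) m) (simp add: integrable_distr_eq)
qed

text \<open>Polar coordinates from ball volumes alone: both measures agree on the rays
  \<open>{..<r}\<close>, an intersection-stable generator, on one side by the volume of a ball and
  on the other by the fundamental theorem of calculus.\<close>

lemma distr_norm_lborel:
  "distr lborel borel (norm :: 'a::euclidean_space \<Rightarrow> real) =
    density lborel (\<lambda>r. ennreal (real DIM('a) * unit_ball_vol DIM('a) * r ^ (DIM('a) - 1)) * indicator {0..} r)"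
    (is "?M = ?N")
proof (rule measure_eqI_generator_eq[where E = "range lessThan" and \<Omega> = UNIV and A = "\<lambda>i. {..<real i}"])
  let ?n = "DIM('a)" let ?w = "unit_ball_vol DIM('a)"
  have M: "emeasure ?M {..<r} = ennreal (if r \<le> 0 then 0 else ?w * r ^ ?n)" for r
  proof -
    have "emeasure ?M {..<r} = emeasure lborel (ball (0::'a) r)"
      by (subst emeasure_distr) (auto intro!: arg_cong[where f = "emeasure lborel"])
    thus ?thesis by (cases "r \<le> 0") (auto simp: emeasure_ball ball_empty)
  qed
  have N: "emeasure ?N {..<r} = ennreal (if r \<le> 0 then 0 else ?w * r ^ ?n)" for r
  proof -
    have "emeasure ?N {..<r} = (\<integral>\<^sup>+x. ennreal (real ?n * ?w * x ^ (?n - 1)) * indicator {0..} x * indicator {..<r} x \<partial>lborel)"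
      by (subst emeasure_density) auto
    also have "\<dots> = (\<integral>\<^sup>+x. ennreal (real ?n * ?w * x ^ (?n - 1)) * indicator {0..r} x \<partial>lborel)"
      using AE_lborel_singleton[of r]
      by (intro nn_integral_cong_AE) (auto elim!: eventually_mono split: split_indicator)
    also have "\<dots> = ennreal (if r \<le> 0 then 0 else ?w * r ^ ?n)"
    proof (cases "r \<le> 0")
      case True
      have "AE x in lborel. ennreal (real ?n * ?w * x ^ (?n - 1)) * indicator {0..r} x = 0"
        \<comment> \<open>For \<open>r = 0\<close> the set \<open>{0..r}\<close> still contains 0,
          and in dimension one the density does not vanish there; the point is discarded as a null
          set.\<close>
        using AE_lborel_singleton[of 0] by eventually_elim (use True in \<open>auto split: split_indicator\<close>)
      hence "(\<integral>\<^sup>+x. ennreal (real ?n * ?w * x ^ (?n - 1)) * indicator {0..r} x \<partial>lborel) = (\<integral>\<^sup>+x. 0 \<partial>(lborel::real measure))"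
        by (rule nn_integral_cong_AE)
      thus ?thesis using True by simp
    next
      case False
      have "(\<integral>\<^sup>+x. ennreal (real ?n * ?w * x ^ (?n - 1)) * indicator {0..r} x \<partial>lborel) = ennreal (?w * r ^ ?n - ?w * 0 ^ ?n)"
        using False by (intro nn_integral_FTC_Icc) (auto intro!: derivative_eq_intros)
      thus ?thesis using False by simp
    qed
    finally show ?thesis .
  qed
  show "Int_stable (range lessThan :: real set set)"
  proof (clarsimp simp: Int_stable_def)
    fix a b :: real
    have "{..<a} \<inter> {..<b} = {..<min a b}" by auto
    thus "{..<a} \<inter> {..<b} \<in> range lessThan" by blast
  qed
  show "sets ?M = sigma_sets UNIV (range lessThan)" "sets ?N = sigma_sets UNIV (range lessThan)"
    by (simp_all add: borel_Iio)
  show "emeasure ?M X = emeasure ?N X" if "X \<in> range lessThan" for X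
    using that by (elim rangeE) (simp only: M N)
  show "(\<Union>i. {..<real i}) = UNIV" by (auto simp: reals_Archimedean2)
  show "emeasure ?M {..<real i} \<noteq> \<infinity>" for i by (simp add: M)
qed auto

lemma nn_integral_radial:
  fixes f :: "real \<Rightarrow> ennreal"
  assumes [measurable]: "f \<in> borel_measurable borel"
  shows "(\<integral>\<^sup>+z. f (norm (z::'a::euclidean_space)) \<partial>lborel) =
    (\<integral>\<^sup>+r. ennreal (real DIM('a) * unit_ball_vol DIM('a) * r ^ (DIM('a) - 1)) * indicator {0..} r * f r \<partial>lborel)"
proof -
  have "(\<integral>\<^sup>+z. f (norm (z::'a)) \<partial>lborel) = (\<integral>\<^sup>+r. f r \<partial>(distr lborel borel (norm :: 'a \<Rightarrow> real)))"
    by (simp add: nn_integral_distr)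
  thus ?thesis unfolding distr_norm_lborel by (simp add: nn_integral_density)
qed

lemma nn_integral_norm_powr_tail:
  fixes p e :: real
  assumes p: "p > real DIM('a::euclidean_space)" and e: "e > 0"
  shows "(\<integral>\<^sup>+z. ennreal (norm (z::'a) powr (- p)) * indicator {z. e \<le> norm z} z \<partial>lborel) =
    ennreal (real DIM('a) * unit_ball_vol DIM('a) * (e powr (DIM('a) - p) / (p - DIM('a))))"
proof -
  let ?n = "DIM('a)" let ?w = "real ?n * unit_ball_vol DIM('a)"
  have "(\<integral>\<^sup>+z. ennreal (norm (z::'a) powr (- p)) * indicator {z. e \<le> norm z} z \<partial>lborel) =
    (\<integral>\<^sup>+z. (\<lambda>r. ennreal (r powr (- p)) * indicator {e..} r) (norm (z::'a)) \<partial>lborel)"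
    by (intro nn_integral_cong) (auto split: split_indicator)
  also have "\<dots> = (\<integral>\<^sup>+r. ennreal (?w * r ^ (?n - 1)) * indicator {0..} r * (ennreal (r powr (- p)) * indicator {e..} r) \<partial>lborel)"
    by (rule nn_integral_radial) measurable
  also have "\<dots> = (\<integral>\<^sup>+r. ennreal (indicator {e..} r * (?w * r powr (real ?n - 1 - p))) \<partial>lborel)"
  proof (intro nn_integral_cong)
    fix r :: real
    have "r ^ (?n - 1) * r powr (- p) = r powr (real ?n - 1 - p)" if "r \<ge> e"
      using that e by (simp flip: powr_realpow add: powr_add[symmetric] of_nat_diff)
    hence "?w * r ^ (?n - 1) * r powr (- p) = ?w * r powr (real ?n - 1 - p)" if "r \<ge> e"
      using that by (simp add: mult.assoc)
    thus "ennreal (?w * r ^ (?n - 1)) * indicator {0..} r * (ennreal (r powr (- p)) * indicator {e..} r) =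
      ennreal (indicator {e..} r * (?w * r powr (real ?n - 1 - p)))"
      using e by (auto split: split_indicator simp flip: ennreal_mult')
  qed
  also have "\<dots> = ennreal (?w * (- (e powr (real ?n - 1 - p + 1)) / (real ?n - 1 - p + 1)))"
    using p e by (intro nn_integral_has_integral_lebesgue has_integral_mult_right has_integral_powr_to_inf) auto
  also have "- (e powr (real ?n - 1 - p + 1)) / (real ?n - 1 - p + 1) = e powr (?n - p) / (p - ?n)"
    using p by (simp add: field_simps)
  finally show ?thesis .
qed

lemma nn_integral_norm_powr_ball:
  fixes p e :: real
  assumes p: "p < real DIM('a::euclidean_space)" and e: "e > 0"
  shows "(\<integral>\<^sup>+z. ennreal (norm (z::'a) powr (- p)) * indicator (ball 0 e) z \<partial>lborel) =
    ennreal (real DIM('a) * unit_ball_vol DIM('a) * (e powr (DIM('a) - p) / (DIM('a) - p)))"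
proof -
  let ?n = "DIM('a)" let ?w = "real ?n * unit_ball_vol DIM('a)"
  have "(\<integral>\<^sup>+z. ennreal (norm (z::'a) powr (- p)) * indicator (ball 0 e) z \<partial>lborel) =
    (\<integral>\<^sup>+z. (\<lambda>r. ennreal (r powr (- p)) * indicator {..<e} r) (norm (z::'a)) \<partial>lborel)"
    by (intro nn_integral_cong) (auto split: split_indicator)
  also have "\<dots> = (\<integral>\<^sup>+r. ennreal (?w * r ^ (?n - 1)) * indicator {0..} r * (ennreal (r powr (- p)) * indicator {..<e} r) \<partial>lborel)"
    by (rule nn_integral_radial) measurable
  also have "\<dots> = (\<integral>\<^sup>+r. ennreal (indicator {0..e} r * (?w * r powr (real ?n - 1 - p))) \<partial>lborel)"
  proof (rule nn_integral_cong_AE)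
    have "ennreal (?w * r ^ (?n - 1)) * indicator {0..} r * (ennreal (r powr (- p)) * indicator {..<e} r) =
      ennreal (indicator {0..e} r * (?w * r powr (real ?n - 1 - p)))" if "r \<noteq> 0" "r \<noteq> e" for r
    proof -
      have "r ^ (?n - 1) * r powr (- p) = r powr (real ?n - 1 - p)" if "r > 0"
        using that e by (simp flip: powr_realpow add: powr_add[symmetric] of_nat_diff)
      hence "?w * r ^ (?n - 1) * r powr (- p) = ?w * r powr (real ?n - 1 - p)" if "r > 0"
        using that by (simp add: mult.assoc)
      thus ?thesis
        using that by (auto split: split_indicator simp flip: ennreal_mult')
    qed
    note * = this
    show "AE r in lborel. ennreal (?w * r ^ (?n - 1)) * indicator {0..} r * (ennreal (r powr (- p)) * indicator {..<e} r) =
      ennreal (indicator {0..e} r * (?w * r powr (real ?n - 1 - p)))"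
      using AE_lborel_singleton[of 0] AE_lborel_singleton[of e] by eventually_elim (rule *)
  qed
  also have "\<dots> = ennreal (?w * (e powr (real ?n - 1 - p + 1) / (real ?n - 1 - p + 1)))"
    using p e by (intro nn_integral_has_integral_lebesgue has_integral_mult_right has_integral_powr_from_0) auto
  also have "e powr (real ?n - 1 - p + 1) / (real ?n - 1 - p + 1) = e powr (?n - p) / (?n - p)"
    by simp
  finally show ?thesis .
qed

lemma integrable_norm_powr_tail:
  fixes p e :: real
  assumes "p > real DIM('a::euclidean_space)" "e > 0"
  shows "integrable lborel (\<lambda>z::'a. norm z powr (- p) * indicator {z. e \<le> norm z} z)"
proof (rule integrableI_nonneg)
  have "(\<integral>\<^sup>+z. ennreal (norm (z::'a) powr (- p) * indicator {z. e \<le> norm z} z) \<partial>lborel) =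
    (\<integral>\<^sup>+z. ennreal (norm (z::'a) powr (- p)) * indicator {z. e \<le> norm z} z \<partial>lborel)"
    by (intro nn_integral_cong) (auto split: split_indicator)
  thus "(\<integral>\<^sup>+z. ennreal (norm (z::'a) powr (- p) * indicator {z. e \<le> norm z} z) \<partial>lborel) < \<infinity>"
    unfolding nn_integral_norm_powr_tail[OF assms] by simp
qed auto

lemma
  fixes p e :: real
  assumes "p < real DIM('a::euclidean_space)" "e > 0"
  shows integrable_norm_powr_ball: "integrable lborel (\<lambda>z::'a. norm z powr (- p) * indicator (ball 0 e) z)"
    and integral_norm_powr_ball: "(\<integral>z. norm (z::'a) powr (- p) * indicator (ball 0 e) z \<partial>lborel) =
      real DIM('a) * unit_ball_vol DIM('a) * (e powr (DIM('a) - p) / (DIM('a) - p))"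
proof -
  have "(\<integral>\<^sup>+z. ennreal (norm (z::'a) powr (- p) * indicator (ball 0 e) z) \<partial>lborel) =
    (\<integral>\<^sup>+z. ennreal (norm (z::'a) powr (- p)) * indicator (ball 0 e) z \<partial>lborel)"
    by (intro nn_integral_cong) (auto split: split_indicator)
  hence *: "(\<integral>\<^sup>+z. ennreal (norm (z::'a) powr (- p) * indicator (ball 0 e) z) \<partial>lborel) =
    ennreal (real DIM('a) * unit_ball_vol DIM('a) * (e powr (DIM('a) - p) / (DIM('a) - p)))"
    unfolding nn_integral_norm_powr_ball[OF assms] .
  have [measurable]: "ball 0 e \<in> sets (borel :: 'a measure)" by simp
  have [measurable]: "(\<lambda>z::'a. norm z powr (- p) * indicator (ball 0 e) z) \<in> borel_measurable lborel"
    by measurable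
  show "integrable lborel (\<lambda>z::'a. norm z powr (- p) * indicator (ball 0 e) z)"
    by (rule integrableI_nonneg) (use * in auto)
  show "(\<integral>z. norm (z::'a) powr (- p) * indicator (ball 0 e) z \<partial>lborel) =
      real DIM('a) * unit_ball_vol DIM('a) * (e powr (DIM('a) - p) / (DIM('a) - p))"
    by (rule integral_eq_nn_integral[THEN trans]) (use * assms in auto)
qed

section \<open>The integral of |z| ^ (- n - 2 s) over a half-space\<close>

lemma nn_integral_Gamma_scaled:
  assumes c: "c > 0" and q: "q > 0"
  shows "(\<integral>\<^sup>+t. ennreal (indicator {0..} t * (t powr (q - 1) * exp (- t * c))) \<partial>lborel) = ennreal (Gamma q * c powr (- q))"
proof -
  have "ennreal (Gamma q) = (\<integral>\<^sup>+t. ennreal (indicator {0..} t * t powr (q - 1) / exp t) \<partial>lborel)"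
    by (rule Gamma_conv_nn_integral_real) fact
  also have "\<dots> = ennreal \<bar>c\<bar> * (\<integral>\<^sup>+t. ennreal (indicator {0..} (0 + c * t) * (0 + c * t) powr (q - 1) / exp (0 + c * t)) \<partial>lborel)"
    using c by (intro nn_integral_real_affine) auto
  also have "\<dots> = (\<integral>\<^sup>+t. ennreal (c powr q) * ennreal (indicator {0..} t * (t powr (q - 1) * exp (- t * c))) \<partial>lborel)"
  proof (subst nn_integral_cmult[symmetric], measurable, intro nn_integral_cong)
    fix t :: real
    have "c * (c * t) powr (q - 1) = c powr q * t powr (q - 1)" if "t \<ge> 0"
      using c that by (simp add: powr_mult powr_diff)
    thus "ennreal \<bar>c\<bar> * ennreal (indicator {0..} (0 + c * t) * (0 + c * t) powr (q - 1) / exp (0 + c * t)) =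
      ennreal (c powr q) * ennreal (indicator {0..} t * (t powr (q - 1) * exp (- t * c)))"
      using c by (auto simp: exp_minus field_simps zero_le_mult_iff simp flip: ennreal_mult' split: split_indicator)
  qed
  also have "\<dots> = ennreal (c powr q) * (\<integral>\<^sup>+t. ennreal (indicator {0..} t * (t powr (q - 1) * exp (- t * c))) \<partial>lborel)"
    by (rule nn_integral_cmult) measurable
  finally have "ennreal (c powr (- q)) * ennreal (Gamma q) = ennreal (c powr (- q)) * ennreal (c powr q) *
     (\<integral>\<^sup>+t. ennreal (indicator {0..} t * (t powr (q - 1) * exp (- t * c))) \<partial>lborel)"
    by (simp add: mult.assoc)
  also have "ennreal (c powr (- q)) * ennreal (c powr q) = 1"
    using c by (simp flip: ennreal_mult' powr_add)
  finally show ?thesis using q by (simp add: mult.commute flip: ennreal_mult')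
qed

lemma nn_integral_gaussian:
  assumes c: "c > 0"
  shows "(\<integral>\<^sup>+x. ennreal (exp (- c * x\<^sup>2)) \<partial>lborel) = ennreal (sqrt (pi / c))"
proof -
  have "has_bochner_integral lborel (\<lambda>x::real. exp (- x\<^sup>2)) (2 *\<^sub>R (sqrt pi / 2))"
    by (rule has_bochner_integral_even_function[OF gaussian_moment_0]) auto
  hence "(\<integral>\<^sup>+x. ennreal (exp (- x\<^sup>2)) \<partial>lborel) = ennreal (sqrt pi)"
    by (subst nn_integral_eq_integral) (auto simp: has_bochner_integral_iff)
  hence "ennreal (sqrt pi) = ennreal \<bar>sqrt c\<bar> * (\<integral>\<^sup>+x. ennreal (exp (- (0 + sqrt c * x)\<^sup>2)) \<partial>lborel)"
    using c by (subst nn_integral_real_affine[symmetric]) auto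
  hence "ennreal (1 / sqrt c) * ennreal (sqrt pi) = ennreal (1 / sqrt c) * ennreal (sqrt c) * (\<integral>\<^sup>+x. ennreal (exp (- c * x\<^sup>2)) \<partial>lborel)"
    using c by (simp add: power_mult_distrib mult.assoc)
  also have "ennreal (1 / sqrt c) * ennreal (sqrt c) = 1"
    using c by (simp flip: ennreal_mult')
  finally show ?thesis using c by (simp add: real_sqrt_divide flip: ennreal_mult')
qed

text \<open>The Gaussian is a product over the coordinates and the half-space restricts only the
  first one, so each of the other n - 1 coordinates contributes
  \<open>sqrt (pi / t)\<close>.\<close>

lemma nn_integral_gaussian_halfspace:
  assumes t: "t > 0"
  shows "(\<integral>\<^sup>+z. indicator {A<..} (x1 (z::real^'n::{finite,wellorder})) * ennreal (exp (- t * (norm z)\<^sup>2)) \<partial>lborel) =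
    ennreal ((pi / t) powr ((real CARD('n) - 1) / 2)) *
      (\<integral>\<^sup>+w. indicator {A<..} w * ennreal (exp (- t * w\<^sup>2)) \<partial>lborel)"
proof -
  define e :: "real^'n::{finite,wellorder}" where "e = axis idx1 1"
  define f where "f = (\<lambda>b (x::real). (if b = e then indicator {A<..} x else 1) * ennreal (exp (- t * x\<^sup>2)))"
  have eB: "e \<in> Basis" by (simp add: e_def axis_in_Basis_iff)
  have "(\<Prod>b\<in>Basis. f b (z \<bullet> b)) = indicator {A<..} (x1 z) * ennreal (exp (- t * (norm z)\<^sup>2))" for z :: "real^'n::{finite,wellorder}"
  proof -
    have "(\<Prod>b\<in>Basis. f b (z \<bullet> b)) = (\<Prod>b\<in>Basis. if b = e then indicator {A<..} (z \<bullet> b) else 1) * (\<Prod>b\<in>Basis. ennreal (exp (- t * (z \<bullet> b)\<^sup>2)))"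
      unfolding f_def by (simp add: prod.distrib)
    also have "(\<Prod>b\<in>Basis. if b = e then indicator {A<..} (z \<bullet> b) else 1) = (indicator {A<..} (x1 z) :: ennreal)"
      using eB by (simp add: x1_inner e_def)
    also have "(\<Prod>b\<in>Basis. ennreal (exp (- t * (z \<bullet> b)\<^sup>2))) = ennreal (exp (- t * (norm z)\<^sup>2))"
      by (simp add: prod_ennreal exp_sum[symmetric] sum_distrib_left norm_eq_sqrt_inner euclidean_inner[of z z] power2_eq_square sum_nonneg
          flip: sum_negf)
    finally show ?thesis .
  qed
  hence "(\<integral>\<^sup>+z. indicator {A<..} (x1 (z::real^'n::{finite,wellorder})) * ennreal (exp (- t * (norm z)\<^sup>2)) \<partial>lborel) =
    (\<Prod>b\<in>(Basis :: (real^'n::{finite,wellorder}) set). (\<integral>\<^sup>+x. f b x \<partial>lborel))"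
    by (subst nn_integral_lborel_prod[symmetric]) (simp_all add: f_def)
  also have "\<dots> = (\<integral>\<^sup>+x. f e x \<partial>lborel) * (\<Prod>b\<in>Basis - {e}. (\<integral>\<^sup>+x. f b x \<partial>lborel))"
    using eB by (simp add: prod.remove)
  also have "(\<Prod>b\<in>Basis - {e}. (\<integral>\<^sup>+x. f b x \<partial>lborel)) = (\<Prod>b\<in>Basis - {e}. ennreal (sqrt (pi / t)))"
    using nn_integral_gaussian[OF t] by (intro prod.cong) (auto simp: f_def)
  also have "\<dots> = ennreal (sqrt (pi / t) ^ (CARD('n) - 1))"
    using eB t by (simp add: card_Diff_singleton prod_constant ennreal_power)
  also have "sqrt (pi / t) ^ (CARD('n) - 1) = (pi / t) powr ((real CARD('n) - 1) / 2)"
    using t by (simp add: powr_half_sqrt[symmetric] powr_powr flip: powr_realpow)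
  finally show ?thesis by (simp add: f_def mult.commute)
qed

text \<open>Subordination: up to \<open>Gamma q\<close>, the power is a mixture of the Gaussians exp
  (- t |z|^2). Exchanging the integrals removes the tangential coordinates and lowers the exponent
  from \<open>q\<close> to \<open>q - m = 1 / 2 + s\<close>; undoing the Gamma integral in the
  remaining variable leaves a one-dimensional power tail.\<close>

lemma nn_integral_norm_powr_halfspace:
  assumes s: "s > 0" and A: "A > 0"
  shows "(\<integral>\<^sup>+z. ennreal (norm (z::real^'n::{finite,wellorder}) powr (- (real CARD('n) + 2 * s))) * indicator {A<..} (x1 z) \<partial>lborel) =
    ennreal (pi powr ((real CARD('n) - 1) / 2) * Gamma (1 / 2 + s) / Gamma ((real CARD('n) + 2 * s) / 2) * (A powr (- 2 * s) / (2 * s)))"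
    (is "?I = _")
proof -
  define q where "q = (real CARD('n) + 2 * s) / 2"
  define m where "m = (real CARD('n) - 1) / 2"
  have q2: "real CARD('n) + 2 * s = 2 * q" by (simp add: q_def)
  have q: "q > 0" using s by (simp add: q_def add_nonneg_pos)
  have G: "ennreal (Gamma q) * ennreal (norm z powr (- (2 * q))) =
      (\<integral>\<^sup>+t. ennreal (indicator {0..} t * (t powr (q - 1) * exp (- t * (norm z)\<^sup>2))) \<partial>lborel)" if "x1 z > A" for z :: "real^'n::{finite,wellorder}"
  proof -
    have z: "norm z > 0" using that A abs_x1_le_norm[of z] by linarith
    have "((norm z)\<^sup>2) powr (- q) = norm z powr (- (2 * q))"
      using z by (simp flip: powr_numeral add: powr_powr)
    thus ?thesis using nn_integral_Gamma_scaled[of "(norm z)\<^sup>2" q] z q by (simp add: ennreal_mult')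
  qed
  have "ennreal (Gamma q) * ?I = (\<integral>\<^sup>+z. ennreal (Gamma q) * (ennreal (norm (z::real^'n::{finite,wellorder}) powr (- (2 * q))) * indicator {A<..} (x1 z)) \<partial>lborel)"
    unfolding q2 by (subst nn_integral_cmult) auto
  also have "\<dots> = (\<integral>\<^sup>+z. (\<integral>\<^sup>+t. indicator {A<..} (x1 z) * ennreal (indicator {0..} t * (t powr (q - 1) * exp (- t * (norm (z::real^'n::{finite,wellorder}))\<^sup>2))) \<partial>lborel) \<partial>lborel)"
    by (intro nn_integral_cong, subst nn_integral_cmult) (auto simp: G split: split_indicator)
  also have "\<dots> = (\<integral>\<^sup>+t. (\<integral>\<^sup>+z. indicator {A<..} (x1 z) * ennreal (indicator {0..} t * (t powr (q - 1) * exp (- t * (norm (z::real^'n::{finite,wellorder}))\<^sup>2))) \<partial>lborel) \<partial>lborel)"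
    by (rule lborel_pair.Fubini') measurable
  also have "\<dots> = (\<integral>\<^sup>+t. (\<integral>\<^sup>+w. ennreal (pi powr m) * (indicator {A<..} w * ennreal (indicator {0..} t * (t powr (q - m - 1) * exp (- t * w\<^sup>2)))) \<partial>lborel) \<partial>lborel)"
  proof (intro nn_integral_cong)
    fix t :: real
    show "(\<integral>\<^sup>+z. indicator {A<..} (x1 z) * ennreal (indicator {0..} t * (t powr (q - 1) * exp (- t * (norm (z::real^'n::{finite,wellorder}))\<^sup>2))) \<partial>lborel) =
      (\<integral>\<^sup>+w. ennreal (pi powr m) * (indicator {A<..} w * ennreal (indicator {0..} t * (t powr (q - m - 1) * exp (- t * w\<^sup>2)))) \<partial>lborel)"
    proof (cases "t > 0")
      case True
      have "(\<integral>\<^sup>+z. indicator {A<..} (x1 z) * ennreal (indicator {0..} t * (t powr (q - 1) * exp (- t * (norm (z::real^'n::{finite,wellorder}))\<^sup>2))) \<partial>lborel) =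
        (\<integral>\<^sup>+z. ennreal (t powr (q - 1)) * (indicator {A<..} (x1 z) * ennreal (exp (- t * (norm (z::real^'n::{finite,wellorder}))\<^sup>2))) \<partial>lborel)"
        using True by (intro nn_integral_cong) (auto simp: ennreal_mult' split: split_indicator)
      also have "\<dots> = ennreal (t powr (q - 1)) * (ennreal ((pi / t) powr m) *
          (\<integral>\<^sup>+w. indicator {A<..} w * ennreal (exp (- t * w\<^sup>2)) \<partial>lborel))"
        unfolding m_def nn_integral_gaussian_halfspace[OF True, symmetric] by (rule nn_integral_cmult) measurable
      also have "\<dots> = ennreal (t powr (q - 1) * (pi / t) powr m) *
          (\<integral>\<^sup>+w. indicator {A<..} w * ennreal (exp (- t * w\<^sup>2)) \<partial>lborel)"
        by (simp add: ennreal_mult' mult.assoc)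
      also have "t powr (q - 1) * (pi / t) powr m = pi powr m * t powr (q - m - 1)"
        using True by (simp add: powr_divide powr_diff mult_ac)
      also have "ennreal \<dots> * (\<integral>\<^sup>+w. indicator {A<..} w * ennreal (exp (- t * w\<^sup>2)) \<partial>lborel) =
        (\<integral>\<^sup>+w. ennreal (pi powr m * t powr (q - m - 1)) * (indicator {A<..} w * ennreal (exp (- t * w\<^sup>2))) \<partial>lborel)"
        by (subst nn_integral_cmult) auto
      also have "\<dots> = (\<integral>\<^sup>+w. ennreal (pi powr m) * (indicator {A<..} w * ennreal (indicator {0..} t * (t powr (q - m - 1) * exp (- t * w\<^sup>2)))) \<partial>lborel)"
        using True by (intro nn_integral_cong) (auto simp: ennreal_mult' mult_ac split: split_indicator)
      finally show ?thesis .
    next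
      case False
      hence "indicator {0..} t * (t powr r * e) = 0" for r e :: real by (auto split: split_indicator)
      thus ?thesis by (simp only: ennreal_0 mult_zero_right nn_integral_const mult_zero_left)
    qed
  qed
  also have "\<dots> = (\<integral>\<^sup>+w. (\<integral>\<^sup>+t. ennreal (pi powr m) * (indicator {A<..} w * ennreal (indicator {0..} t * (t powr (q - m - 1) * exp (- t * w\<^sup>2)))) \<partial>lborel) \<partial>lborel)"
    by (rule lborel_pair.Fubini') measurable
  also have "\<dots> = (\<integral>\<^sup>+w. ennreal (indicator {A..} w * (pi powr m * Gamma (q - m) * w powr (- 2 * (q - m)))) \<partial>lborel)"
  proof (rule nn_integral_cong_AE)
    have qm: "q - m > 0" using s by (simp add: q_def m_def diff_divide_distrib add_divide_distrib)
    have "(\<integral>\<^sup>+t. ennreal (pi powr m) * (indicator {A<..} w * ennreal (indicator {0..} t * (t powr (q - m - 1) * exp (- t * w\<^sup>2)))) \<partial>lborel) =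
      ennreal (indicator {A..} w * (pi powr m * Gamma (q - m) * w powr (- 2 * (q - m))))" if "w \<noteq> A" for w
    proof (cases "w > A")
      case True
      have "(\<integral>\<^sup>+t. ennreal (pi powr m) * (indicator {A<..} w * ennreal (indicator {0..} t * (t powr (q - m - 1) * exp (- t * w\<^sup>2)))) \<partial>lborel) =
        ennreal (pi powr m) * ennreal (Gamma (q - m) * (w\<^sup>2) powr (- (q - m)))"
        using True A qm nn_integral_Gamma_scaled[of "w\<^sup>2" "q - m"] by (subst nn_integral_cmult) simp_all
      also have "(w\<^sup>2) powr (- (q - m)) = w powr (- 2 * (q - m))"
        using True A by (simp flip: powr_numeral add: powr_powr)
      finally show ?thesis using True qm by (simp add: ennreal_mult' mult.assoc)
    qed (use that in auto)
    note * = this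
    show "AE w in lborel. (\<integral>\<^sup>+t. ennreal (pi powr m) * (indicator {A<..} w * ennreal (indicator {0..} t * (t powr (q - m - 1) * exp (- t * w\<^sup>2)))) \<partial>lborel) =
      ennreal (indicator {A..} w * (pi powr m * Gamma (q - m) * w powr (- 2 * (q - m))))"
      using AE_lborel_singleton[of A] by eventually_elim (rule *)
  qed
  also have "q - m = 1 / 2 + s" by (simp add: q_def m_def field_simps)
  also have "(\<integral>\<^sup>+w. ennreal (indicator {A..} w * (pi powr m * Gamma (1 / 2 + s) * w powr (- 2 * (1 / 2 + s)))) \<partial>lborel) =
    ennreal (pi powr m * Gamma (1 / 2 + s) * (- (A powr (- 2 * (1 / 2 + s) + 1)) / (- 2 * (1 / 2 + s) + 1)))"
    using s A by (intro nn_integral_has_integral_lebesgue has_integral_mult_right has_integral_powr_to_inf) auto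
  also have "- (A powr (- 2 * (1 / 2 + s) + 1)) / (- 2 * (1 / 2 + s) + 1) = A powr (- 2 * s) / (2 * s)"
    using s by (simp add: field_simps)
  finally have "ennreal (1 / Gamma q) * (ennreal (Gamma q) * ?I) =
    ennreal (1 / Gamma q) * ennreal (pi powr m * Gamma (1 / 2 + s) * (A powr (- 2 * s) / (2 * s)))" by simp
  moreover have "ennreal (1 / Gamma q) * (ennreal (Gamma q) * ?I) = ?I"
  proof -
    have "ennreal (1 / Gamma q) * ennreal (Gamma q) = 1"
      using Gamma_real_pos[OF q] by (simp flip: ennreal_mult')
    thus ?thesis by (simp only: mult.assoc[symmetric] mult_1)
  qed
  moreover have "ennreal (1 / Gamma q) * ennreal (pi powr m * Gamma (1 / 2 + s) * (A powr (- 2 * s) / (2 * s))) =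
    ennreal (pi powr m * Gamma (1 / 2 + s) / Gamma q * (A powr (- 2 * s) / (2 * s)))"
    using Gamma_real_pos[OF q] s by (subst ennreal_mult'[symmetric]) (simp_all add: mult_ac)
  ultimately show ?thesis by (simp add: q_def m_def)
qed

text \<open>The dependence on n cancels against \<open>c_ns\<close>, and the Gamma factor left over
  is the one in \<open>c_ns 1 s\<close>. This explains the zero-order coefficient of
  \<open>fraclap\<close>: it is twice the mass of the reflected kernel over the half-space, with the
  normalising constant.\<close>

lemma
  assumes s: "s > 0" and A: "A > 0"
  defines "f \<equiv> \<lambda>z::real^'n::{finite,wellorder}. norm z powr (- (real CARD('n) + 2 * s)) * indicator {A<..} (x1 z)"
  shows integrable_norm_powr_halfspace: "integrable lborel f"
    and integral_norm_powr_halfspace: "2 * c_ns CARD('n) s * (\<integral>z. f z \<partial>lborel) = c_ns 1 s / s * A powr (- 2 * s)"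
proof -
  let ?g = "(real CARD('n) + 2 * s) / 2"
  let ?R = "pi powr ((real CARD('n) - 1) / 2) * Gamma (1 / 2 + s) / Gamma ?g * (A powr (- 2 * s) / (2 * s))"
  have g: "Gamma ?g > 0" "Gamma (1 / 2 + s) > 0" using s by (auto intro!: Gamma_real_pos add_nonneg_pos)
  have "(\<integral>\<^sup>+z. ennreal (f z) \<partial>lborel) =
    (\<integral>\<^sup>+z. ennreal (norm (z::real^'n::{finite,wellorder}) powr (- (real CARD('n) + 2 * s))) * indicator {A<..} (x1 z) \<partial>lborel)"
    unfolding f_def by (intro nn_integral_cong) (auto split: split_indicator)
  hence *: "(\<integral>\<^sup>+z. ennreal (f z) \<partial>lborel) = ennreal ?R"
    unfolding nn_integral_norm_powr_halfspace[OF s A] .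
  have [measurable]: "f \<in> borel_measurable lborel" unfolding f_def by measurable
  have nn: "f z \<ge> 0" for z by (simp add: f_def)
  show "integrable lborel f" by (rule integrableI_nonneg) (use * nn in auto)
  have "(\<integral>z. f z \<partial>lborel) = ?R"
    by (rule integral_eq_nn_integral[THEN trans]) (use * nn g s in auto)
  hence "2 * c_ns CARD('n) s * (\<integral>z. f z \<partial>lborel) =
     4 powr s * (pi powr ((real CARD('n) - 1) / 2) / pi powr (real CARD('n) / 2)) * Gamma (1 / 2 + s) / Gamma (1 - s) * A powr (- 2 * s)"
  proof -
    define G where "G = Gamma ?g"
    define m where "m = pi powr ((real CARD('n) - 1) / 2)"
    have "c_ns CARD('n) s = s * 4 powr s * G / (pi powr (real CARD('n) / 2) * Gamma (1 - s))"
      by (simp add: c_ns_def G_def)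
    moreover have "G > 0" using g by (simp add: G_def)
    moreover assume "(\<integral>z. f z \<partial>lborel) = ?R"
    ultimately show ?thesis using s unfolding G_def[symmetric] m_def[symmetric] by simp
  qed
  also have "pi powr ((real CARD('n) - 1) / 2) / pi powr (real CARD('n) / 2) = 1 / pi powr (1 / 2)"
    by (simp add: diff_divide_distrib powr_diff)
  also have "4 powr s * (1 / pi powr (1 / 2)) * Gamma (1 / 2 + s) / Gamma (1 - s) * A powr (- 2 * s) = c_ns 1 s / s * A powr (- 2 * s)"
    using s by (simp add: c_ns_def add_divide_distrib)
  finally show "2 * c_ns CARD('n) s * (\<integral>z. f z \<partial>lborel) = c_ns 1 s / s * A powr (- 2 * s)" .
qed


section \<open>The weight and the far field\<close>

text \<open>The scaled distance \<open>t = norm (a - y) / r\<close> is at least 1 and satisfies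
  \<open>norm y \<le> 2 * R * t\<close>, so a single power of \<open>t\<close> controls the weight
  for bounded and for large \<open>y\<close> alike.\<close>

lemma ker_le_weight:
  fixes a y :: "real^'n::{finite,wellorder}"
  assumes a: "x1 a > 0" "norm a \<le> R" and y: "x1 y > 0" "r \<le> norm (a - y)" and p: "p > 1" and r: "0 < r" "r \<le> R"
  shows "ker p a y \<le> 2 * p * (1 + (2 * R) powr (p + 2)) * r powr (- p - 2) * x1 a * (x1 y / (1 + norm y powr (p + 2)))"
proof -
  define t where "t = norm (a - y) / r"
  have t: "t \<ge> 1" using y r by (simp add: t_def)
  have "norm y \<le> norm a + norm (a - y)"
    using norm_triangle_ineq4[of a "a - y"] by simp
  also have "\<dots> \<le> R * t + R * t"
  proof (intro add_mono)
    show "norm a \<le> R * t" using a t r mult_left_mono[OF t, of R] by linarith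
    show "norm (a - y) \<le> R * t" using r t mult_right_mono[of r R t] by (simp add: t_def)
  qed
  finally have "norm y \<le> 2 * R * t" by simp
  hence "norm y powr (p + 2) \<le> (2 * R * t) powr (p + 2)"
    using p by (intro powr_mono2) auto
  also have "\<dots> = (2 * R) powr (p + 2) * t powr (p + 2)"
    using r t by (intro powr_mult)
  finally have "1 + norm y powr (p + 2) \<le> 1 * t powr (p + 2) + (2 * R) powr (p + 2) * t powr (p + 2)"
    using ge_one_powr_ge_zero[of t "p + 2"] t p by (intro add_mono) auto
  hence le: "1 + norm y powr (p + 2) \<le> (1 + (2 * R) powr (p + 2)) * t powr (p + 2)"
    by (simp add: algebra_simps)
  have pos: "1 + norm y powr (p + 2) > 0" by (simp add: add_pos_nonneg)
  have "norm (a - y) powr (- p - 2) = r powr (- p - 2) / t powr (p + 2)"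
  proof -
    have "norm (a - y) = r * t" using r by (simp add: t_def)
    moreover have "t powr (- p - 2) = 1 / t powr (p + 2)"
      using powr_minus_divide[of t "p + 2"] by simp
    ultimately show ?thesis using r t by (simp add: powr_mult)
  qed
  also have "\<dots> \<le> r powr (- p - 2) * ((1 + (2 * R) powr (p + 2)) / (1 + norm y powr (p + 2)))"
  proof -
    have "t powr (p + 2) > 0" using t by simp
    hence "1 / t powr (p + 2) \<le> (1 + (2 * R) powr (p + 2)) / (1 + norm y powr (p + 2))"
      using pos le by (simp add: field_simps)
    from mult_left_mono[OF this, of "r powr (- p - 2)"] show ?thesis by simp
  qed
  finally have *: "norm (a - y) powr (- p - 2) \<le> r powr (- p - 2) * ((1 + (2 * R) powr (p + 2)) / (1 + norm y powr (p + 2)))" .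
  have "ker p a y \<le> 2 * p * x1 a * x1 y * norm (a - y) powr (- p - 2)"
    using y r by (intro ker_le2 a p) auto
  also have "\<dots> \<le> 2 * p * x1 a * x1 y * (r powr (- p - 2) * ((1 + (2 * R) powr (p + 2)) / (1 + norm y powr (p + 2))))"
    using a y p by (intro mult_left_mono *) auto
  also have "\<dots> = 2 * p * (1 + (2 * R) powr (p + 2)) * r powr (- p - 2) * x1 a * (x1 y / (1 + norm y powr (p + 2)))"
    by simp
  finally show ?thesis .
qed

text \<open>Near \<open>a\<close> the kernel only grows: replacing \<open>norm (a - y)\<close> by
  the larger reflected distance, itself at most \<open>norm a + norm y\<close>, costs nothing
  essential and gives a bound valid up to the singularity. Through it the mass of \<open>u\<close>
  enters the lower bound.\<close>

lemma ker_ge_weight: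
  fixes a y :: "real^'n::{finite,wellorder}"
  assumes a: "x1 a > 0" "norm a \<le> R" and y: "x1 y > 0" "y \<noteq> a" and p: "p > 1"
  shows "ker p a y \<ge> 2 / (2 powr (p + 2) * (1 + R powr (p + 2))) * x1 a * (x1 y / (1 + norm y powr (p + 2)))"
proof -
  let ?Z = "norm (reflect a - y)"
  have Z: "?Z > 0" by (rule norm_reflect_diff_pos[OF a(1) y(1) p])
  have "?Z \<le> norm a + norm y" using norm_triangle_ineq4[of "reflect a" y] by simp
  also have "\<dots> \<le> 2 * max R (norm y)" using a by simp
  finally have "?Z powr (p + 2) \<le> (2 * max R (norm y)) powr (p + 2)"
    using p by (intro powr_mono2) auto
  also have "\<dots> = 2 powr (p + 2) * (max R (norm y)) powr (p + 2)"
    by (intro powr_mult)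
  also have "\<dots> \<le> 2 powr (p + 2) * ((1 + R powr (p + 2)) * (1 + norm y powr (p + 2)))"
    by (intro mult_left_mono) (auto simp: max_def algebra_simps)
  finally have le: "?Z powr (p + 2) \<le> 2 powr (p + 2) * (1 + R powr (p + 2)) * (1 + norm y powr (p + 2))"
    by simp
  have pos: "1 + norm y powr (p + 2) > 0" "1 + R powr (p + 2) > 0" by (simp_all add: add_pos_nonneg)
  have "2 / (2 powr (p + 2) * (1 + R powr (p + 2))) * x1 a * (x1 y / (1 + norm y powr (p + 2))) =
    2 * x1 a * x1 y * (1 / (2 powr (p + 2) * (1 + R powr (p + 2)) * (1 + norm y powr (p + 2))))"
    by simp
  also have "\<dots> \<le> 2 * x1 a * x1 y * (1 / ?Z powr (p + 2))"
    using le pos Z a y by (intro mult_left_mono divide_left_mono) (auto intro!: mult_pos_pos)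
  also have "1 / ?Z powr (p + 2) = ?Z powr (- p) * ?Z powr (- 2)"
    using Z powr_minus_divide[of ?Z "p + 2"] by (simp flip: powr_add)
  also have "2 * x1 a * x1 y * (?Z powr (- p) * ?Z powr (- 2)) \<le> 2 * x1 a * x1 y * (norm (a - y) powr (- p) * ?Z powr (- 2))"
    using norm_le_norm_reflect_diff[OF a(1) y(1) p] a y p
    by (intro mult_left_mono mult_right_mono powr_mono2') auto
  also have "\<dots> \<le> ker p a y"
    using ker_ge[OF a(1) y(1) p y(2)] by (simp add: mult.assoc)
  finally show ?thesis .
qed

text \<open>For p = n + 2 s, the density in \<open>As_norm\<close> with the factor
  \<open>\<bar>u\<bar>\<close> taken out.\<close>

definition wgt :: "real \<Rightarrow> real^'n::{finite,wellorder} \<Rightarrow> real" where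
  "wgt p y = x1 y / (1 + norm y powr (p + 2))"

lemma borel_measurable_wgt [measurable]: "wgt p \<in> borel_measurable borel"
  unfolding wgt_def by measurable

lemma wgt_pos: "x1 y > 0 \<Longrightarrow> wgt p y > 0"
  unfolding wgt_def by (intro divide_pos_pos) (auto intro: add_pos_nonneg)

lemma set_integrable_lebesgueI:
  fixes f :: "'a::euclidean_space \<Rightarrow> real"
  shows "set_integrable lborel A f \<Longrightarrow> set_integrable lebesgue A f"
  unfolding set_integrable_def using integrable_completion[of _ lborel] borel_measurable_integrable by blast

lemma set_integral_lebesgue_eq:
  fixes f :: "'a::euclidean_space \<Rightarrow> real"
  assumes "set_borel_measurable lborel A f"
  shows "set_lebesgue_integral lebesgue A f = set_lebesgue_integral lborel A f"
  using assms unfolding set_lebesgue_integral_def set_borel_measurable_def by (rule integral_completion)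

text \<open>Linear growth is admissible: together with the factor \<open>x1 y\<close> the integrand
  then decays like |y| ^ (- p), and p > n. This covers constants, \<open>x1\<close> and the
  Gaussians.\<close>

lemma set_integrable_wgt:
  fixes g :: "real^'n::{finite,wellorder} \<Rightarrow> real"
  assumes p: "p > real CARD('n)" and [measurable]: "g \<in> borel_measurable borel"
    and g: "\<And>y. y \<in> halfspace \<Longrightarrow> \<bar>g y\<bar> \<le> B * (1 + norm y)"
  shows "set_integrable lebesgue halfspace (\<lambda>y. wgt p y * g y)"
proof (rule set_integrable_lebesgueI)
  have [measurable]: "ball 0 1 \<in> sets (borel :: (real^'n::{finite,wellorder}) measure)" by simp
  let ?b = "\<lambda>y::real^'n::{finite,wellorder}. 2 * \<bar>B\<bar> * (indicator (ball 0 1) y + norm y powr (- p) * indicator {z. 1 \<le> norm z} y)"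
  show "set_integrable lborel halfspace (\<lambda>y. wgt p y * g y)"
    unfolding set_integrable_def
  proof (rule Bochner_Integration.integrable_bound[where f = ?b])
    show "integrable lborel ?b"
      using p by (intro integrable_mult_right Bochner_Integration.integrable_add integrable_norm_powr_tail)
        (auto simp: emeasure_ball intro!: integrable_real_indicator)
    show "(\<lambda>x. indicat_real halfspace x *\<^sub>R (wgt p x * g x)) \<in> borel_measurable lborel"
      by measurable
    have "norm (indicat_real halfspace y *\<^sub>R (wgt p y * g y)) \<le> norm (?b y)" for y :: "real^'n::{finite,wellorder}"
    proof (cases "y \<in> halfspace")
      case True
      hence y: "x1 y > 0" "x1 y \<le> norm y" using abs_x1_le_norm[of y] by (auto simp: halfspace_def)
      have gB: "\<bar>g y\<bar> \<le> \<bar>B\<bar> * (1 + norm y)" by (rule order.trans[OF g[OF True]]) (auto intro!: mult_right_mono)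
      have "\<bar>wgt p y\<bar> * \<bar>g y\<bar> \<le> (norm y / (1 + norm y powr (p + 2))) * (\<bar>B\<bar> * (1 + norm y))"
        using y gB by (intro mult_mono) (auto simp: wgt_def abs_mult intro!: divide_right_mono divide_nonneg_nonneg add_nonneg_nonneg)
      also have "\<dots> = \<bar>B\<bar> * ((norm y * (1 + norm y)) / (1 + norm y powr (p + 2)))" by simp
      also have "\<dots> \<le> \<bar>B\<bar> * (2 * (indicator (ball 0 1) y + norm y powr (- p) * indicator {z. 1 \<le> norm z} y))"
      proof (intro mult_left_mono)
        show "(norm y * (1 + norm y)) / (1 + norm y powr (p + 2)) \<le> 2 * (indicator (ball 0 1) y + norm y powr (- p) * indicator {z. 1 \<le> norm z} y)"
        proof (cases "norm y < 1")
          case True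
          have "(norm y * (1 + norm y)) / (1 + norm y powr (p + 2)) \<le> 2 / 1"
            using True mult_mono[of "norm y" 1 "1 + norm y" 2] by (intro frac_le) auto
          thus ?thesis using True by simp
        next
          case False
          have "(norm y * (1 + norm y)) / (1 + norm y powr (p + 2)) \<le> (norm y * (2 * norm y)) / norm y powr (p + 2)"
            using False by (intro frac_le mult_left_mono) auto
          also have "\<dots> = 2 * norm y powr (- p)"
            using False y by (simp add: powr_add powr_minus field_simps power2_eq_square)
          finally show ?thesis using False by simp
        qed
      qed simp
      finally have "norm (indicat_real halfspace y *\<^sub>R (wgt p y * g y)) \<le> \<bar>B\<bar> * (2 * (indicator (ball 0 1) y + norm y powr (- p) * indicator {z. 1 \<le> norm z} y))"
        using True by (simp only: indicator_simps scaleR_one real_norm_def abs_mult)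
      moreover have nX: "norm (2 * \<bar>B\<bar> * X) = \<bar>B\<bar> * (2 * X)" if "X \<ge> 0" for X
        using that by (simp add: abs_mult)
      have "norm (?b y) = \<bar>B\<bar> * (2 * (indicator (ball 0 1) y + norm y powr (- p) * indicator {z. 1 \<le> norm z} y))"
        by (rule nX) (intro add_nonneg_nonneg mult_nonneg_nonneg, auto)
      ultimately show ?thesis by (simp only:)
    qed simp
    thus "AE y in lborel. norm (indicat_real halfspace y *\<^sub>R (wgt p y * g y)) \<le> norm (?b y)"
      by (intro AE_I2)
  qed
qed

lemma ker_far:
  fixes a :: "real^'n::{finite,wellorder}" and f :: "real^'n::{finite,wellorder} \<Rightarrow> real"
  assumes p: "p > 1" and a: "x1 a > 0" "norm a \<le> R" and r: "0 < r" "r \<le> R"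
    and f: "set_integrable lebesgue halfspace (\<lambda>y. wgt p y * f y)"
  shows set_integrable_ker: "set_integrable lebesgue (halfspace - ball a r) (\<lambda>y. ker p a y * f y)"
    and set_integral_ker_le: "(\<And>y. y \<in> halfspace \<Longrightarrow> f y \<ge> 0) \<Longrightarrow>
      set_lebesgue_integral lebesgue (halfspace - ball a r) (\<lambda>y. ker p a y * f y) \<le>
      2 * p * (1 + (2 * R) powr (p + 2)) * r powr (- p - 2) * x1 a * set_lebesgue_integral lebesgue halfspace (\<lambda>y. wgt p y * f y)"
proof -
  let ?C = "2 * p * (1 + (2 * R) powr (p + 2)) * r powr (- p - 2) * x1 a"
  let ?S = "halfspace - ball a r"
  have [measurable]: "ball a r \<in> sets borel" by simp
  have Smeas: "?S \<in> sets lebesgue" by (simp add: sets_completionI_sets)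
  have C: "?C \<ge> 0" using p a by (intro mult_nonneg_nonneg) (auto intro: add_nonneg_nonneg)
  have k: "0 \<le> ker p a y" "ker p a y \<le> ?C * wgt p y" if "y \<in> ?S" for y
  proof -
    have "y \<noteq> a" "x1 y > 0" "r \<le> norm (a - y)" using that r by (auto simp: halfspace_def dist_norm)
    thus "0 \<le> ker p a y" "ker p a y \<le> ?C * wgt p y"
      using ker_le_weight[OF a _ _ p r, of y] ker_nonneg[OF a(1) _ p, of y] by (auto simp: wgt_def)
  qed
  \<comment> \<open>A bounded Borel multiplier: the kernel integrand is \<open>m\<close> times the
    weighted integrand, so integrability and Lebesgue measurability are inherited from the
    hypothesis on \<open>f\<close>.\<close>
  define m where "m = (\<lambda>y. indicator ?S y * (ker p a y / wgt p y))"
  have [measurable]: "m \<in> borel_measurable borel" unfolding m_def by measurable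
  hence m_leb: "m \<in> borel_measurable lebesgue" by (intro measurable_completion) simp
  have eq: "indicat_real ?S y *\<^sub>R (ker p a y * f y) = m y * (indicat_real halfspace y *\<^sub>R (wgt p y * f y))" for y
    using wgt_pos[of y p] by (auto simp: m_def halfspace_def split: split_indicator)
  have mb: "\<bar>m y\<bar> \<le> ?C" for y
    using k[of y] C wgt_pos[of y p] by (auto simp: m_def halfspace_def abs_mult field_simps split: split_indicator)
  have fi: "integrable lebesgue (\<lambda>y. indicat_real halfspace y *\<^sub>R (wgt p y * f y))"
    using f unfolding set_integrable_def .
  show *: "set_integrable lebesgue ?S (\<lambda>y. ker p a y * f y)"
    unfolding set_integrable_def eq
  proof (rule Bochner_Integration.integrable_bound[where f = "\<lambda>y. ?C * (indicat_real halfspace y *\<^sub>R (wgt p y * f y))"])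
    show "integrable lebesgue (\<lambda>y. ?C * (indicat_real halfspace y *\<^sub>R (wgt p y * f y)))"
      using fi by (rule integrable_mult_right)
    show "(\<lambda>x. m x * (indicat_real halfspace x *\<^sub>R (wgt p x * f x))) \<in> borel_measurable lebesgue"
      using m_leb borel_measurable_integrable[OF fi] by (rule borel_measurable_times)
    show "AE y in lebesgue. norm (m y * (indicat_real halfspace y *\<^sub>R (wgt p y * f y))) \<le> norm (?C * (indicat_real halfspace y *\<^sub>R (wgt p y * f y)))"
    proof (intro AE_I2)
      have "norm (m y * X) \<le> norm (D * X)" if "\<bar>m y\<bar> \<le> D" "D \<ge> 0" for y D X
        using mult_right_mono[OF that(1), of "\<bar>X\<bar>"] that(2) by (simp add: abs_mult)
      from this[OF mb C] show "norm (m y * (indicat_real halfspace y *\<^sub>R (wgt p y * f y))) \<le> norm (?C * (indicat_real halfspace y *\<^sub>R (wgt p y * f y)))" for y .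
    qed
  qed
  assume nn: "\<And>y. y \<in> halfspace \<Longrightarrow> f y \<ge> 0"
  have "set_lebesgue_integral lebesgue ?S (\<lambda>y. ker p a y * f y) \<le> (\<integral>y. ?C * (indicat_real halfspace y *\<^sub>R (wgt p y * f y)) \<partial>lebesgue)"
    unfolding set_lebesgue_integral_def
  proof (rule integral_mono)
    show "integrable lebesgue (\<lambda>y. indicat_real ?S y *\<^sub>R (ker p a y * f y))" using * unfolding set_integrable_def .
    show "integrable lebesgue (\<lambda>y. ?C * (indicat_real halfspace y *\<^sub>R (wgt p y * f y)))"
      using fi by (rule integrable_mult_right)
    fix y
    have "m y \<le> ?C" using mb[of y] by simp
    thus "indicat_real ?S y *\<^sub>R (ker p a y * f y) \<le> ?C * (indicat_real halfspace y *\<^sub>R (wgt p y * f y))"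
      unfolding eq using nn[of y] wgt_pos[of y p]
      by (intro mult_right_mono) (auto simp: halfspace_def split: split_indicator)
  qed
  also have "\<dots> = ?C * set_lebesgue_integral lebesgue halfspace (\<lambda>y. wgt p y * f y)"
    unfolding set_lebesgue_integral_def by simp
  finally show "set_lebesgue_integral lebesgue ?S (\<lambda>y. ker p a y * f y) \<le> ?C * set_lebesgue_integral lebesgue halfspace (\<lambda>y. wgt p y * f y)" .
qed


section \<open>Odd Gaussians\<close>

text \<open>For p = n + 2 s, its limit as \<open>\<epsilon>\<close> tends to 0 from the right is the
  principal value inside \<open>fraclap\<close>; the zero-order term is kept apart.\<close>

definition trunc :: "real \<Rightarrow> (real^'n::{finite,wellorder} \<Rightarrow> real) \<Rightarrow> real^'n::{finite,wellorder} \<Rightarrow> real \<Rightarrow> real" where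
  "trunc p u x \<epsilon> = set_lebesgue_integral lebesgue (halfspace - ball x \<epsilon>) (\<lambda>y. ker p x y * (u x - u y))"

definition gau :: "real \<Rightarrow> real^'n::{finite,wellorder} \<Rightarrow> real" where
  "gau l x = x1 x * exp (- l * (norm x)\<^sup>2)"

lemma borel_measurable_gau [measurable]: "gau l \<in> borel_measurable borel"
  unfolding gau_def by measurable

lemma gau_reflect [simp]: "gau l (reflect x) = - gau l x"
  by (simp add: gau_def)

lemma abs_gau_le:
  assumes l: "l > 0"
  shows "\<bar>gau l x\<bar> \<le> 1 + 1 / l"
proof -
  let ?t = "norm x"
  have "?t \<le> 1 + ?t\<^sup>2" using sum_squares_bound[of ?t 1] norm_ge_zero[of x] by (simp del: norm_ge_zero)
  also have "\<dots> \<le> (1 + 1 / l) * (1 + l * ?t\<^sup>2)"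
    using l by (simp add: field_simps)
  also have "\<dots> \<le> (1 + 1 / l) * exp (l * ?t\<^sup>2)"
    using l exp_ge_add_one_self[of "l * ?t\<^sup>2"] by (intro mult_left_mono) auto
  finally have "?t * exp (- l * ?t\<^sup>2) \<le> 1 + 1 / l"
    by (simp add: exp_minus field_simps)
  moreover have "\<bar>gau l x\<bar> \<le> ?t * exp (- l * ?t\<^sup>2)"
    unfolding gau_def abs_mult using abs_x1_le_norm[of x] by (auto intro!: mult_right_mono)
  ultimately show ?thesis by simp
qed

lemma abs_exp_diff_le:
  fixes u v m :: real
  assumes "\<bar>u\<bar> \<le> m" "\<bar>v\<bar> \<le> m"
  shows "\<bar>exp u - exp v\<bar> \<le> \<bar>u - v\<bar> * exp m"
proof -
  have *: "exp u - exp v \<le> (u - v) * exp m" if "v \<le> u" "\<bar>u\<bar> \<le> m" for u v :: real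
  proof -
    have "exp u * (1 + (v - u)) \<le> exp u * exp (v - u)"
      by (intro mult_left_mono exp_ge_add_one_self) simp
    hence "exp u - exp v \<le> (u - v) * exp u" by (simp flip: exp_add add: algebra_simps)
    also have "\<dots> \<le> (u - v) * exp m" using that by (intro mult_left_mono) auto
    finally show ?thesis .
  qed
  show ?thesis
  proof (cases "v \<le> u")
    case True thus ?thesis using *[of v u] assms by simp
  next
    case False thus ?thesis using *[of u v] assms by simp
  qed
qed

text \<open>Averaging over the four images of \<open>z\<close> under \<open>z \<mapsto> - z\<close> and \<open>z \<mapsto> reflect z\<close> is what produces
  the factor \<open>x1 a\<close>; the usual second difference alone is not small near the hyperplane.\<close>

lemma gau_fourth_difference:
  fixes a z :: "real^'n::{finite,wellorder}"
  assumes l: "l > 0" and a: "x1 a \<ge> 0" "norm a \<le> R"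
  defines "g \<equiv> 4 * gau l a - gau l (a + z) - gau l (a - z) - gau l (a + reflect z) - gau l (a - reflect z)"
  defines "C \<equiv> 4 * (1 + l + 2 * l\<^sup>2 * R\<^sup>2) + 8 * l * (1 + 2 * R\<^sup>2 + 2 / l)"
  shows "\<bar>g\<bar> \<le> C * x1 a * (norm z)\<^sup>2" and "\<bar>g\<bar> \<le> C * x1 a"
proof -
  \<comment> \<open>\<open>m\<close> bounds the exponents at all four images of \<open>z\<close>.
    The growth of \<open>exp m\<close> is harmless because \<open>E * exp m\<close> is again a
    Gaussian, now in \<open>norm z - norm a\<close>, and hence at most 1.\<close>
  define A E t where "A = exp (- l * (norm a)\<^sup>2)" and "E = exp (- l * (norm a)\<^sup>2 - l * (norm z)\<^sup>2)" and "t = norm z"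
  define \<alpha> \<gamma> m where "\<alpha> = 2 * l * (a \<bullet> z)" and "\<gamma> = 2 * l * (a \<bullet> reflect z)" and "m = 2 * l * (norm a * t)"
  define c where "c = (\<lambda>\<beta>::real. (exp \<beta> + exp (- \<beta>)) / 2)"
  have gp: "gau l (a + w) = (x1 a + x1 w) * (E * exp (- (2 * l * (a \<bullet> w))))" if "norm w = norm z" for w
  proof -
    have "(norm (a + w))\<^sup>2 = (norm a)\<^sup>2 + (norm z)\<^sup>2 + 2 * (a \<bullet> w)"
      unfolding that[symmetric] by (simp add: power2_norm_eq_inner inner_add_left inner_add_right inner_commute[of w a])
    thus ?thesis by (simp add: gau_def E_def flip: exp_add) (simp add: algebra_simps)
  qed
  have ag: "\<alpha> - \<gamma> = 4 * l * x1 a * x1 z"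
    unfolding \<alpha>_def \<gamma>_def inner_commute[of a "reflect z"] inner_reflect by (simp add: inner_commute[of z a] algebra_simps)
  \<comment> \<open>The first group carries \<open>x1 a\<close> explicitly. In the second, pairing
    the exponentials of \<open>\<alpha>\<close> with those of \<open>\<gamma>\<close> exposes
    \<open>\<alpha> - \<gamma> = 4 * l * x1 a * x1 z\<close>, which supplies the factor.\<close>
  have geq: "g = 2 * x1 a * ((A - E * c \<alpha>) + (A - E * c \<gamma>)) + E * x1 z * ((exp \<alpha> - exp \<gamma>) - (exp (- \<alpha>) - exp (- \<gamma>)))"
  proof -
    have gz: "gau l (a + z) = (x1 a + x1 z) * (E * exp (- \<alpha>))" "gau l (a - z) = (x1 a - x1 z) * (E * exp \<alpha>)"
      "gau l (a + reflect z) = (x1 a - x1 z) * (E * exp (- \<gamma>))" "gau l (a - reflect z) = (x1 a + x1 z) * (E * exp \<gamma>)"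
      using gp[of z] gp[of "- z"] gp[of "reflect z"] gp[of "- reflect z"] by (simp_all add: \<alpha>_def \<gamma>_def)
    have "gau l a = x1 a * A" by (simp add: gau_def A_def)
    thus ?thesis unfolding g_def gz c_def by (simp add: field_simps)
  qed
  have am: "\<bar>\<alpha>\<bar> \<le> m" "\<bar>\<gamma>\<bar> \<le> m"
    using Cauchy_Schwarz_ineq2[of a z] Cauchy_Schwarz_ineq2[of a "reflect z"] l
    by (simp_all add: \<alpha>_def \<gamma>_def m_def t_def abs_mult)
  have Em: "E * exp m = exp (- l * (t - norm a)\<^sup>2)"
    by (simp add: E_def m_def t_def power2_eq_square algebra_simps flip: exp_add)
  have Em1: "E * exp m \<le> 1" unfolding Em using l by simp
  have "R \<ge> 0" using a(2) norm_ge_zero[of a] by linarith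
  \<comment> \<open>\<open>norm z\<close> is split into \<open>norm a\<close> and the deviation from
    it; the Gaussian absorbs the square of the deviation.\<close>
  have Em2: "E * exp m * t\<^sup>2 \<le> 2 * R\<^sup>2 + 2 / l"
  proof -
    let ?d = "t - norm a"
    have "t\<^sup>2 \<le> 2 * (norm a)\<^sup>2 + 2 * ?d\<^sup>2"
      using sum_squares_bound[of "norm a" ?d] by (simp add: power2_eq_square algebra_simps)
    also have "\<dots> \<le> 2 * R\<^sup>2 + 2 * ?d\<^sup>2" using a by (intro add_right_mono mult_left_mono power_mono) auto
    finally have "E * exp m * t\<^sup>2 \<le> E * exp m * (2 * R\<^sup>2 + 2 * ?d\<^sup>2)"
      by (intro mult_left_mono) (auto simp: E_def)
    also have "\<dots> = E * exp m * (2 * R\<^sup>2) + 2 * (?d\<^sup>2 * exp (- l * ?d\<^sup>2))"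
      unfolding Em by (simp add: algebra_simps)
    also have "\<dots> \<le> 1 * (2 * R\<^sup>2) + 2 * (1 / l)"
    proof (intro add_mono mult_right_mono mult_left_mono Em1)
      have "l * ?d\<^sup>2 \<le> exp (l * ?d\<^sup>2)" using exp_ge_add_one_self[of "l * ?d\<^sup>2"] by linarith
      thus "?d\<^sup>2 * exp (- l * ?d\<^sup>2) \<le> 1 / l" using l by (simp add: exp_minus field_simps)
    qed auto
    finally show ?thesis by simp
  qed
  have A: "0 < A" "A \<le> 1" using l by (auto simp: A_def)
  have E: "E = A * exp (- l * t\<^sup>2)" "E > 0" by (simp_all add: E_def A_def t_def flip: exp_add)
  have c: "\<bar>A - E * c \<beta>\<bar> \<le> 1" "\<bar>A - E * c \<beta>\<bar> \<le> (l + 2 * l\<^sup>2 * R\<^sup>2) * t\<^sup>2" if b: "\<bar>\<beta>\<bar> \<le> m" for \<beta>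
  proof -
    have "exp \<beta> \<le> exp m" "exp (- \<beta>) \<le> exp m" using b by auto
    from add_mono[OF this] have "c \<beta> \<le> exp m" by (simp add: c_def)
    moreover have "c \<beta> \<ge> 0" by (simp add: c_def add_nonneg_nonneg)
    ultimately have "0 \<le> E * c \<beta>" "E * c \<beta> \<le> E * exp m" using E(2) by (auto intro: mult_left_mono)
    thus "\<bar>A - E * c \<beta>\<bar> \<le> 1" using A Em1 by linarith
    \<comment> \<open>\<open>2 * (c \<beta> - 1)\<close> is a perfect square, so the hyperbolic
      cosine \<open>c \<beta>\<close> differs from 1 only quadratically in
      \<open>\<beta>\<close>.\<close>
    have "(exp (\<beta> / 2) - exp (- \<beta> / 2))\<^sup>2 \<le> (\<bar>\<beta>\<bar> * exp (m / 2))\<^sup>2"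
      using abs_exp_diff_le[of "\<beta> / 2" "m / 2" "- \<beta> / 2"] b by (subst abs_le_square_iff[symmetric]) (simp add: abs_mult)
    also have "\<dots> = \<beta>\<^sup>2 * exp m"
      by (simp add: power_mult_distrib flip: exp_of_nat_mult)
    also have sq: "(exp (\<beta> / 2) - exp (- \<beta> / 2))\<^sup>2 = 2 * (c \<beta> - 1)"
    proof -
      have "exp (\<beta> / 2) * exp (\<beta> / 2) = exp \<beta>" "exp (- \<beta> / 2) * exp (- \<beta> / 2) = exp (- \<beta>)"
        "exp (\<beta> / 2) * exp (- \<beta> / 2) = 1" by (simp_all flip: exp_add)
      hence "(exp (\<beta> / 2) - exp (- \<beta> / 2))\<^sup>2 = exp \<beta> + exp (- \<beta>) - 2"
        by (simp only: power2_eq_square left_diff_distrib right_diff_distrib mult.commute[of "exp (- \<beta> / 2)" "exp (\<beta> / 2)"])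
      thus ?thesis by (simp add: c_def)
    qed
    finally have cm: "c \<beta> - 1 \<le> \<beta>\<^sup>2 / 2 * exp m" by simp
    have "E * (c \<beta> - 1) \<le> \<beta>\<^sup>2 / 2 * (E * exp m)"
      using mult_left_mono[OF cm, of E] E(2) by (simp only: less_imp_le mult_ac)
    also have "\<dots> \<le> \<beta>\<^sup>2 / 2 * 1" using Em1 by (intro mult_left_mono) auto
    also have "\<beta>\<^sup>2 \<le> m\<^sup>2" using b by (simp add: abs_le_square_iff[symmetric])
    also have "m\<^sup>2 / 2 * 1 = 2 * l\<^sup>2 * ((norm a)\<^sup>2 * t\<^sup>2)" by (simp add: m_def power_mult_distrib)
    also have "\<dots> \<le> 2 * l\<^sup>2 * (R\<^sup>2 * t\<^sup>2)"
      using a \<open>R \<ge> 0\<close> by (intro mult_left_mono mult_right_mono power_mono) auto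
    finally have u: "E * (c \<beta> - 1) \<le> 2 * l\<^sup>2 * R\<^sup>2 * t\<^sup>2" by simp
    have "c \<beta> \<ge> 1"
    proof -
      have "0 \<le> (exp (\<beta> / 2) - exp (- \<beta> / 2))\<^sup>2" by simp
      thus ?thesis unfolding sq by simp
    qed
    hence u0: "E * (c \<beta> - 1) \<ge> 0" using E(2) by simp
    have "A - E = A * (1 - exp (- l * t\<^sup>2))" by (simp add: E algebra_simps)
    also have "\<dots> \<le> 1 * (l * t\<^sup>2)" using A l exp_ge_add_one_self[of "- l * t\<^sup>2"] by (intro mult_mono) auto
    finally have v: "A - E \<le> l * t\<^sup>2" by simp
    have v0: "A - E \<ge> 0" using A l by (simp add: E)
    have "0 \<le> l * t\<^sup>2" "0 \<le> 2 * l\<^sup>2 * R\<^sup>2 * t\<^sup>2" using l by auto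
    hence "\<bar>(A - E) - E * (c \<beta> - 1)\<bar> \<le> l * t\<^sup>2 + 2 * l\<^sup>2 * R\<^sup>2 * t\<^sup>2"
      using u u0 v v0 by linarith
    thus "\<bar>A - E * c \<beta>\<bar> \<le> (l + 2 * l\<^sup>2 * R\<^sup>2) * t\<^sup>2"
      by (simp add: algebra_simps)
  qed
  have z1: "\<bar>x1 z\<bar> \<le> t" using abs_x1_le_norm by (simp add: t_def)
  have sec: "\<bar>E * x1 z * ((exp \<alpha> - exp \<gamma>) - (exp (- \<alpha>) - exp (- \<gamma>)))\<bar> \<le> x1 a * (8 * l * (E * exp m * t\<^sup>2))"
  proof -
    have "\<bar>(exp \<alpha> - exp \<gamma>) - (exp (- \<alpha>) - exp (- \<gamma>))\<bar> \<le> \<bar>\<alpha> - \<gamma>\<bar> * exp m + \<bar>\<alpha> - \<gamma>\<bar> * exp m"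
    proof -
      have "\<bar>exp (- \<alpha>) - exp (- \<gamma>)\<bar> \<le> \<bar>\<alpha> - \<gamma>\<bar> * exp m"
        using abs_exp_diff_le[of "- \<alpha>" m "- \<gamma>"] am by (simp add: abs_minus_commute)
      thus ?thesis using abs_exp_diff_le[OF am] by linarith
    qed
    also have "\<dots> = 8 * l * x1 a * \<bar>x1 z\<bar> * exp m" unfolding ag using l a by (simp add: abs_mult)
    finally have "E * \<bar>x1 z\<bar> * \<bar>(exp \<alpha> - exp \<gamma>) - (exp (- \<alpha>) - exp (- \<gamma>))\<bar> \<le> E * \<bar>x1 z\<bar> * (8 * l * x1 a * \<bar>x1 z\<bar> * exp m)"
      using E(2) by (intro mult_left_mono) auto
    also have "\<dots> = x1 a * (8 * l * (E * exp m * \<bar>x1 z\<bar>\<^sup>2))" by (simp add: power2_eq_square)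
    also have "\<dots> \<le> x1 a * (8 * l * (E * exp m * t\<^sup>2))"
      using a l E(2) z1 by (intro mult_left_mono power_mono) auto
    finally show ?thesis using E(2) by (simp add: abs_mult)
  qed
  have bound: "\<bar>g\<bar> \<le> 2 * x1 a * (X + X) + x1 a * (8 * l * (E * exp m * t\<^sup>2))"
    if "\<bar>A - E * c \<alpha>\<bar> \<le> X" "\<bar>A - E * c \<gamma>\<bar> \<le> X" for X
  proof -
    have "\<bar>g\<bar> \<le> \<bar>2 * x1 a * ((A - E * c \<alpha>) + (A - E * c \<gamma>))\<bar> + x1 a * (8 * l * (E * exp m * t\<^sup>2))"
      unfolding geq using sec by linarith
    also have "\<bar>2 * x1 a * ((A - E * c \<alpha>) + (A - E * c \<gamma>))\<bar> \<le> 2 * x1 a * (X + X)"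
      unfolding abs_mult using that a by (intro mult_mono) auto
    finally show ?thesis by simp
  qed
  have C0: "0 \<le> l * (1 + 2 * R\<^sup>2 + 2 / l)" "0 \<le> l + 2 * l\<^sup>2 * R\<^sup>2" using l by (auto intro!: mult_nonneg_nonneg add_nonneg_nonneg)
  have "\<bar>g\<bar> \<le> 2 * x1 a * ((l + 2 * l\<^sup>2 * R\<^sup>2) * t\<^sup>2 + (l + 2 * l\<^sup>2 * R\<^sup>2) * t\<^sup>2) + x1 a * (8 * l * (1 * t\<^sup>2))"
    using a l Em1 by (intro order.trans[OF bound[OF c(2)[OF am(1)] c(2)[OF am(2)]]] add_left_mono mult_left_mono mult_right_mono) auto
  also have "\<dots> = (4 * (l + 2 * l\<^sup>2 * R\<^sup>2) + 8 * l) * (x1 a * t\<^sup>2)" by (simp add: algebra_simps)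
  also have "\<dots> \<le> C * (x1 a * t\<^sup>2)"
    using a l by (intro mult_right_mono) (auto simp: C_def algebra_simps)
  finally show "\<bar>g\<bar> \<le> C * x1 a * (norm z)\<^sup>2" by (simp add: t_def mult.assoc)
  have "\<bar>g\<bar> \<le> 2 * x1 a * (1 + 1) + x1 a * (8 * l * (2 * R\<^sup>2 + 2 / l))"
    using a l Em2 by (intro order.trans[OF bound[OF c(1)[OF am(1)] c(1)[OF am(2)]]] add_left_mono mult_left_mono) auto
  also have "\<dots> = (4 + 8 * l * (2 * R\<^sup>2 + 2 / l)) * x1 a" by (simp add: algebra_simps)
  also have "\<dots> \<le> C * x1 a"
    using a l by (intro mult_right_mono) (auto simp: C_def algebra_simps)
  finally show "\<bar>g\<bar> \<le> C * x1 a" .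
qed


section \<open>Unfolding the operator on odd functions to the whole space\<close>

lemma AE_x1_nonzero: "AE y in lborel. x1 (y::real^'n::{finite,wellorder}) \<noteq> 0"
proof -
  let ?N = "{y::real^'n::{finite,wellorder}. y \<bullet> axis idx1 1 = 0}"
  have "negligible ?N" by (rule negligible_standard_hyperplane) (simp add: axis_in_Basis_iff)
  hence "?N \<in> null_sets (completion lborel)" by (simp add: negligible_iff_null_sets)
  moreover have "?N \<in> sets lborel" by measurable
  ultimately have "?N \<in> null_sets lborel" using null_sets_completion_iff by blast
  thus ?thesis by (rule AE_I') (auto simp: x1_inner)
qed

lemma integrable_powr_bounded:
  fixes b :: "real^'n::{finite,wellorder} \<Rightarrow> real"
  assumes p: "p > real CARD('n)" and e: "e > 0" and [measurable]: "b \<in> borel_measurable borel" and b: "\<And>z. \<bar>b z\<bar> \<le> B"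
  shows "integrable lborel (\<lambda>z. norm z powr (- p) * indicator {z. e \<le> norm z} z * b z)"
proof (rule Bochner_Integration.integrable_bound)
  show "integrable lborel (\<lambda>z::real^'n::{finite,wellorder}. B * (norm z powr (- p) * indicator {z. e \<le> norm z} z))"
    using p e by (intro integrable_mult_right integrable_norm_powr_tail) auto
  have "norm (norm z powr (- p) * indicator {z. e \<le> norm z} z * b z) \<le> norm (B * (norm z powr (- p) * indicator {z. e \<le> norm z} z))" for z
    using b[of z] by (auto simp: abs_mult mult.commute[of B] intro!: mult_left_mono order.trans[OF _ abs_ge_self] split: split_indicator)
  thus "AE z in lborel. norm (norm z powr (- p) * indicator {z. e \<le> norm z} z * b z) \<le> norm (B * (norm z powr (- p) * indicator {z. e \<le> norm z} z))"
    by (intro AE_I2)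
qed measurable

lemma abs_integral_ball_le:
  fixes f :: "'a::euclidean_space \<Rightarrow> real"
  assumes [measurable]: "f \<in> borel_measurable borel" and e: "0 \<le> e" and f: "\<And>y. y \<in> ball c e \<Longrightarrow> \<bar>f y\<bar> \<le> M"
  shows "integrable lborel (\<lambda>y. indicator (ball c e) y * f y)"
    and "\<bar>\<integral>y. indicator (ball c e) y * f y \<partial>lborel\<bar> \<le> M * (unit_ball_vol DIM('a) * e ^ DIM('a))"
proof -
  have [measurable]: "ball c e \<in> sets borel" by simp
  have i: "integrable lborel (\<lambda>y. M * indicator (ball c e) y)"
    by (intro integrable_mult_right integrable_real_indicator) (auto simp: emeasure_ball e)
  have b: "norm (indicator (ball c e) y * f y) \<le> M * indicator (ball c e) y" for y
    using f[of y] by (auto split: split_indicator)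
  show ii: "integrable lborel (\<lambda>y. indicator (ball c e) y * f y)"
    by (rule Bochner_Integration.integrable_bound[OF i]) (use b in \<open>auto intro!: AE_I2 order.trans[OF _ abs_ge_self]\<close>)
  have "\<bar>\<integral>y. indicator (ball c e) y * f y \<partial>lborel\<bar> \<le> (\<integral>y. M * indicator (ball c e) y \<partial>lborel)"
    using Bochner_Integration.integral_norm_bound_integral[OF ii i] b by simp
  also have "\<dots> = M * (unit_ball_vol DIM('a) * e ^ DIM('a))"
    using e by (simp add: content_ball)
  finally show "\<bar>\<integral>y. indicator (ball c e) y * f y \<partial>lborel\<bar> \<le> M * (unit_ball_vol DIM('a) * e ^ DIM('a))" .
qed

text \<open>Unfolding the half-space integral of an odd function to the whole space: the zero-order term of the
  operator is exactly what the reflected kernel contributes.\<close>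

lemma trunc_unfold:
  fixes h :: "real^'n::{finite,wellorder} \<Rightarrow> real" and s :: real
  defines "p \<equiv> real CARD('n) + 2 * s"
  assumes s: "0 < s" and [measurable]: "h \<in> borel_measurable borel" and hB: "\<And>y. \<bar>h y\<bar> \<le> B"
    and odd: "\<And>y. h (reflect y) = - h y" and a: "x1 a > 0" and e: "0 < e" "e < x1 a"
  defines "F \<equiv> \<lambda>z. norm z powr (- p) * indicator {z. e \<le> norm z} z * (h a - h (a + z))"
  shows "\<bar>c_ns CARD('n) s * trunc p h a e + c_ns 1 s / s * h a * x1 a powr (- 2 * s) - c_ns CARD('n) s * (\<integral>z. F z \<partial>lborel)\<bar>
    \<le> \<bar>c_ns CARD('n) s\<bar> * (4 * B * x1 a powr (- p) * (unit_ball_vol CARD('n) * e ^ CARD('n)))"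
proof -
  have p: "p > real CARD('n)" "p > 0" using s by (auto simp: p_def intro: add_nonneg_pos)
  let ?B = "ball a e" and ?B' = "ball (reflect a) e"
  have [measurable]: "?B \<in> sets borel" "?B' \<in> sets borel" by simp_all
  have B0: "B \<ge> 0" using hB[of a] by linarith
  have [measurable]: "F \<in> borel_measurable borel" unfolding F_def by measurable
  \<comment> \<open>Oddness gives \<open>- (h a - h y) = (h a - h (reflect y)) - 2 * h a\<close>.
    \<open>Aq\<close> is the direct part; against the reflected kernel the first summand becomes
    \<open>Bq\<close> at the reflected point and the second becomes \<open>Tq\<close>.
    \<open>Dq\<close> cancels \<open>Tq\<close> inside the removed ball, where the left-hand side
    vanishes.\<close>
  define Aq where "Aq = (\<lambda>y. indicator halfspace y * F (y - a))"
  define Bq where "Bq = (\<lambda>y. indicator {y. x1 y < 0} y * indicator (- ?B') y * F (y - a))"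
  define Tq where "Tq = (\<lambda>y. indicator halfspace y * norm (reflect a - y) powr (- p))"
  define Dq where "Dq = (\<lambda>y. indicator ?B y * (2 * h a * norm (reflect a - y) powr (- p)))"
  have F_int: "integrable lborel F"
    unfolding F_def
  proof (rule integrable_powr_bounded[OF p(1) e(1), where B = "B + B"])
    fix z show "\<bar>h a - h (a + z)\<bar> \<le> B + B" using hB[of a] hB[of "a + z"] by linarith
  qed measurable
  have Fs_int: "integrable lborel (\<lambda>y. F (y - a))"
    using F_int integrable_shift[of F "- a"] by simp
  have A_int: "integrable lborel Aq" unfolding Aq_def
    by (rule Bochner_Integration.integrable_bound[OF Fs_int]) (auto split: split_indicator)
  have B_int: "integrable lborel Bq" unfolding Bq_def
    by (rule Bochner_Integration.integrable_bound[OF Fs_int]) (auto split: split_indicator)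
  have T: "integrable lborel Tq \<and> (\<integral>y. Tq y \<partial>lborel) = (\<integral>z. norm z powr (- p) * indicator {x1 a<..} (x1 (z::real^'n::{finite,wellorder})) \<partial>lborel)"
  proof -
    have [measurable]: "Tq \<in> borel_measurable borel" unfolding Tq_def by measurable
    have eq: "Tq (reflect a + z) = norm z powr (- p) * indicator {x1 a<..} (x1 z)" for z
      by (auto simp: Tq_def halfspace_def split: split_indicator)
    have "integrable lborel (\<lambda>z. Tq (reflect a + z))"
      unfolding eq p_def by (rule integrable_norm_powr_halfspace[OF s a])
    moreover have "(\<integral>z. Tq (reflect a + z) \<partial>lborel) = (\<integral>z. norm z powr (- p) * indicator {x1 a<..} (x1 (z::real^'n::{finite,wellorder})) \<partial>lborel)"
      unfolding eq ..
    ultimately show ?thesis using integrable_shift[of Tq "reflect a"] integral_shift[of Tq "reflect a"] by simp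
  qed
  have far: "norm (reflect a - y) \<ge> x1 a" if "x1 y > 0" for y
    using abs_x1_le_norm[of "reflect a - y"] that a by simp
  have far': "norm (y - a) \<ge> x1 a" if "x1 y < 0" for y
    using abs_x1_le_norm[of "y - a"] that a by simp
  have Bpos: "x1 y > 0" if "y \<in> ?B" for y
    using that abs_x1_le_norm[of "a - y"] e by (auto simp: dist_norm)
  have B'neg: "x1 y < 0" if "y \<in> ?B'" for y
    using that abs_x1_le_norm[of "reflect a - y"] e by (auto simp: dist_norm)
  have D: "integrable lborel Dq" "\<bar>\<integral>y. Dq y \<partial>lborel\<bar> \<le> (2 * B * x1 a powr (- p)) * (unit_ball_vol CARD('n) * e ^ CARD('n))"
  proof -
    have m: "\<bar>2 * h a * norm (reflect a - y) powr (- p)\<bar> \<le> 2 * B * x1 a powr (- p)" if "y \<in> ?B" for y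
    proof -
      have "norm (reflect a - y) powr (- p) \<le> x1 a powr (- p)"
        using far[OF Bpos[OF that]] a p by (intro powr_mono2') auto
      thus ?thesis unfolding abs_mult using hB[of a] B0 by (intro mult_mono) auto
    qed
    show "integrable lborel Dq" "\<bar>\<integral>y. Dq y \<partial>lborel\<bar> \<le> (2 * B * x1 a powr (- p)) * (unit_ball_vol CARD('n) * e ^ CARD('n))"
      unfolding Dq_def using abs_integral_ball_le[of "\<lambda>y. 2 * h a * norm (reflect a - y) powr (- p)" e a, OF _ _ m] e by auto
  qed
  \<comment> \<open>This is what \<open>Bq\<close> leaves out of the whole-space integral. Like
    \<open>Dq\<close> it lives on a ball of radius \<open>e\<close> whose points are at least
    \<open>x1 a\<close> away from the pole involved, so both are of order
    \<open>e ^ n\<close>.\<close>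
  define Eq where "Eq = (\<lambda>y. indicator ?B' y * F (y - a))"
  have E: "integrable lborel Eq" "\<bar>\<integral>y. Eq y \<partial>lborel\<bar> \<le> (2 * B * x1 a powr (- p)) * (unit_ball_vol CARD('n) * e ^ CARD('n))"
  proof -
    have m: "\<bar>F (y - a)\<bar> \<le> 2 * B * x1 a powr (- p)" if "y \<in> ?B'" for y
    proof -
      have "norm (y - a) powr (- p) \<le> x1 a powr (- p)"
        using far'[OF B'neg[OF that]] a p by (intro powr_mono2') auto
      moreover have "\<bar>h a - h y\<bar> \<le> 2 * B" using hB[of a] hB[of y] by linarith
      ultimately have "norm (y - a) powr (- p) * \<bar>h a - h y\<bar> \<le> x1 a powr (- p) * (2 * B)"
        by (intro mult_mono) auto
      thus ?thesis using B0 by (auto simp: F_def abs_mult mult_ac split: split_indicator)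
    qed
    show "integrable lborel Eq" "\<bar>\<integral>y. Eq y \<partial>lborel\<bar> \<le> (2 * B * x1 a powr (- p)) * (unit_ball_vol CARD('n) * e ^ CARD('n))"
      unfolding Eq_def using abs_integral_ball_le[of "\<lambda>y. F (y - a)" e "reflect a", OF _ _ m] e by auto
  qed
  have [measurable]: "Bq \<in> borel_measurable borel" unfolding Bq_def by measurable
  let ?S = "halfspace - ?B"
  have pt: "indicat_real ?S y *\<^sub>R (ker p a y * (h a - h y)) = Aq y + Bq (reflect y) - 2 * h a * Tq y + Dq y" for y
  proof (cases "y \<in> halfspace")
    case False
    hence "y \<notin> ?B" using Bpos[of y] by (auto simp: halfspace_def)
    thus ?thesis using False by (auto simp: Aq_def Bq_def Tq_def Dq_def halfspace_def split: split_indicator)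
  next
    case H: True
    have dr: "norm (reflect y - a) = norm (reflect a - y)"
      by (metis norm_minus_commute norm_reflect_diff)
    have rb: "reflect y \<in> ?B' \<longleftrightarrow> y \<in> ?B"
      by (simp add: dist_norm flip: reflect_simps(2))
    show ?thesis
    proof (cases "y \<in> ?B")
      case True
      thus ?thesis using H rb by (simp add: Aq_def Bq_def Tq_def Dq_def F_def dist_norm norm_minus_commute)
    next
      case False
      have "x1 a \<le> norm (reflect y - a)" unfolding dr using far[of y] H by (auto simp: halfspace_def)
      hence "Bq (reflect y) = norm (reflect a - y) powr (- p) * (h a + h y)"
        using False H rb e by (auto simp: Bq_def F_def odd dr halfspace_def)
      moreover have "Aq y = norm (a - y) powr (- p) * (h a - h y)"
        using False H by (auto simp: Aq_def F_def dist_norm norm_minus_commute)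
      ultimately show ?thesis using False H by (simp add: Tq_def Dq_def ker_def algebra_simps)
    qed
  qed
  have m: "set_borel_measurable lborel ?S (\<lambda>y. ker p a y * (h a - h y))"
    unfolding set_borel_measurable_def by measurable
  have Br: "integrable lborel (\<lambda>y. Bq (reflect y))" "(\<integral>y. Bq (reflect y) \<partial>lborel) = (\<integral>y. Bq y \<partial>lborel)"
    using B_int by (simp_all add: integrable_reflect integral_reflect)
  have "trunc p h a e = (\<integral>y. Aq y + Bq (reflect y) - 2 * h a * Tq y + Dq y \<partial>lborel)"
    unfolding trunc_def set_integral_lebesgue_eq[OF m] unfolding set_lebesgue_integral_def pt ..
  also have "\<dots> = (\<integral>y. Aq y \<partial>lborel) + (\<integral>y. Bq y \<partial>lborel) - 2 * h a * (\<integral>y. Tq y \<partial>lborel) + (\<integral>y. Dq y \<partial>lborel)"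
    using A_int Br T D(1) by simp
  also have "(\<integral>y. Aq y \<partial>lborel) + (\<integral>y. Bq y \<partial>lborel) = (\<integral>y. Aq y + Bq y \<partial>lborel)"
    using A_int B_int by simp
  also have "\<dots> = (\<integral>y. F (y - a) - Eq y \<partial>lborel)"
  proof (rule integral_cong_AE)
    show "AE y in lborel. Aq y + Bq y = F (y - a) - Eq y"
      using AE_x1_nonzero
    proof eventually_elim
      case (elim y)
      thus ?case using B'neg[of y] by (cases "x1 y > 0") (auto simp: Aq_def Bq_def Eq_def halfspace_def split: split_indicator)
    qed
  qed (use A_int B_int Fs_int E(1) in auto)
  also have "\<dots> = (\<integral>z. F z \<partial>lborel) - (\<integral>y. Eq y \<partial>lborel)"
    using Fs_int E(1) integral_shift[of F "- a"] by simp
  finally have tr: "trunc p h a e = (\<integral>z. F z \<partial>lborel) - (\<integral>y. Eq y \<partial>lborel) - 2 * h a * (\<integral>y. Tq y \<partial>lborel) + (\<integral>y. Dq y \<partial>lborel)" .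
  have c: "2 * c_ns CARD('n) s * (\<integral>y. Tq y \<partial>lborel) = c_ns 1 s / s * x1 a powr (- 2 * s)"
    using T integral_norm_powr_halfspace[OF s a, where 'n = 'n] by (simp add: p_def)
  have "c_ns CARD('n) s * trunc p h a e + c_ns 1 s / s * h a * x1 a powr (- 2 * s) - c_ns CARD('n) s * (\<integral>z. F z \<partial>lborel)
    = c_ns CARD('n) s * trunc p h a e + h a * (2 * c_ns CARD('n) s * (\<integral>y. Tq y \<partial>lborel)) - c_ns CARD('n) s * (\<integral>z. F z \<partial>lborel)"
    unfolding c by simp
  also have "\<dots> = c_ns CARD('n) s * ((\<integral>y. Dq y \<partial>lborel) - (\<integral>y. Eq y \<partial>lborel))"
    unfolding tr by (simp add: algebra_simps)
  finally have eq: "c_ns CARD('n) s * trunc p h a e + c_ns 1 s / s * h a * x1 a powr (- 2 * s) - c_ns CARD('n) s * (\<integral>z. F z \<partial>lborel) = \<dots>" .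
  have "\<bar>(\<integral>y. Dq y \<partial>lborel) - (\<integral>y. Eq y \<partial>lborel)\<bar> \<le> 4 * B * x1 a powr (- p) * (unit_ball_vol CARD('n) * e ^ CARD('n))"
    using D(2) E(2) by linarith
  thus ?thesis unfolding eq abs_mult by (intro mult_left_mono) auto
qed

text \<open>Changing \<open>z\<close> to \<open>- z\<close>, \<open>reflect z\<close> or
  \<open>- reflect z\<close> preserves the integral, so four times it is the integral of the fourth
  difference. The quadratic bound of that difference is integrable near 0 because s < 1, its uniform
  bound is integrable far away because s > 0, and neither depends on \<open>e\<close>.\<close>

lemma gau_integral_bound:
  fixes s l R :: real
  assumes s: "0 < s" "s < 1" and l: "l > 0"
  defines "p \<equiv> real CARD('n::{finite,wellorder}) + 2 * s"
  shows "\<exists>C\<ge>0. \<forall>(a::real^'n::{finite,wellorder}) e. x1 a > 0 \<and> norm a \<le> R \<and> 0 < e \<longrightarrow>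
    \<bar>\<integral>z. norm z powr (- p) * indicator {z. e \<le> norm z} z * (gau l a - gau l (a + z)) \<partial>lborel\<bar> \<le> C * x1 a"
proof -
  have p: "p > real CARD('n)" "p - 2 < real CARD('n)" using s by (auto simp: p_def intro: add_nonneg_pos)
  define C where "C = 4 * (1 + l + 2 * l\<^sup>2 * R\<^sup>2) + 8 * l * (1 + 2 * R\<^sup>2 + 2 / l)"
  have C: "C \<ge> 0" unfolding C_def using l by (intro add_nonneg_nonneg mult_nonneg_nonneg) auto
  define m where "m = (\<lambda>z::real^'n::{finite,wellorder}. norm z powr (- (p - 2)) * indicator (ball 0 1) z + norm z powr (- p) * indicator {z. 1 \<le> norm z} z)"
  have m_int: "integrable lborel m" unfolding m_def
    using p by (intro Bochner_Integration.integrable_add integrable_norm_powr_tail integrable_norm_powr_ball) auto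
  have m0: "m z \<ge> 0" for z by (simp add: m_def)
  define J where "J = (\<integral>z. m z \<partial>lborel)"
  have J: "J \<ge> 0" unfolding J_def using m0 by (intro Bochner_Integration.integral_nonneg) auto
  show ?thesis
  proof (intro exI[of _ "C * J"] conjI allI impI; (elim conjE)?)
    show "C * J \<ge> 0" using C J by simp
    fix a :: "real^'n::{finite,wellorder}" and e :: real
    assume a: "x1 a > 0" "norm a \<le> R" and e: "0 < e"
    define F where "F = (\<lambda>z. norm z powr (- p) * indicator {z. e \<le> norm z} z * (gau l a - gau l (a + z)))"
    have [measurable]: "F \<in> borel_measurable borel" unfolding F_def by measurable
    have F_int: "integrable lborel F"
      unfolding F_def
    proof (rule integrable_powr_bounded[OF p(1) e, where B = "(1 + 1 / l) + (1 + 1 / l)"])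
      fix z show "\<bar>gau l a - gau l (a + z)\<bar> \<le> (1 + 1 / l) + (1 + 1 / l)"
        using abs_gau_le[OF l, of a] abs_gau_le[OF l, of "a + z"] by linarith
    qed measurable
    have [measurable]: "(\<lambda>z. F (- z)) \<in> borel_measurable borel" by measurable
    have ints: "integrable lborel (\<lambda>z. F (- z))" "(\<integral>z. F (- z) \<partial>lborel) = (\<integral>z. F z \<partial>lborel)"
      "integrable lborel (\<lambda>z. F (reflect z))" "(\<integral>z. F (reflect z) \<partial>lborel) = (\<integral>z. F z \<partial>lborel)"
      "integrable lborel (\<lambda>z. F (- reflect z))" "(\<integral>z. F (- reflect z) \<partial>lborel) = (\<integral>z. F z \<partial>lborel)"
      using F_int integrable_reflect[of "\<lambda>z. F (- z)"] integral_reflect[of "\<lambda>z. F (- z)"]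
      by (simp_all add: integrable_uminus integral_uminus integrable_reflect integral_reflect)
    have "4 * (\<integral>z. F z \<partial>lborel) = (\<integral>z. F z + F (- z) + F (reflect z) + F (- reflect z) \<partial>lborel)"
      using F_int ints by simp
    also have "\<bar>\<dots>\<bar> \<le> (\<integral>z. (C * x1 a) * m z \<partial>lborel)"
    proof (rule order.trans[OF _ Bochner_Integration.integral_norm_bound_integral])
      fix z
      define g where "g = 4 * gau l a - gau l (a + z) - gau l (a - z) - gau l (a + reflect z) - gau l (a - reflect z)"
      have "F z + F (- z) + F (reflect z) + F (- reflect z) = norm z powr (- p) * indicator {z. e \<le> norm z} z * g"
        by (simp add: F_def g_def algebra_simps split: split_indicator)
      hence "norm (F z + F (- z) + F (reflect z) + F (- reflect z)) \<le> norm z powr (- p) * \<bar>g\<bar>"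
        by (auto simp: abs_mult split: split_indicator)
      also have "\<dots> \<le> (C * x1 a) * m z"
      proof (cases "norm z < 1")
        case True
        show ?thesis
        proof (cases "z = 0")
          case False
          have "norm z powr (- p) * \<bar>g\<bar> \<le> norm z powr (- p) * (C * x1 a * (norm z)\<^sup>2)"
            unfolding g_def C_def using a l by (intro mult_left_mono gau_fourth_difference) auto
          also have "\<dots> = C * x1 a * norm z powr (- (p - 2))"
            using False by (simp add: powr_diff powr_minus field_simps)
          finally show ?thesis using True by (simp add: m_def)
        qed (use C a m0 in simp)
      next
        case False
        have "norm z powr (- p) * \<bar>g\<bar> \<le> norm z powr (- p) * (C * x1 a)"
          unfolding g_def C_def using a l by (intro mult_left_mono gau_fourth_difference) auto
        thus ?thesis using False by (simp add: m_def mult_ac)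
      qed
      finally show "norm (F z + F (- z) + F (reflect z) + F (- reflect z)) \<le> (C * x1 a) * m z" .
    qed (use F_int ints m_int in auto)
    also have "\<dots> = C * J * x1 a" by (simp add: J_def)
    finally have "4 * \<bar>\<integral>z. F z \<partial>lborel\<bar> \<le> C * J * x1 a" by simp
    moreover have "0 \<le> C * J * x1 a" using C J a by simp
    ultimately show "\<bar>\<integral>z. norm z powr (- p) * indicator {z. e \<le> norm z} z * (gau l a - gau l (a + z)) \<partial>lborel\<bar> \<le> C * J * x1 a"
      unfolding F_def by linarith
  qed
qed

text \<open>A bound on truncations avoids proving that the principal value of a Gaussian exists.
  \<open>E\<close> may depend on \<open>a\<close>, since \<open>e\<close> tends to 0 while
  \<open>a\<close> is fixed; only \<open>C\<close> has to be uniform.\<close>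

lemma trunc_gau_bound:
  fixes s l R :: real
  assumes s: "0 < s" "s < 1" and l: "l > 0"
  defines "p \<equiv> real CARD('n::{finite,wellorder}) + 2 * s"
  shows "\<exists>C\<ge>0. \<forall>a::real^'n::{finite,wellorder}. x1 a > 0 \<and> norm a \<le> R \<longrightarrow> (\<exists>E. \<forall>e. 0 < e \<and> e < 1 \<and> e < x1 a \<longrightarrow>
    \<bar>c_ns CARD('n) s * trunc p (gau l) a e + c_ns 1 s / s * gau l a * x1 a powr (- 2 * s)\<bar> \<le> C * x1 a + E * e)"
proof -
  obtain C where C: "C \<ge> 0" and CF: "\<And>(a::real^'n::{finite,wellorder}) e. x1 a > 0 \<Longrightarrow> norm a \<le> R \<Longrightarrow> 0 < e \<Longrightarrow>
    \<bar>\<integral>z. norm z powr (- p) * indicator {z. e \<le> norm z} z * (gau l a - gau l (a + z)) \<partial>lborel\<bar> \<le> C * x1 a"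
    using gau_integral_bound[OF s l, where 'n = 'n and R = R] unfolding p_def by blast
  let ?c = "c_ns CARD('n) s"
  show ?thesis
  proof (rule exI[of _ "\<bar>?c\<bar> * C"], intro conjI allI impI; (elim conjE)?)
    show "\<bar>?c\<bar> * C \<ge> 0" using C by simp
    fix a :: "real^'n::{finite,wellorder}" assume a: "x1 a > 0" "norm a \<le> R"
    let ?D = "4 * (1 + 1 / l) * x1 a powr (- p)"
    show "\<exists>E. \<forall>e. 0 < e \<and> e < 1 \<and> e < x1 a \<longrightarrow>
      \<bar>?c * trunc p (gau l) a e + c_ns 1 s / s * gau l a * x1 a powr (- 2 * s)\<bar> \<le> \<bar>?c\<bar> * C * x1 a + E * e"
    proof (intro exI[of _ "\<bar>?c\<bar> * (?D * unit_ball_vol CARD('n))"] allI impI; (elim conjE)?)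
      fix e :: real assume e: "0 < e" "e < 1" "e < x1 a"
      have "\<bar>?c * trunc p (gau l) a e + c_ns 1 s / s * gau l a * x1 a powr (- 2 * s) - ?c * (\<integral>z. norm z powr (- p) * indicator {z. e \<le> norm z} z * (gau l a - gau l (a + z)) \<partial>lborel)\<bar>
        \<le> \<bar>?c\<bar> * (?D * (unit_ball_vol CARD('n) * e ^ CARD('n)))"
        unfolding p_def using trunc_unfold[OF s(1) borel_measurable_gau abs_gau_le[OF l] gau_reflect a(1) e(1,3)] by (simp add: mult.assoc)
      moreover have "\<bar>?c * (\<integral>z. norm z powr (- p) * indicator {z. e \<le> norm z} z * (gau l a - gau l (a + z)) \<partial>lborel)\<bar> \<le> \<bar>?c\<bar> * (C * x1 a)"
        unfolding abs_mult using CF[OF a e(1)] by (intro mult_left_mono) auto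
      moreover have "\<bar>?c\<bar> * (?D * (unit_ball_vol CARD('n) * e ^ CARD('n))) \<le> \<bar>?c\<bar> * (?D * (unit_ball_vol CARD('n) * e))"
        using e l power_decreasing[of 1 "CARD('n)" e] by (intro mult_left_mono) auto
      ultimately show "\<bar>?c * trunc p (gau l) a e + c_ns 1 s / s * gau l a * x1 a powr (- 2 * s)\<bar> \<le> \<bar>?c\<bar> * C * x1 a + \<bar>?c\<bar> * (?D * unit_ball_vol CARD('n)) * e"
        by (simp add: mult.assoc)
    qed
  qed
qed


section \<open>The principal value\<close>

lemma partial_has_derivative:
  fixes f :: "real^'n::{finite,wellorder} \<Rightarrow> real"
  assumes "(\<lambda>t. f ((y + c *\<^sub>R axis j 1) + t *\<^sub>R axis j 1)) differentiable (at 0)"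
  shows "((\<lambda>t. f (y + t *\<^sub>R axis j 1)) has_real_derivative partial j f (y + c *\<^sub>R axis j 1)) (at c)"
proof -
  let ?g = "\<lambda>t. f ((y + c *\<^sub>R axis j 1) + t *\<^sub>R axis j 1)"
  have "(?g has_real_derivative partial j f (y + c *\<^sub>R axis j 1)) (at 0)"
    unfolding partial_def using assms by (simp add: DERIV_deriv_iff_real_differentiable)
  hence "((\<lambda>t. f (y + (c + t) *\<^sub>R axis j 1)) has_real_derivative partial j f (y + c *\<^sub>R axis j 1)) (at 0)"
    by (simp add: scaleR_add_left add.assoc)
  thus ?thesis using DERIV_at_within_shift[of "\<lambda>t. f (y + t *\<^sub>R axis j 1)" "partial j f (y + c *\<^sub>R axis j 1)" c 0 UNIV]
    by (simp add: add.commute)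
qed

text \<open>Only axis-parallel derivatives are available, so the increment is telescoped along the coordinates.\<close>

lemma increment_partials:
  fixes f :: "real^'n::{finite,wellorder} \<Rightarrow> real"
  assumes d: "\<And>i y. norm (y - x) \<le> norm z \<Longrightarrow> (\<lambda>t. f (y + t *\<^sub>R axis i 1)) differentiable (at 0)"
  shows "\<exists>\<xi>. (\<forall>i. norm (\<xi> i - x) \<le> norm z) \<and> f (x + z) - f x = (\<Sum>i\<in>UNIV. partial i f (\<xi> i) * z $ i)"
proof -
  define zS where "zS = (\<lambda>S. \<chi> i. if i \<in> S then z $ i else 0)"
  have "\<exists>\<xi>. (\<forall>i. norm (\<xi> i - x) \<le> norm z) \<and> f (x + zS S) - f x = (\<Sum>i\<in>S. partial i f (\<xi> i) * z $ i)" if "finite S" for S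
    using that
  proof induction
    case empty
    have "zS {} = 0" by (simp add: zS_def vec_eq_iff)
    thus ?case by (intro exI[of _ "\<lambda>_. x"]) simp
  next
    case (insert j S)
    then obtain \<xi> where \<xi>: "\<And>i. norm (\<xi> i - x) \<le> norm z" "f (x + zS S) - f x = (\<Sum>i\<in>S. partial i f (\<xi> i) * z $ i)" by auto
    let ?y = "\<lambda>t. x + zS S + (t * z $ j) *\<^sub>R axis j 1"
    have y: "norm (?y t - x) \<le> norm z" if "0 \<le> t" "t \<le> 1" for t
    proof -
      have "norm (zS S + (t * z $ j) *\<^sub>R axis j 1) \<le> norm z"
        using insert.hyps that
        by (intro norm_le_componentwise_cart) (auto simp: zS_def axis_def abs_mult intro: mult_left_le_one_le)
      thus ?thesis by (simp add: algebra_simps)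
    qed
    have der: "((\<lambda>t. f (?y t)) has_real_derivative partial j f (?y t) * z $ j) (at t)" if "0 \<le> t" "t \<le> 1" for t
    proof -
      have "((\<lambda>t. f (x + zS S + t *\<^sub>R axis j 1)) has_real_derivative partial j f (?y t)) (at (t * z $ j))"
        by (rule partial_has_derivative) (rule d[OF y[OF that]])
      moreover have "((\<lambda>t. t * z $ j) has_real_derivative z $ j) (at t)"
        by (auto intro!: derivative_eq_intros)
      ultimately show ?thesis by (rule DERIV_chain2)
    qed
    have "\<exists>t. 0 < t \<and> t < 1 \<and> f (?y 1) - f (?y 0) = (1 - 0) * (partial j f (?y t) * z $ j)"
      using der by (intro MVT2) auto
    then obtain t where t: "0 < t" "t < 1" "f (?y 1) - f (?y 0) = partial j f (?y t) * z $ j" by auto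
    have "?y 1 = x + zS (insert j S)" using insert.hyps by (auto simp: zS_def vec_eq_iff axis_def)
    moreover have "?y 0 = x + zS S" by simp
    ultimately have eq: "f (x + zS (insert j S)) - f (x + zS S) = partial j f (?y t) * z $ j" using t(3) by (simp only:)
    have "(\<Sum>i\<in>S. partial i f ((\<xi>(j := ?y t)) i) * z $ i) = (\<Sum>i\<in>S. partial i f (\<xi> i) * z $ i)"
      using insert.hyps by (intro sum.cong) auto
    hence "f (x + zS (insert j S)) - f x = (\<Sum>i\<in>insert j S. partial i f ((\<xi>(j := ?y t)) i) * z $ i)"
      using insert.hyps eq \<xi>(2) by simp
    thus ?case using \<xi>(1) y[of t] t by (intro exI[of _ "\<xi>(j := ?y t)"]) auto
  qed
  from this[of UNIV] show ?thesis by (simp add: zS_def)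
qed

text \<open>The increments in the directions \<open>z\<close> and \<open>- z\<close> telescope into
  partial derivatives times opposite components, so their sum only sees differences of first
  derivatives at points at most \<open>2 * norm z\<close> apart.\<close>

lemma second_difference_of_partials:
  fixes u :: "real^'n::{finite,wellorder} \<Rightarrow> real"
  assumes d: "\<And>i y. y \<in> ball a (2 * r) \<Longrightarrow> (\<lambda>t. u (y + t *\<^sub>R axis i 1)) differentiable (at 0)"
    and H: "\<And>i y y'. y \<in> ball a (2 * r) \<Longrightarrow> y' \<in> ball a (2 * r) \<Longrightarrow> \<bar>partial i u y - partial i u y'\<bar> \<le> K * dist y y' powr g"
    and K: "K \<ge> 0" and g: "g > 0" and x: "x \<in> ball a r" and z: "norm z < r"
  shows "\<bar>2 * u x - u (x + z) - u (x - z)\<bar> \<le> real CARD('n) * K * 2 powr g * norm z powr (1 + g)"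
proof -
  have in2: "y \<in> ball a (2 * r)" if "norm (y - x) \<le> norm z" for y
    using x z that dist_triangle[of a y x] by (simp add: dist_norm norm_minus_commute)
  obtain \<xi> where \<xi>: "\<And>i. norm (\<xi> i - x) \<le> norm z" "u (x + z) - u x = (\<Sum>i\<in>UNIV. partial i u (\<xi> i) * z $ i)"
    using increment_partials[of x z u] d in2 by blast
  obtain \<eta> where \<eta>: "\<And>i. norm (\<eta> i - x) \<le> norm z" "u (x - z) - u x = (\<Sum>i\<in>UNIV. partial i u (\<eta> i) * (- z) $ i)"
    using increment_partials[of x "- z" u] d in2 by auto
  have "2 * u x - u (x + z) - u (x - z) = - (\<Sum>i\<in>UNIV. (partial i u (\<xi> i) - partial i u (\<eta> i)) * z $ i)"
    using \<xi>(2) \<eta>(2) by (simp add: sum_subtractf sum_negf left_diff_distrib)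
  also have "\<bar>\<dots>\<bar> \<le> (\<Sum>i\<in>(UNIV::'n set). K * (2 * norm z) powr g * norm z)"
    unfolding abs_minus_cancel
  proof (rule order.trans[OF sum_abs], intro sum_mono)
    fix i
    have "dist (\<xi> i) (\<eta> i) \<le> 2 * norm z"
      using dist_triangle2[of "\<xi> i" "\<eta> i" x] \<xi>(1)[of i] \<eta>(1)[of i] by (simp add: dist_norm)
    hence "K * dist (\<xi> i) (\<eta> i) powr g \<le> K * (2 * norm z) powr g"
      using K g by (intro mult_left_mono powr_mono2) auto
    hence "\<bar>partial i u (\<xi> i) - partial i u (\<eta> i)\<bar> \<le> K * (2 * norm z) powr g"
      using H[OF in2[OF \<xi>(1)] in2[OF \<eta>(1)], of i i i] by linarith
    thus "\<bar>(partial i u (\<xi> i) - partial i u (\<eta> i)) * z $ i\<bar> \<le> K * (2 * norm z) powr g * norm z"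
      unfolding abs_mult using component_le_norm_cart[of z i] K by (intro mult_mono) auto
  qed
  also have "\<dots> = real CARD('n) * K * 2 powr g * norm z powr (1 + g)"
    by (cases "z = 0") (simp_all add: powr_mult powr_add)
  finally show ?thesis .
qed

text \<open>If the integer part of the exponent is 0 or 1, the Hoelder bound for \<open>u\<close> or
  for its first partials gives the power \<open>2 * s + \<alpha>\<close>. From 2 on, bounded second
  partials make the first partials Lipschitz, and the resulting power 2 exceeds \<open>2 * s\<close>
  since s < 1.\<close>

lemma C_beta_second_difference:
  fixes u :: "real^'n::{finite,wellorder} \<Rightarrow> real"
  assumes C: "C_beta (2 * s + \<alpha>) (ball 0 \<rho>) u" and s: "0 < s" "s < 1" and \<alpha>: "\<alpha> > 0" "2 * s + \<alpha> \<notin> \<int>"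
    and a: "a \<in> ball 0 \<rho>"
  shows "\<exists>r0>0. \<exists>K\<ge>0. \<exists>\<gamma>>2 * s. ball a (2 * r0) \<subseteq> ball 0 \<rho> \<and>
    (\<forall>x\<in>ball a r0. \<forall>z. norm z < r0 \<longrightarrow> \<bar>2 * u x - u (x + z) - u (x - z)\<bar> \<le> K * norm z powr \<gamma>)"
proof -
  let ?U = "ball 0 \<rho> :: (real^'n::{finite,wellorder}) set"
  define k where "k = nat \<lfloor>2 * s + \<alpha>\<rfloor>"
  define g where "g = 2 * s + \<alpha> - of_int \<lfloor>2 * s + \<alpha>\<rfloor>"
  define r0 where "r0 = (\<rho> - norm a) / 4"
  have r0: "r0 > 0" using a by (simp add: r0_def)
  have sub: "ball a (4 * r0) \<subseteq> ?U"
  proof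
    fix y assume "y \<in> ball a (4 * r0)"
    thus "y \<in> ?U" using dist_triangle[of 0 y a] by (simp add: r0_def)
  qed
  have sub2: "ball a (2 * r0) \<subseteq> ball a (4 * r0)" using r0 by (intro subset_ball) simp
  have U2: "y \<in> ?U" if "y \<in> ball a (2 * r0)" for y using that sub sub2 by blast
  have kg: "2 * s + \<alpha> = real k + g"
    using s \<alpha> by (simp add: k_def g_def)
  have g: "g > 0" using \<alpha>(2) by (auto simp: g_def less_le) (metis Ints_of_int add.commute diff_eq_eq add_0)
  have H: "Holder_on k g ?U u" using C unfolding C_beta_def k_def g_def .
  have hol: "\<And>is. length is = k \<Longrightarrow> \<exists>L. \<forall>x\<in>?U. \<forall>y\<in>?U. \<bar>pds is u x - pds is u y\<bar> \<le> L * dist x y powr g"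
    and diff: "\<And>is i x. length is < k \<Longrightarrow> x \<in> ?U \<Longrightarrow> (\<lambda>t. pds is u (x + t *\<^sub>R axis i 1)) differentiable (at 0)"
    and bdd: "\<And>is. length is \<le> k \<Longrightarrow> bounded (pds is u ` ?U)"
    using H unfolding Holder_on_def Ck_on_def by blast+
  have half: "x \<in> ball a (2 * r0)" "x + z \<in> ball a (2 * r0)" "x - z \<in> ball a (2 * r0)" if "x \<in> ball a r0" "norm z < r0" for x z
    using that r0 dist_triangle[of a "x + z" x] dist_triangle[of a "x - z" x] by (auto simp: dist_norm)
  consider "k = 0" | "k = 1" | "k \<ge> 2" by linarith
  thus ?thesis
  proof cases
    case 1
    obtain L where L: "\<And>x y. x \<in> ?U \<Longrightarrow> y \<in> ?U \<Longrightarrow> \<bar>u x - u y\<bar> \<le> L * dist x y powr g"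
    proof -
      have "\<exists>L. \<forall>x\<in>?U. \<forall>y\<in>?U. \<bar>u x - u y\<bar> \<le> L * dist x y powr g" using hol[of "[]"] 1 by simp
      thus ?thesis using that by blast
    qed
    have "\<bar>2 * u x - u (x + z) - u (x - z)\<bar> \<le> (2 * \<bar>L\<bar>) * norm z powr g" if "x \<in> ball a r0" "norm z < r0" for x z
    proof -
      have "\<bar>u x - u (x + z)\<bar> \<le> L * norm z powr g" "\<bar>u x - u (x - z)\<bar> \<le> L * norm z powr g"
      proof -
        have U: "x \<in> ?U" "x + z \<in> ?U" "x - z \<in> ?U" using half[OF that] sub sub2 by blast+
        show "\<bar>u x - u (x + z)\<bar> \<le> L * norm z powr g" "\<bar>u x - u (x - z)\<bar> \<le> L * norm z powr g"
          using L[OF U(1,2)] L[OF U(1,3)] by (simp_all add: dist_norm)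
      qed
      moreover have "L * norm z powr g \<le> \<bar>L\<bar> * norm z powr g" by (intro mult_right_mono) auto
      ultimately show ?thesis by linarith
    qed
    thus ?thesis using r0 sub sub2 kg \<alpha>(1) 1
      by (intro exI[of _ r0] conjI exI[of _ "2 * \<bar>L\<bar>"] exI[of _ g]) auto
  next
    case 2
    have "\<forall>i. \<exists>L. \<forall>x\<in>?U. \<forall>y\<in>?U. \<bar>partial i u x - partial i u y\<bar> \<le> L * dist x y powr g"
      using hol[of "[_]"] 2 by auto
    then obtain L where L: "\<And>i x y. x \<in> ?U \<Longrightarrow> y \<in> ?U \<Longrightarrow> \<bar>partial i u x - partial i u y\<bar> \<le> L i * dist x y powr g" by metis
    define K where "K = (\<Sum>i\<in>UNIV. \<bar>L i\<bar>)"
    have LK: "L i \<le> K" for i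
    proof -
      have "\<bar>L i\<bar> \<le> K" unfolding K_def by (rule member_le_sum) auto
      thus ?thesis by simp
    qed
    have K: "K \<ge> 0" by (auto simp: K_def intro: sum_nonneg)
    have "\<bar>2 * u x - u (x + z) - u (x - z)\<bar> \<le> real CARD('n) * K * 2 powr g * norm z powr (1 + g)" if "x \<in> ball a r0" "norm z < r0" for x z
    proof (rule second_difference_of_partials[OF _ _ K g that])
      show "(\<lambda>t. u (y + t *\<^sub>R axis i 1)) differentiable (at 0)" if "y \<in> ball a (2 * r0)" for i y
        using diff[of "[]" y i, OF _ U2[OF that]] 2 by simp
      show "\<bar>partial i u y - partial i u y'\<bar> \<le> K * dist y y' powr g" if "y \<in> ball a (2 * r0)" "y' \<in> ball a (2 * r0)" for i y y'
        by (rule order.trans[OF L[OF U2[OF that(1)] U2[OF that(2)]] mult_right_mono[OF LK]]) simp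
    qed
    thus ?thesis using r0 sub sub2 kg \<alpha>(1) 2 K
      by (intro exI[of _ r0] conjI exI[of _ "real CARD('n) * K * 2 powr g"] exI[of _ "1 + g"]) auto
  next
    case 3
    have "\<forall>i j. \<exists>B. \<forall>x\<in>?U. \<bar>partial j (partial i u) x\<bar> \<le> B"
    proof (intro allI)
      fix i j
      have "bounded (pds [j, i] u ` ?U)" using 3 by (intro bdd) simp
      thus "\<exists>B. \<forall>x\<in>?U. \<bar>partial j (partial i u) x\<bar> \<le> B" unfolding bounded_iff by auto
    qed
    then obtain B where B: "\<And>i j x. x \<in> ?U \<Longrightarrow> \<bar>partial j (partial i u) x\<bar> \<le> B i j" by metis
    define K where "K = (\<Sum>i\<in>UNIV. \<Sum>j\<in>UNIV. \<bar>B i j\<bar>)"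
    have K: "K \<ge> 0" by (auto simp: K_def intro!: sum_nonneg)
    \<comment> \<open>Two points of \<open>ball a (2 * r1)\<close> are less than
      \<open>4 * r1\<close> apart, so telescoping between them along the coordinates stays within
      \<open>6 * r1\<close> of \<open>a\<close> and hence inside the domain.\<close>
    define r1 where "r1 = r0 / 3"
    have r1: "r1 > 0" "r1 \<le> r0" "2 * r1 + 4 * r1 \<le> 4 * r0" using r0 by (auto simp: r1_def)
    have "\<bar>2 * u x - u (x + z) - u (x - z)\<bar> \<le> real CARD('n) * K * 2 powr 1 * norm z powr (1 + 1)" if "x \<in> ball a r1" "norm z < r1" for x z
    proof (rule second_difference_of_partials[OF _ _ K _ that])
      show "(\<lambda>t. u (y + t *\<^sub>R axis i 1)) differentiable (at 0)" if "y \<in> ball a (2 * r1)" for i y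
      proof -
        have "y \<in> ball a (4 * r0)" using that r1 by simp
        hence "y \<in> ?U" using sub by blast
        thus ?thesis using diff[of "[]" y i] 3 by simp
      qed
      fix i y y' assume y: "y \<in> ball a (2 * r1)" "y' \<in> ball a (2 * r1)"
      define w where "w = y - y'"
      have w: "norm w < 4 * r1" using y dist_triangle3[of y y' a] by (simp add: w_def dist_norm)
      have inU: "v \<in> ?U" if "norm (v - y') \<le> norm w" for v
      proof -
        have "dist a v \<le> dist a y' + norm (v - y')" using dist_triangle[of a v y'] by (simp add: dist_norm norm_minus_commute)
        hence "v \<in> ball a (4 * r0)" using that w y r1 by simp
        thus ?thesis using sub by blast
      qed
      have "(\<lambda>t. partial i u (v + t *\<^sub>R axis j 1)) differentiable (at 0)" if "norm (v - y') \<le> norm w" for j v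
        using diff[of "[i]" v j] 3 inU[OF that] by simp
      from increment_partials[OF this] obtain \<xi> where \<xi>: "\<And>j. norm (\<xi> j - y') \<le> norm w"
        "partial i u (y' + w) - partial i u y' = (\<Sum>j\<in>UNIV. partial j (partial i u) (\<xi> j) * w $ j)" by blast
      have "\<bar>partial i u y - partial i u y'\<bar> = \<bar>\<Sum>j\<in>UNIV. partial j (partial i u) (\<xi> j) * w $ j\<bar>"
        using \<xi>(2) by (simp add: w_def)
      also have "\<dots> \<le> (\<Sum>j\<in>UNIV. \<bar>B i j\<bar> * norm w)"
      proof (rule order.trans[OF sum_abs], intro sum_mono)
        fix j
        have "\<bar>partial j (partial i u) (\<xi> j)\<bar> \<le> \<bar>B i j\<bar>" using B[OF inU[OF \<xi>(1)], of j i j] by linarith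
        thus "\<bar>partial j (partial i u) (\<xi> j) * w $ j\<bar> \<le> \<bar>B i j\<bar> * norm w"
          unfolding abs_mult using component_le_norm_cart[of w j] by (intro mult_mono) auto
      qed
      also have "\<dots> = (\<Sum>j\<in>UNIV. \<bar>B i j\<bar>) * norm w" by (simp add: sum_distrib_right)
      also have "\<dots> \<le> K * norm w"
        unfolding K_def by (intro mult_right_mono member_le_sum[of i UNIV "\<lambda>i. \<Sum>j\<in>UNIV. \<bar>B i j\<bar>"]) (auto intro: sum_nonneg)
      finally show "\<bar>partial i u y - partial i u y'\<bar> \<le> K * dist y y' powr 1" by (simp add: w_def dist_norm)
    qed simp
    moreover have "ball a (2 * r1) \<subseteq> ?U" using r1 by (intro order.trans[OF _ sub] subset_ball) auto
    ultimately show ?thesis using r1 s K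
      by (intro exI[of _ r1] conjI exI[of _ "real CARD('n) * K * 2 powr 1"] exI[of _ "1 + 1"]) auto
  qed
qed


section \<open>Existence and continuity of the principal value\<close>

lemma set_integrable_trunc:
  fixes u :: "real^'n::{finite,wellorder} \<Rightarrow> real"
  assumes p: "p > real CARD('n)" and u: "set_integrable lebesgue halfspace (\<lambda>y. wgt p y * u y)"
    and x: "x1 x > 0" and e: "e > 0"
  shows "set_integrable lebesgue (halfspace - ball x e) (\<lambda>y. ker p x y * (b - u y))"
proof -
  have p1: "p > 1" using p by (rule le_less_trans[rotated]) (simp add: Suc_leI)
  have "set_integrable lebesgue halfspace (\<lambda>y. wgt p y * (b - u y))"
  proof -
    have "set_integrable lebesgue halfspace (\<lambda>y::real^'n::{finite,wellorder}. wgt p y * b)"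
    proof (rule set_integrable_wgt[OF p, where B = "\<bar>b\<bar>"])
      fix y :: "real^'n::{finite,wellorder}"
      show "\<bar>b\<bar> \<le> \<bar>b\<bar> * (1 + norm y)" by (simp add: algebra_simps)
    qed measurable
    thus ?thesis using u by (simp add: right_diff_distrib)
  qed
  thus ?thesis using p1 x e
    by (intro set_integrable_ker[where R = "norm x + e"]) auto
qed

text \<open>A Cauchy criterion that keeps the rate: the limit is found along
  \<open>r / (k + 1)\<close> and the modulus passes to it. A rate shared by all base points later
  permits an exchange of limits.\<close>

lemma limit_at_right_of_modulus:
  fixes f m :: "real \<Rightarrow> real"
  assumes r: "r > 0" and m: "(m \<longlongrightarrow> 0) (at_right 0)" and f: "\<And>e e'. 0 < e \<Longrightarrow> e < e' \<Longrightarrow> e' \<le> r \<Longrightarrow> \<bar>f e - f e'\<bar> \<le> m e'"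
  shows "\<exists>l. (f \<longlongrightarrow> l) (at_right 0) \<and> (\<forall>e. 0 < e \<and> e \<le> r \<longrightarrow> \<bar>l - f e\<bar> \<le> m e)"
proof -
  define t where "t = (\<lambda>k. r / real (Suc k))"
  have t: "0 < t k" "t k \<le> r" for k using r by (auto simp: t_def field_simps)
  have t0: "t \<longlonglongrightarrow> 0"
    using LIMSEQ_inverse_real_of_nat[THEN tendsto_mult_right, of r] by (simp add: t_def divide_inverse mult.commute)
  have tr: "filterlim t (at_right 0) sequentially"
  proof -
    have "t k \<noteq> 0" for k using t(1)[of k] by linarith
    thus ?thesis unfolding filterlim_at using t0 t by auto
  qed
  have dec: "t j < t k" if "k < j" for k j using that r by (simp add: t_def frac_less2)
  have mk: "(\<lambda>k. m (t k)) \<longlonglongrightarrow> 0" by (rule filterlim_compose[OF m tr])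
  have "Cauchy (\<lambda>k. f (t k))"
  proof (rule metric_CauchyI)
    fix \<epsilon> :: real assume "\<epsilon> > 0"
    then obtain N where N: "m (t N) < \<epsilon> / 2"
      using order_tendstoD(2)[OF mk, of "\<epsilon> / 2"] by (auto simp: eventually_sequentially)
    have *: "\<bar>f (t k) - f (t N)\<bar> \<le> m (t N)" if "k > N" for k using f[OF t(1) dec[OF that] t(2)] .
    show "\<exists>N. \<forall>i\<ge>N. \<forall>j\<ge>N. dist (f (t i)) (f (t j)) < \<epsilon>"
    proof (intro exI[of _ "Suc N"] allI impI)
      fix i j assume "Suc N \<le> i" "Suc N \<le> j"
      thus "dist (f (t i)) (f (t j)) < \<epsilon>" using *[of i] *[of j] N by (auto simp: dist_real_def)
    qed
  qed
  then obtain l where l: "(\<lambda>k. f (t k)) \<longlonglongrightarrow> l" using Cauchy_convergent convergent_def by blast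
  have lf: "\<bar>l - f e\<bar> \<le> m e" if e: "0 < e" "e \<le> r" for e
  proof (rule tendsto_upperbound)
    show "(\<lambda>k. \<bar>f (t k) - f e\<bar>) \<longlonglongrightarrow> \<bar>l - f e\<bar>" by (intro tendsto_intros l)
    have "eventually (\<lambda>k. t k < e) sequentially" using order_tendstoD(2)[OF t0 e(1)] .
    thus "eventually (\<lambda>k. \<bar>f (t k) - f e\<bar> \<le> m e) sequentially"
      by eventually_elim (use f t(1) e in auto)
  qed simp
  have "((\<lambda>e. f e - l) \<longlongrightarrow> 0) (at_right 0)"
  proof (rule Lim_null_comparison[OF _ m])
    show "\<forall>\<^sub>F e in at_right 0. norm (f e - l) \<le> m e"
      unfolding eventually_at_right_field using r lf by (intro exI[of _ r]) (auto simp: abs_minus_commute)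
  qed
  thus ?thesis using lf by (auto simp: LIM_zero_iff)
qed

context
  fixes u :: "real^'n::{finite,wellorder} \<Rightarrow> real" and a :: "real^'n::{finite,wellorder}" and s r K \<gamma> M p :: real
  assumes s: "0 < s" and pdef: "p = real CARD('n) + 2 * s"
    and u: "set_integrable lebesgue halfspace (\<lambda>y. wgt p y * u y)"
    and r: "0 < r" "r \<le> 1" and ar: "4 * r \<le> x1 a"
    and cont: "continuous_on (ball a (2 * r)) u" and M: "\<And>y. y \<in> ball a (2 * r) \<Longrightarrow> \<bar>u y\<bar> \<le> M"
    and \<gamma>: "\<gamma> > 2 * s" and K: "K \<ge> 0"
    and sd: "\<And>x z. x \<in> ball a r \<Longrightarrow> norm z < r \<Longrightarrow> \<bar>2 * u x - u (x + z) - u (x - z)\<bar> \<le> K * norm z powr \<gamma>"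
begin

lemma p_gt: "p > real CARD('n)" "p > 1"
proof -
  show "p > real CARD('n)" using s by (simp add: pdef)
  moreover have "real CARD('n) \<ge> 1" by (simp add: Suc_leI)
  ultimately show "p > 1" by linarith
qed

lemma near_pos:
  assumes "y \<in> ball a (2 * r)" shows "x1 y > 2 * r" "y \<in> halfspace"
proof -
  have "\<bar>x1 (a - y)\<bar> < 2 * r" using assms abs_x1_le_norm[of "a - y"] by (simp add: dist_norm)
  thus "x1 y > 2 * r" using ar by simp
  thus "y \<in> halfspace" using r by (simp add: halfspace_def)
qed

lemma near_ball: "x \<in> ball a r \<Longrightarrow> norm z < r \<Longrightarrow> x + z \<in> ball a (2 * r)"
  using dist_triangle[of a "x + z" x] by (simp add: dist_norm)

text \<open>On the annulus the kernel splits into its singular part \<open>P\<close> and the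
  reflected part \<open>Q\<close>. \<open>P\<close> is symmetrised under
  \<open>z \<mapsto> - z\<close>, where the second difference is integrable against the kernel
  because \<open>\<gamma> > 2 * s\<close>; in \<open>Q\<close> the pole is at distance at least
  \<open>r\<close>. The bound is the same for all \<open>x\<close> in
  \<open>ball a r\<close>.\<close>

lemma trunc_diff_bound:
  assumes x: "x \<in> ball a r" and e: "0 < e" "e < e'" "e' \<le> r"
  shows "\<bar>trunc p u x e - trunc p u x e'\<bar> \<le>
    K * (real CARD('n) * unit_ball_vol CARD('n) * (e' powr (\<gamma> - 2 * s) / (\<gamma> - 2 * s)))
      + 2 * M * r powr (- p) * (unit_ball_vol CARD('n) * e')"
proof -
  have xb: "ball x e' \<subseteq> ball a (2 * r)"
  proof
    fix y assume "y \<in> ball x e'"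
    thus "y \<in> ball a (2 * r)" using near_ball[OF x, of "y - x"] e by (simp add: dist_norm norm_minus_commute)
  qed
  have x2: "x \<in> ball a (2 * r)" using near_ball[OF x, of 0] r by simp
  hence xpos: "x1 x > 2 * r" using near_pos by blast
  let ?f = "\<lambda>y. ker p x y * (u x - u y)"
  define A where "A = ball x e' - ball x e"
  have Asub: "A \<subseteq> ball a (2 * r)" using xb by (auto simp: A_def)
  have Ahalf: "A \<subseteq> halfspace" using Asub near_pos(2) by auto
  have [measurable]: "A \<in> sets borel" "ball x e' \<in> sets borel" "ball a (2 * r) \<in> sets borel" by (auto simp: A_def)
  have Sm: "halfspace - ball x e' \<in> sets lebesgue" "A \<in> sets lebesgue"
    by (auto intro!: sets_completionI_sets)
  have int: "set_integrable lebesgue (halfspace - ball x e) ?f"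
    using r xpos e by (intro set_integrable_trunc p_gt u) auto
  have split: "halfspace - ball x e = (halfspace - ball x e') \<union> A"
    using Ahalf e by (auto simp: A_def)
  have "trunc p u x e = trunc p u x e' + set_lebesgue_integral lebesgue A ?f"
    unfolding trunc_def split
  proof (rule set_integral_Un)
    show "(halfspace - ball x e') \<inter> A = {}" by (auto simp: A_def)
    show "set_integrable lebesgue (halfspace - ball x e') ?f" "set_integrable lebesgue A ?f"
      using int split Sm by (auto intro: set_integrable_subset)
  qed
  hence td: "trunc p u x e - trunc p u x e' = set_lebesgue_integral lebesgue A ?f" by simp
  \<comment> \<open>Globally \<open>u\<close> is only Lebesgue measurable. Cut off to the ball on
    which it is continuous it becomes Borel, so that the change of variables for
    \<open>lborel\<close> applies.\<close>
  define v where "v = (\<lambda>y. indicator (ball a (2 * r)) y *\<^sub>R u y)"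
  have [measurable]: "v \<in> borel_measurable borel"
    unfolding v_def by (rule borel_measurable_continuous_on_indicator) (use cont in auto)
  have v: "v y = u y" if "y \<in> ball a (2 * r)" for y using that by (simp add: v_def)
  define P where "P = (\<lambda>z. indicator (ball 0 e') z * (indicator {z. e \<le> norm z} z * norm z powr (- p) * (v x - v (x + z))))"
  define Q where "Q = (\<lambda>z. indicator (ball 0 e') z * (indicator {z. e \<le> norm z} z * norm (reflect x - x - z) powr (- p) * (v x - v (x + z))))"
  have [measurable]: "ball 0 e' \<in> sets (borel :: (real^'n::{finite,wellorder}) measure)" by simp
  have [measurable]: "P \<in> borel_measurable borel" "Q \<in> borel_measurable borel"
    unfolding P_def Q_def by measurable
  define G where "G = (\<lambda>y. indicat_real A y *\<^sub>R (ker p x y * (v x - v y)))"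
  have [measurable]: "G \<in> borel_measurable borel" unfolding G_def by measurable
  have "set_lebesgue_integral lebesgue A ?f = (\<integral>y. G y \<partial>lebesgue)"
    unfolding set_lebesgue_integral_def G_def
    by (intro Bochner_Integration.integral_cong) (use v Asub x2 in \<open>auto split: split_indicator\<close>)
  also have "\<dots> = (\<integral>y. G y \<partial>lborel)" by (rule integral_completion) simp
  also have "\<dots> = (\<integral>z. G (x + z) \<partial>lborel)" by (rule integral_shift[symmetric]) simp
  also have "\<dots> = (\<integral>z. P z - Q z \<partial>lborel)"
    by (intro Bochner_Integration.integral_cong) (auto simp: G_def P_def Q_def A_def ker_def dist_norm algebra_simps split: split_indicator)
  finally have fPQ: "set_lebesgue_integral lebesgue A ?f = (\<integral>z. P z - Q z \<partial>lborel)" .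
  have vM: "\<bar>v x - v (x + z)\<bar> \<le> 2 * M" if "z \<in> ball 0 e'" for z :: "real^'n::{finite,wellorder}"
  proof -
    have "x + z \<in> ball a (2 * r)" using near_ball[OF x, of z] that e by simp
    thus ?thesis using M[of x] M[of "x + z"] x2 by (simp add: v)
  qed
  have M0: "M \<ge> 0" using M[OF x2] by linarith
  have en: "e' ^ CARD('n) \<le> e'" using e r power_decreasing[of 1 "CARD('n)" e'] by simp
  have Q: "integrable lborel Q" "\<bar>\<integral>z. Q z \<partial>lborel\<bar> \<le> 2 * M * r powr (- p) * (unit_ball_vol CARD('n) * e')"
  proof -
    have m: "\<bar>indicator {z. e \<le> norm z} z * norm (reflect x - x - z) powr (- p) * (v x - v (x + z))\<bar> \<le> 2 * M * r powr (- p)" if "z \<in> ball 0 e'" for z :: "real^'n::{finite,wellorder}"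
    proof -
      have "x1 (x + z) > 2 * r" using near_pos(1)[OF near_ball[OF x, of z]] that e by simp
      hence "r \<le> norm (reflect x - x - z)" using abs_x1_le_norm[of "reflect x - x - z"] xpos r by simp
      hence "norm (reflect x - x - z) powr (- p) \<le> r powr (- p)"
        using r p_gt by (intro powr_mono2') auto
      hence "norm (reflect x - x - z) powr (- p) * \<bar>v x - v (x + z)\<bar> \<le> r powr (- p) * (2 * M)"
        using vM[OF that] by (intro mult_mono) auto
      thus ?thesis using M0 by (auto simp: abs_mult mult_ac split: split_indicator)
    qed
    show "integrable lborel Q"
      unfolding Q_def by (rule abs_integral_ball_le(1)[OF _ _ m]) (use e in auto)
    have "\<bar>\<integral>z. Q z \<partial>lborel\<bar> \<le> 2 * M * r powr (- p) * (unit_ball_vol CARD('n) * e' ^ CARD('n))"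
      unfolding Q_def by (rule order.trans[OF abs_integral_ball_le(2)[OF _ _ m]]) (use e in auto)
    also have "\<dots> \<le> 2 * M * r powr (- p) * (unit_ball_vol CARD('n) * e')"
      using en M0 by (intro mult_left_mono) auto
    finally show "\<bar>\<integral>z. Q z \<partial>lborel\<bar> \<le> 2 * M * r powr (- p) * (unit_ball_vol CARD('n) * e')" .
  qed
  have P: "integrable lborel P"
    unfolding P_def
  proof (rule abs_integral_ball_le(1))
    fix z :: "real^'n::{finite,wellorder}" assume z: "z \<in> ball 0 e'"
    have "indicat_real {z. e \<le> norm z} z * norm z powr (- p) \<le> e powr (- p)"
      using e p_gt by (auto split: split_indicator intro: powr_mono2')
    hence "indicator {z. e \<le> norm z} z * norm z powr (- p) * \<bar>v x - v (x + z)\<bar> \<le> e powr (- p) * (2 * M)"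
      using vM[OF z] by (intro mult_mono) auto
    thus "\<bar>indicator {z. e \<le> norm z} z * norm z powr (- p) * (v x - v (x + z))\<bar> \<le> e powr (- p) * (2 * M)"
      by (simp add: abs_mult)
  qed (use e in auto)
  have P': "integrable lborel (\<lambda>z. P (- z))" "(\<integral>z. P (- z) \<partial>lborel) = (\<integral>z. P z \<partial>lborel)"
    using P by (simp_all add: integrable_uminus integral_uminus)
  define m where "m = (\<lambda>z::real^'n::{finite,wellorder}. K * (norm z powr (- (p - \<gamma>)) * indicator (ball 0 e') z))"
  have pg: "p - \<gamma> < real CARD('n)" using \<gamma> by (simp add: pdef)
  have m_int: "integrable lborel m" unfolding m_def
    using pg e by (intro integrable_mult_right integrable_norm_powr_ball) auto
  have "2 * (\<integral>z. P z \<partial>lborel) = (\<integral>z. P z + P (- z) \<partial>lborel)" using P P' by simp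
  also have "\<bar>\<dots>\<bar> \<le> (\<integral>z. m z \<partial>lborel)"
  proof (rule order.trans[OF _ Bochner_Integration.integral_norm_bound_integral])
    fix z
    show "norm (P z + P (- z)) \<le> m z"
    proof (cases "z \<in> ball 0 e' \<and> e \<le> norm z")
      case False
      thus ?thesis using K by (auto simp: P_def m_def)
    next
      case True
      hence z: "norm z < r" "norm (- z) < r" using e by auto
      have "P z + P (- z) = norm z powr (- p) * (2 * u x - u (x + z) - u (x - z))"
        using True v[OF near_ball[OF x z(1)]] v[OF near_ball[OF x z(2)]] v[OF x2] by (simp add: P_def algebra_simps)
      also have "norm \<dots> \<le> norm z powr (- p) * (K * norm z powr \<gamma>)"
        unfolding norm_mult using sd[OF x z(1)] by (intro mult_mono) auto
      also have "\<dots> = m z" using True by (simp add: m_def powr_diff powr_minus field_simps)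
      finally show ?thesis .
    qed
  qed (use P P' m_int in auto)
  also have "(\<integral>z. m z \<partial>lborel) = K * (real CARD('n) * unit_ball_vol CARD('n) * (e' powr (\<gamma> - 2 * s) / (\<gamma> - 2 * s)))"
    unfolding m_def using pg e integral_norm_powr_ball[where 'a = "real^'n::{finite,wellorder}", of "p - \<gamma>" e'] by (simp add: pdef)
  finally have "2 * \<bar>\<integral>z. P z \<partial>lborel\<bar> \<le> \<dots>" by simp
  moreover have "(\<integral>z. P z - Q z \<partial>lborel) = (\<integral>z. P z \<partial>lborel) - (\<integral>z. Q z \<partial>lborel)"
    using P Q by simp
  moreover have "\<bar>\<integral>z. P z \<partial>lborel\<bar> \<ge> 0" by simp
  ultimately show ?thesis unfolding td fPQ using Q(2) by linarith
qed

definition modulus :: "real \<Rightarrow> real" where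
  "modulus e = K * (real CARD('n) * unit_ball_vol CARD('n) * (e powr (\<gamma> - 2 * s) / (\<gamma> - 2 * s)))
      + 2 * M * r powr (- p) * (unit_ball_vol CARD('n) * e)"

lemma modulus_tendsto: "(modulus \<longlongrightarrow> 0) (at_right 0)"
proof -
  have e: "((\<lambda>e::real. e) \<longlongrightarrow> 0) (at_right 0)" by (rule tendsto_ident_at)
  hence "((\<lambda>e. e powr (\<gamma> - 2 * s)) \<longlongrightarrow> 0 powr (\<gamma> - 2 * s)) (at_right 0)"
  proof (rule tendsto_powr')
    show "0 \<noteq> (0::real) \<or> 0 < \<gamma> - 2 * s \<and> (\<forall>\<^sub>F x in at_right 0. 0 \<le> (x::real))"
      using \<gamma> by (auto simp: eventually_at_right_field intro: exI[of _ 1])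
  qed simp
  hence "(modulus \<longlongrightarrow> K * (real CARD('n) * unit_ball_vol CARD('n) * (0 / (\<gamma> - 2 * s))) + 2 * M * r powr (- p) * (unit_ball_vol CARD('n) * 0)) (at_right 0)"
    unfolding modulus_def[abs_def] using \<gamma> e by (intro tendsto_intros) auto
  thus ?thesis by simp
qed

lemma trunc_limit:
  assumes x: "x \<in> ball a r"
  shows "\<exists>l. (trunc p u x \<longlongrightarrow> l) (at_right 0) \<and> (\<forall>e. 0 < e \<and> e \<le> r \<longrightarrow> \<bar>l - trunc p u x e\<bar> \<le> modulus e)"
  using limit_at_right_of_modulus[OF r(1) modulus_tendsto, of "trunc p u x"] trunc_diff_bound[OF x]
  unfolding modulus_def by blast

text \<open>Dominated convergence: with balls of fixed radius \<open>e\<close> removed, the kernels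
  with poles \<open>x j\<close> have a common bound by a multiple of the weight. The indicators can
  fail to converge only on the sphere of radius \<open>e\<close> around \<open>a\<close>, a null
  set.\<close>

lemma trunc_continuous:
  assumes xa: "x \<longlonglongrightarrow> a" and x: "\<And>j. x j \<in> ball a r" and e: "0 < e" "e \<le> r"
  shows "(\<lambda>j. trunc p u (x j) e) \<longlonglongrightarrow> trunc p u a e"
proof -
  define R where "R = norm a + 2 * r"
  define D where "D = 2 * p * (1 + (2 * R) powr (p + 2)) * e powr (- p - 2) * R"
  have ball2: "x j \<in> ball a (2 * r)" for j using near_ball[OF x, of 0] r by simp
  have a2: "a \<in> ball a (2 * r)" using r by simp
  have xR: "norm (x j) \<le> R" for j
    using ball2[of j] norm_triangle_sub[of "x j" a] by (simp add: R_def dist_norm norm_minus_commute)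
  have eR: "e \<le> R" using e r by (simp add: R_def add_increasing)
  have M0: "M \<ge> 0" using M[OF a2] by linarith
  have D0: "D \<ge> 0" using p_gt eR e unfolding D_def by (intro mult_nonneg_nonneg add_nonneg_nonneg) auto
  define F where "F = (\<lambda>x y. indicat_real (halfspace - ball x e) y *\<^sub>R (ker p x y * (u x - u y)))"
  define w where "w = (\<lambda>y. D * (M * (indicat_real halfspace y *\<^sub>R (wgt p y * 1)) + \<bar>indicat_real halfspace y *\<^sub>R (wgt p y * u y)\<bar>))"
  have F_int: "integrable lebesgue (F v)" if "v \<in> ball a (2 * r)" for v
    using set_integrable_trunc[OF p_gt(1) u, of v e "u v"] near_pos(1)[OF that] r e
    unfolding F_def set_integrable_def by simp
  have cu: "(\<lambda>j. u (x j)) \<longlonglongrightarrow> u a"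
  proof -
    have "isCont u a" using cont a2 continuous_on_eq_continuous_at[of "ball a (2 * r)" u] by blast
    thus ?thesis using xa by (rule isCont_tendsto_compose)
  qed
  have "(\<lambda>j. \<integral>y. F (x j) y \<partial>lebesgue) \<longlonglongrightarrow> (\<integral>y. F a y \<partial>lebesgue)"
  proof (rule integral_dominated_convergence)
    show "F a \<in> borel_measurable lebesgue" "\<And>j. F (x j) \<in> borel_measurable lebesgue"
      using F_int[OF a2] F_int[OF ball2] by auto
    have "set_integrable lebesgue halfspace (\<lambda>y::real^'n::{finite,wellorder}. wgt p y * 1)"
      by (rule set_integrable_wgt[OF p_gt(1), where B = 1]) auto
    thus "integrable lebesgue w"
      using u unfolding w_def set_integrable_def by (intro integrable_mult_right Bochner_Integration.integrable_add integrable_abs)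
    show "AE y in lebesgue. norm (F (x j) y) \<le> w y" for j
    proof (intro AE_I2)
      fix y
      show "norm (F (x j) y) \<le> w y"
      proof (cases "y \<in> halfspace - ball (x j) e")
        case False
        thus ?thesis using D0 M0 wgt_pos[of y p] by (auto simp: F_def w_def halfspace_def split: split_indicator)
      next
        case True
        hence y: "x1 y > 0" "e \<le> norm (x j - y)" "y \<noteq> x j" using e by (auto simp: halfspace_def dist_norm)
        have xp: "x1 (x j) > 0" using near_pos(1)[OF ball2[of j]] r by simp
        have "ker p (x j) y \<le> 2 * p * (1 + (2 * R) powr (p + 2)) * e powr (- p - 2) * x1 (x j) * (x1 y / (1 + norm y powr (p + 2)))"
          by (rule ker_le_weight[OF xp xR y(1,2) p_gt(2) e(1) eR])
        also have "\<dots> \<le> D * wgt p y"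
          unfolding D_def wgt_def using p_gt y xR[of j] abs_x1_le_norm[of "x j"]
          by (intro mult_right_mono mult_left_mono) (auto intro!: mult_nonneg_nonneg add_nonneg_nonneg divide_nonneg_nonneg)
        finally have k: "\<bar>ker p (x j) y\<bar> \<le> D * wgt p y" using ker_nonneg[OF xp y(1) p_gt(2) y(3)] by simp
        have "\<bar>u (x j) - u y\<bar> \<le> M + \<bar>u y\<bar>" using M[OF ball2[of j]] by linarith
        with k have "\<bar>ker p (x j) y\<bar> * \<bar>u (x j) - u y\<bar> \<le> D * wgt p y * (M + \<bar>u y\<bar>)"
          by (intro mult_mono) auto
        also have "\<dots> = w y" using True wgt_pos[OF y(1), of p] by (simp add: w_def abs_mult algebra_simps)
        also have "\<bar>ker p (x j) y\<bar> * \<bar>u (x j) - u y\<bar> = norm (F (x j) y)" using True by (simp add: F_def abs_mult)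
        finally show ?thesis .
      qed
    qed
    show "AE y in lebesgue. (\<lambda>j. F (x j) y) \<longlonglongrightarrow> F a y"
    proof -
      have "sphere a e \<in> null_sets lebesgue" using negligible_sphere[of a e] by (simp add: negligible_iff_null_sets)
      hence "AE y in lebesgue. y \<notin> sphere a e" by (rule AE_not_in)
      thus ?thesis
      proof eventually_elim
        case (elim y)
        have dl: "(\<lambda>j. dist (x j) y) \<longlonglongrightarrow> dist a y" by (intro tendsto_intros xa)
        show "(\<lambda>j. F (x j) y) \<longlonglongrightarrow> F a y"
        proof (cases "y \<in> halfspace \<and> dist a y > e")
          case True
          have "eventually (\<lambda>j. dist (x j) y > e) sequentially" using order_tendstoD(1)[OF dl, of e] True by simp
          hence ev: "eventually (\<lambda>j. ker p (x j) y * (u (x j) - u y) = F (x j) y) sequentially"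
            by eventually_elim (use True in \<open>auto simp: F_def\<close>)
          have ap: "x1 a > 0" using near_pos(1)[OF a2] r by simp
          have nz: "norm (a - y) \<noteq> 0" "norm (reflect a - y) \<noteq> 0"
            using True e norm_reflect_diff_pos[OF ap _ p_gt(2), of y] by (auto simp: halfspace_def)
          have "(\<lambda>j. reflect (x j)) \<longlonglongrightarrow> reflect a"
            unfolding reflect_eq x1_inner by (intro tendsto_intros xa)
          hence "(\<lambda>j. ker p (x j) y * (u (x j) - u y)) \<longlonglongrightarrow> ker p a y * (u a - u y)"
            unfolding ker_def using nz by (intro tendsto_intros xa cu) auto
          moreover have "F a y = ker p a y * (u a - u y)" using True by (simp add: F_def)
          ultimately show ?thesis using Lim_transform_eventually[OF _ ev] by simp
        next
          case False
          have "eventually (\<lambda>j. F (x j) y = 0) sequentially"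
          proof (cases "y \<in> halfspace")
            case True
            hence "dist a y < e" using False elim by (auto simp: less_le dist_commute)
            from order_tendstoD(2)[OF dl this] show ?thesis
              by eventually_elim (auto simp: F_def)
          qed (simp add: F_def)
          moreover have "F a y = 0" using False elim by (auto simp: F_def split: split_indicator)
          ultimately show ?thesis using tendsto_eventually by metis
        qed
      qed
    qed
  qed
  thus ?thesis by (simp add: F_def trunc_def set_lebesgue_integral_def)
qed

text \<open>Three-term estimate: \<open>modulus\<close> controls the distance between limit and
  truncation both at \<open>x j\<close> and at \<open>a\<close>, and for one fixed radius the
  truncations converge.\<close>

lemma trunc_limit_continuous:
  assumes xa: "x \<longlonglongrightarrow> a" and x: "\<And>j. x j \<in> ball a r"
    and L: "\<And>j. (trunc p u (x j) \<longlongrightarrow> L j) (at_right 0)" and l: "(trunc p u a \<longlongrightarrow> l) (at_right 0)"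
  shows "L \<longlonglongrightarrow> l"
proof (rule LIMSEQ_I)
  fix \<epsilon> :: real assume \<epsilon>: "\<epsilon> > 0"
  have bd: "\<bar>k - trunc p u v e\<bar> \<le> modulus e" if "v \<in> ball a r" "(trunc p u v \<longlongrightarrow> k) (at_right 0)" "0 < e" "e \<le> r" for v k e
    using trunc_limit[OF that(1)] that(2-4) tendsto_unique[OF trivial_limit_at_right_real that(2)] by blast
  have "eventually (\<lambda>e. modulus e < \<epsilon> / 3) (at_right 0)"
    using order_tendstoD(2)[OF modulus_tendsto, of "\<epsilon> / 3"] \<epsilon> by simp
  then obtain b where b: "b > 0" "\<And>e. 0 < e \<Longrightarrow> e < b \<Longrightarrow> modulus e < \<epsilon> / 3"
    unfolding eventually_at_right_field by auto
  define e where "e = min r (b / 2)"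
  have e: "0 < e" "e \<le> r" "modulus e < \<epsilon> / 3" using b r by (auto simp: e_def)
  have a: "a \<in> ball a r" using r by simp
  have "eventually (\<lambda>j. dist (trunc p u (x j) e) (trunc p u a e) < \<epsilon> / 3) sequentially"
    using tendstoD[OF trunc_continuous[OF xa x e(1,2)], of "\<epsilon> / 3"] \<epsilon> by simp
  then obtain N where N: "\<And>j. j \<ge> N \<Longrightarrow> dist (trunc p u (x j) e) (trunc p u a e) < \<epsilon> / 3"
    unfolding eventually_sequentially by auto
  have "norm (L j - l) < \<epsilon>" if "j \<ge> N" for j
    using N[OF that] bd[OF x L e(1,2), of j] bd[OF a l e(1,2)] e(3) unfolding dist_real_def real_norm_def by linarith
  thus "\<exists>no. \<forall>j\<ge>no. norm (L j - l) < \<epsilon>" by blast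
qed

end

section \<open>From the equation to the inequality |L u| <= M u\<close>

lemma in_As_wgt:
  fixes u :: "real^'n::{finite,wellorder} \<Rightarrow> real"
  assumes u: "in_As s u" and pos: "\<And>x. x \<in> halfspace \<Longrightarrow> u x \<ge> 0"
  defines "p \<equiv> real CARD('n) + 2 * s"
  shows "set_integrable lebesgue halfspace (\<lambda>y. wgt p y * u y)"
    and "As_norm s u = set_lebesgue_integral lebesgue halfspace (\<lambda>y. wgt p y * u y)"
proof -
  have eq: "As_weight s u y = wgt p y * u y" if "y \<in> halfspace" for y
    using pos[OF that] by (simp add: As_weight_def wgt_def p_def)
  have "indicat_real halfspace y *\<^sub>R As_weight s u y = indicat_real halfspace y *\<^sub>R (wgt p y * u y)" for y
    using eq by (auto split: split_indicator)
  thus "set_integrable lebesgue halfspace (\<lambda>y. wgt p y * u y)" "As_norm s u = set_lebesgue_integral lebesgue halfspace (\<lambda>y. wgt p y * u y)"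
    using u unfolding in_As_def As_norm_def set_integrable_def set_lebesgue_integral_def by (simp_all only:)
qed

lemma exists_good_point:
  fixes a :: "real^'n::{finite,wellorder}"
  assumes "AE x in lebesgue. P x" "t > 0"
  shows "\<exists>x\<in>ball a t. P x"
proof (rule ccontr)
  assume n: "\<not> (\<exists>x\<in>ball a t. P x)"
  from assms(1) have "AE x in lebesgue. x \<notin> ball a t"
    by (rule AE_mp) (use n in auto)
  hence "ball a t \<in> null_sets lebesgue"
    by (subst AE_iff_null_sets) auto
  hence "negligible (ball a t)" by (simp add: negligible_iff_null_sets)
  thus False using open_not_negligible[of "ball a t"] assms(2) by auto
qed

text \<open>The potential is controlled only almost everywhere; continuity of the operator in the base point
  transfers the resulting inequality to every point.\<close>

lemma fraclap_bound:
  fixes u c :: "real^'n::{finite,wellorder} \<Rightarrow> real"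
  assumes s: "0 < s" "s < 1" and C: "C_beta (2 * s + \<alpha>) (ball 0 \<rho>) u" and \<alpha>: "\<alpha> > 0" "2 * s + \<alpha> \<notin> \<int>"
    and u: "in_As s u" and pos: "\<And>x. x \<in> halfspace \<Longrightarrow> u x \<ge> 0"
    and c: "AE x in lebesgue. x \<in> ball 0 \<rho> \<inter> halfspace \<longrightarrow> \<bar>c x\<bar> \<le> M"
    and eq: "\<And>x. x \<in> ball 0 \<rho> \<inter> halfspace \<Longrightarrow> fraclap s u x + c x * u x = 0"
    and a: "a \<in> ball 0 \<rho> \<inter> halfspace"
  defines "p \<equiv> real CARD('n) + 2 * s"
  shows "\<exists>l. (trunc p u a \<longlongrightarrow> l) (at_right 0) \<and>
    \<bar>c_ns CARD('n) s * l + c_ns 1 s / s * u a * x1 a powr (- 2 * s)\<bar> \<le> M * u a"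
proof -
  obtain r0 K \<gamma> where r0: "r0 > 0" "K \<ge> 0" "\<gamma> > 2 * s" "ball a (2 * r0) \<subseteq> ball 0 \<rho>"
    "\<And>x z. x \<in> ball a r0 \<Longrightarrow> norm z < r0 \<Longrightarrow> \<bar>2 * u x - u (x + z) - u (x - z)\<bar> \<le> K * norm z powr \<gamma>"
    using C_beta_second_difference[OF C s \<alpha>, of a] a by blast
  have H: "Holder_on (nat \<lfloor>2 * s + \<alpha>\<rfloor>) (2 * s + \<alpha> - of_int \<lfloor>2 * s + \<alpha>\<rfloor>) (ball 0 \<rho>) u"
    using C unfolding C_beta_def .
  have cont: "continuous_on (ball 0 \<rho>) u" and bdd: "bounded (u ` ball 0 \<rho>)"
  proof -
    have "continuous_on (ball 0 \<rho>) (pds [] u)" "bounded (pds [] u ` ball 0 \<rho>)"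
      using H unfolding Holder_on_def Ck_on_def by (metis le0 list.size(3))+
    thus "continuous_on (ball 0 \<rho>) u" "bounded (u ` ball 0 \<rho>)" by simp_all
  qed
  obtain B where B: "\<And>y. y \<in> ball 0 \<rho> \<Longrightarrow> \<bar>u y\<bar> \<le> B"
    using bdd unfolding bounded_iff ball_simps real_norm_def by blast
  have ap: "x1 a > 0" using a by (simp add: halfspace_def)
  \<comment> \<open>The quarter keeps \<open>ball a (2 * r)\<close> at distance at least
    \<open>2 * r\<close> from the hyperplane.\<close>
  define r where "r = min r0 (min 1 (x1 a / 4))"
  have r: "0 < r" "r \<le> 1" "4 * r \<le> x1 a" "r \<le> r0" using r0(1) ap by (auto simp: r_def)
  have sub: "ball a (2 * r) \<subseteq> ball 0 \<rho>" using r by (intro order.trans[OF _ r0(4)] subset_ball) simp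
  note w = in_As_wgt[OF u pos, folded p_def]
  have pd: "p = real CARD('n) + 2 * s" by (simp add: p_def)
  have B': "\<bar>u y\<bar> \<le> B" if "y \<in> ball a (2 * r)" for y using B that sub by blast
  have sd: "\<bar>2 * u x - u (x + z) - u (x - z)\<bar> \<le> K * norm z powr \<gamma>" if "x \<in> ball a r" "norm z < r" for x z
    using r0(5) that r by simp
  note lim = trunc_limit[OF s(1) pd w(1) r(1,2,3) continuous_on_subset[OF cont sub] B' r0(3,2) sd]
  have lim': "\<exists>l. (trunc p u x \<longlongrightarrow> l) (at_right 0)" if "x \<in> ball a r" for x using lim that by blast
  note limc = trunc_limit_continuous[OF s(1) pd w(1) r(1,2,3) continuous_on_subset[OF cont sub] B' r0(3,2) sd]
  have posn: "x1 y > 0" if "y \<in> ball a r" for y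
    using that abs_x1_le_norm[of "a - y"] r by (auto simp: dist_norm)
  have inB: "y \<in> ball 0 \<rho> \<inter> halfspace" if "y \<in> ball a r" for y
    using that sub r posn[OF that] by (auto simp: halfspace_def subset_eq)
  \<comment> \<open>\<open>fraclap\<close> is written with \<open>Lim\<close>, whose value can be
    identified only once convergence is known; the limit is therefore a premise here.\<close>
  have frac: "fraclap s u x = c_ns CARD('n) s * l + c_ns 1 s / s * u x * x1 x powr (- 2 * s)" if "(trunc p u x \<longlongrightarrow> l) (at_right 0)" for x l
    using tendsto_Lim[OF trivial_limit_at_right_real that] unfolding fraclap_def trunc_def[abs_def] ker_def p_def by simp
  obtain l where l: "(trunc p u a \<longlongrightarrow> l) (at_right 0)" using lim'[of a] r by auto
  have "\<forall>j. \<exists>x\<in>ball a (r / real (Suc j)). x \<in> ball 0 \<rho> \<inter> halfspace \<longrightarrow> \<bar>c x\<bar> \<le> M"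
    using r by (intro allI exists_good_point[OF c]) simp
  then obtain x where x: "\<And>j. x j \<in> ball a (r / real (Suc j))" "\<And>j. x j \<in> ball 0 \<rho> \<inter> halfspace \<Longrightarrow> \<bar>c (x j)\<bar> \<le> M" by metis
  have xr: "x j \<in> ball a r" for j
  proof -
    have "r / real (Suc j) \<le> r" using r by (simp add: field_simps)
    thus ?thesis using x(1)[of j] by simp
  qed
  have xa: "x \<longlonglongrightarrow> a"
  proof (rule metric_tendsto_imp_tendsto)
    show "(\<lambda>j. r / real (Suc j)) \<longlonglongrightarrow> 0"
      using LIMSEQ_inverse_real_of_nat[THEN tendsto_mult_right, of r] by (simp add: divide_inverse mult.commute)
    show "\<forall>\<^sub>F j in sequentially. dist (x j) a \<le> dist (r / real (Suc j)) 0"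
      using x(1) r by (intro always_eventually allI) (auto simp: dist_commute less_imp_le)
  qed
  obtain L where L: "\<And>j. (trunc p u (x j) \<longlongrightarrow> L j) (at_right 0)" using lim'[OF xr] by metis
  have Ll: "L \<longlonglongrightarrow> l" by (rule limc; (assumption | rule xa xr L l))
  have "isCont u a" using cont a continuous_on_eq_continuous_at[of "ball 0 \<rho>" u] by blast
  hence ux: "(\<lambda>j. u (x j)) \<longlonglongrightarrow> u a" using xa by (rule isCont_tendsto_compose)
  have x1x: "(\<lambda>j. x1 (x j)) \<longlonglongrightarrow> x1 a" unfolding x1_inner by (intro tendsto_intros xa)
  have "\<bar>c_ns CARD('n) s * l + c_ns 1 s / s * u a * x1 a powr (- 2 * s)\<bar> \<le> M * u a"
  proof (rule LIMSEQ_le)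
    show "(\<lambda>j. \<bar>c_ns CARD('n) s * L j + c_ns 1 s / s * u (x j) * x1 (x j) powr (- 2 * s)\<bar>) \<longlonglongrightarrow>
      \<bar>c_ns CARD('n) s * l + c_ns 1 s / s * u a * x1 a powr (- 2 * s)\<bar>"
      using ap by (intro tendsto_intros Ll ux x1x) auto
    show "(\<lambda>j. M * u (x j)) \<longlonglongrightarrow> M * u a" by (intro tendsto_intros ux)
    have "\<bar>c_ns CARD('n) s * L j + c_ns 1 s / s * u (x j) * x1 (x j) powr (- 2 * s)\<bar> \<le> M * u (x j)" for j
    proof -
      have "\<bar>fraclap s u (x j)\<bar> = \<bar>c (x j)\<bar> * u (x j)"
        using eq[OF inB[OF xr[of j]]] pos[of "x j"] inB[OF xr[of j]] by (simp add: eq_neg_iff_add_eq_0[symmetric] abs_mult)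
      also have "\<dots> \<le> M * u (x j)" using x(2) inB[OF xr[of j]] pos by (intro mult_right_mono) auto
      finally show ?thesis unfolding frac[OF L] .
    qed
    thus "\<exists>N. \<forall>n\<ge>N. \<bar>c_ns CARD('n) s * L n + c_ns 1 s / s * u (x n) * x1 (x n) powr (- 2 * s)\<bar> \<le> M * u (x n)" by blast
  qed
  thus ?thesis using l by blast
qed


section \<open>The lower bound\<close>

lemma c_ns_pos: "0 < s \<Longrightarrow> s < 1 \<Longrightarrow> c_ns n s > 0"
  unfolding c_ns_def by (intro divide_pos_pos mult_pos_pos Gamma_real_pos) (auto intro: add_nonneg_pos)

text \<open>What the barrier arguments retain of a solution. The potential and the Hoelder data have
  disappeared in favour of \<open>M\<close>, so constants derived from this predicate depend on n,
  s, \<open>\<rho>\<close> and \<open>M\<close> only.\<close>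

definition subsuper :: "real \<Rightarrow> real \<Rightarrow> real \<Rightarrow> (real^'n::{finite,wellorder} \<Rightarrow> real) \<Rightarrow> bool" where
  "subsuper s \<rho> M u \<longleftrightarrow> continuous_on (ball 0 \<rho>) u \<and> (\<forall>x\<in>halfspace. u x \<ge> 0) \<and> (\<forall>x. x1 x = 0 \<longrightarrow> u x = 0) \<and>
    set_integrable lebesgue halfspace (\<lambda>y. wgt (real CARD('n) + 2 * s) y * u y) \<and>
    (\<forall>a\<in>ball 0 \<rho> \<inter> halfspace. \<exists>l. (trunc (real CARD('n) + 2 * s) u a \<longlongrightarrow> l) (at_right 0) \<and>
      \<bar>c_ns CARD('n) s * l + c_ns 1 s / s * u a * x1 a powr (- 2 * s)\<bar> \<le> M * u a)"

text \<open>This is \<open>As_norm\<close> for functions that are nonnegative on the half-space. It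
  is also applied to \<open>x1\<close>, to measure what the barrier costs.\<close>

definition mass :: "real \<Rightarrow> (real^'n::{finite,wellorder} \<Rightarrow> real) \<Rightarrow> real" where
  "mass s u = set_lebesgue_integral lebesgue halfspace (\<lambda>y. wgt (real CARD('n) + 2 * s) y * u y)"

lemma mass_nonneg: "(\<And>y. y \<in> halfspace \<Longrightarrow> f y \<ge> 0) \<Longrightarrow> mass s f \<ge> 0"
  unfolding mass_def set_lebesgue_integral_def
  by (intro Bochner_Integration.integral_nonneg)
    (auto simp: halfspace_def split: split_indicator intro!: mult_nonneg_nonneg less_imp_le[OF wgt_pos])

lemma set_integrable_wgt_gau:
  assumes "p > real CARD('n::{finite,wellorder})" "l > 0"
  shows "set_integrable lebesgue halfspace (\<lambda>y::real^'n::{finite,wellorder}. wgt p y * gau l y)"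
proof (rule set_integrable_wgt[OF assms(1), where B = "1 + 1 / l"])
  fix y :: "real^'n::{finite,wellorder}"
  have "\<bar>gau l y\<bar> \<le> (1 + 1 / l) * 1" using abs_gau_le[OF assms(2), of y] by simp
  also have "\<dots> \<le> (1 + 1 / l) * (1 + norm y)" using assms(2) by (intro mult_left_mono) auto
  finally show "\<bar>gau l y\<bar> \<le> (1 + 1 / l) * (1 + norm y)" .
qed measurable

text \<open>With this the truncated weighted integral becomes the full mass when the removed ball
  shrinks.\<close>

lemma set_integral_minus_ball_tendsto:
  fixes f :: "'a::euclidean_space \<Rightarrow> real"
  assumes f: "set_integrable lebesgue A f" and A: "A \<in> sets lebesgue" and e: "e \<longlonglongrightarrow> 0"
  shows "(\<lambda>k. set_lebesgue_integral lebesgue (A - ball a (e k)) f) \<longlonglongrightarrow> set_lebesgue_integral lebesgue A f"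
  unfolding set_lebesgue_integral_def
proof (rule integral_dominated_convergence[where w = "\<lambda>y. \<bar>indicat_real A y *\<^sub>R f y\<bar>"])
  have i: "integrable lebesgue (\<lambda>y. indicat_real A y *\<^sub>R f y)" using f unfolding set_integrable_def .
  thus "(\<lambda>y. indicat_real A y *\<^sub>R f y) \<in> borel_measurable lebesgue" by simp
  show "integrable lebesgue (\<lambda>y. \<bar>indicat_real A y *\<^sub>R f y\<bar>)" using i by (rule integrable_abs)
  fix k
  have "set_integrable lebesgue (A - ball a (e k)) f" using f by (rule set_integrable_subset) (use A in auto)
  thus "(\<lambda>y. indicat_real (A - ball a (e k)) y *\<^sub>R f y) \<in> borel_measurable lebesgue"
    unfolding set_integrable_def by simp
  show "AE y in lebesgue. norm (indicat_real (A - ball a (e k)) y *\<^sub>R f y) \<le> \<bar>indicat_real A y *\<^sub>R f y\<bar>"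
    by (intro AE_I2) (auto split: split_indicator)
next
  have "AE y in lebesgue. y \<noteq> a" using AE_lborel_singleton[of a] by (rule AE_completion)
  thus "AE y in lebesgue. (\<lambda>k. indicat_real (A - ball a (e k)) y *\<^sub>R f y) \<longlonglongrightarrow> indicat_real A y *\<^sub>R f y"
  proof eventually_elim
    case (elim y)
    hence "dist a y > 0" by simp
    with e have "eventually (\<lambda>k. e k < dist a y) sequentially" by (rule order_tendstoD(2))
    hence "eventually (\<lambda>k. indicat_real (A - ball a (e k)) y *\<^sub>R f y = indicat_real A y *\<^sub>R f y) sequentially"
      by eventually_elim (auto split: split_indicator)
    thus ?case by (rule tendsto_eventually)
  qed
qed

text \<open>\<open>\<phi>\<close> vanishes on the sphere of radius \<open>r\<close> and is negative outside, so \<open>\<phi> \<le> \<sigma> (u + \<eta>)\<close>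
  on the whole half-space once it holds on the half-ball. Shifting \<open>u\<close> by the constant \<open>\<eta>\<close> keeps the contact
  point off the hyperplane, and the resulting zero-order term has the favourable sign.\<close>

lemma lower_bound_shifted:
  fixes u :: "real^'n::{finite,wellorder} \<Rightarrow> real"
  assumes p_def: "p = real CARD('n) + 2 * s" and s: "0 < s" "s < 1" and r: "0 < r" "r < \<rho>" and M: "M \<ge> 0"
    and G: "\<And>a::real^'n::{finite,wellorder}. x1 a > 0 \<Longrightarrow> norm a \<le> \<rho> \<Longrightarrow> \<exists>E. \<forall>e. 0 < e \<and> e < 1 \<and> e < x1 a \<longrightarrow>
      \<bar>c_ns CARD('n) s * trunc p (gau 1) a e + c_ns 1 s / s * gau 1 a * x1 a powr (- 2 * s)\<bar> \<le> C1 * x1 a + E * e"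
    and G': "\<And>a::real^'n::{finite,wellorder}. x1 a > 0 \<Longrightarrow> norm a \<le> \<rho> \<Longrightarrow> \<exists>E. \<forall>e. 0 < e \<and> e < 1 \<and> e < x1 a \<longrightarrow>
      \<bar>c_ns CARD('n) s * trunc p (gau (1/4)) a e + c_ns 1 s / s * gau (1/4) a * x1 a powr (- 2 * s)\<bar> \<le> C2 * x1 a + E * e"
    and u: "subsuper s \<rho> M u" and \<eta>: "\<eta> > 0" and x: "x \<in> ball 0 r \<inter> halfspace"
  defines "k \<equiv> exp (- (3 / 4) * r\<^sup>2)"
    and "\<kappa> \<equiv> 2 / (2 powr (real CARD('n) + 2 * s + 2) * (1 + \<rho> powr (real CARD('n) + 2 * s + 2)))"
  shows "(gau 1 x - k * gau (1/4) x) * mass s u \<le> ((C1 + k * C2 + M) / (c_ns CARD('n) s * \<kappa>) + mass s (x1 :: real^'n::{finite,wellorder} \<Rightarrow> real)) * (u x + \<eta>)"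
proof -
  let ?c = "c_ns CARD('n) s"
  have c: "?c > 0" using c_ns_pos[OF s] .
  have c1: "c_ns 1 s / s > 0" using c_ns_pos[OF s] s by simp
  have pn: "p > real CARD('n)" using s by (simp add: p_def)
  have p1: "p > 1"
  proof -
    have "real CARD('n) \<ge> 1" by (simp add: Suc_leI)
    thus ?thesis using pn by linarith
  qed
  have \<kappa>: "\<kappa> > 0" unfolding \<kappa>_def by (intro divide_pos_pos mult_pos_pos) (auto intro: add_pos_nonneg)
  have k: "k > 0" by (simp add: k_def)
  have ucont: "continuous_on (ball 0 \<rho>) u" and upos: "\<And>y. y \<in> halfspace \<Longrightarrow> u y \<ge> 0" and u0: "\<And>y. x1 y = 0 \<Longrightarrow> u y = 0"
    and uint: "set_integrable lebesgue halfspace (\<lambda>y. wgt p y * u y)"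
    and ueq: "\<And>a. a \<in> ball 0 \<rho> \<inter> halfspace \<Longrightarrow> \<exists>l. (trunc p u a \<longlongrightarrow> l) (at_right 0) \<and>
      \<bar>?c * l + c_ns 1 s / s * u a * x1 a powr (- 2 * s)\<bar> \<le> M * u a"
    using u unfolding subsuper_def p_def by blast+
  have upos': "u y \<ge> 0" if "x1 y \<ge> 0" for y
    using that u0[of y] upos[of y] by (cases "x1 y = 0") (auto simp: halfspace_def)
  define \<phi> where "\<phi> = (\<lambda>y::real^'n::{finite,wellorder}. gau 1 y - k * gau (1/4) y)"
  \<comment> \<open>The value of \<open>k\<close> makes the two Gaussian terms agree at radius
    \<open>r\<close>; factoring out the wider Gaussian shows that on the open half-space
    \<open>\<phi>\<close> has the sign of \<open>r - norm y\<close>.\<close>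
  have \<phi>: "\<phi> y = x1 y * (exp (- (norm y)\<^sup>2 / 4) * (exp (- (3 / 4) * (norm y)\<^sup>2) - exp (- (3 / 4) * r\<^sup>2)))" for y
    by (simp add: \<phi>_def gau_def k_def algebra_simps flip: exp_add)
  have \<phi>neg: "\<phi> y \<le> 0" if "x1 y \<ge> 0" "norm y \<ge> r" for y
  proof -
    have "r\<^sup>2 \<le> (norm y)\<^sup>2" using that r by (intro power_mono) auto
    thus ?thesis unfolding \<phi> using that by (intro mult_nonneg_nonpos) auto
  qed
  have \<phi>pos: "\<phi> y > 0" if "x1 y > 0" "norm y < r" for y
  proof -
    have "(norm y)\<^sup>2 < r\<^sup>2" using that by (intro power_strict_mono) auto
    thus ?thesis unfolding \<phi> using that by (intro mult_pos_pos) auto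
  qed
  have gle: "gau 1 y \<le> x1 y" if "x1 y \<ge> 0" for y :: "real^'n::{finite,wellorder}"
    using that by (simp add: gau_def mult_left_le)
  have \<phi>le: "\<phi> y \<le> x1 y" if "x1 y \<ge> 0" for y
    using gle[OF that] k that unfolding \<phi>_def by (simp add: gau_def) (smt (verit) mult_nonneg_nonneg exp_ge_zero)
  define S where "S = cball 0 r \<inter> {y::real^'n::{finite,wellorder}. x1 y \<ge> 0}"
  have S: "compact S" unfolding S_def x1_inner
    by (intro compact_Int_closed compact_cball closed_Collect_le continuous_intros)
  have xS: "x \<in> S" and xp: "x1 x > 0" "norm x < r" using x by (auto simp: S_def halfspace_def)
  have Sball: "S \<subseteq> ball 0 \<rho>" using r by (auto simp: S_def)
  \<comment> \<open>\<open>\<phi>\<close> and \<open>u\<close> both vanish on the hyperplane. The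
    shift by \<open>\<eta>\<close> makes the quotient continuous up to it, with value 0 there, so a
    positive maximum is attained inside the open half-space.\<close>
  have upS: "u y + \<eta> > 0" if "y \<in> S" for y using upos'[of y] that \<eta> by (auto simp: S_def)
  have "continuous_on S (\<lambda>y. \<phi> y / (u y + \<eta>))"
    unfolding \<phi>_def gau_def
    by (intro continuous_intros continuous_on_subset[OF ucont Sball]) (use upS in force)
  then obtain a where a: "a \<in> S" "\<And>y. y \<in> S \<Longrightarrow> \<phi> y / (u y + \<eta>) \<le> \<phi> a / (u a + \<eta>)"
    using continuous_attains_sup[OF S] xS by blast
  define \<sigma> where "\<sigma> = \<phi> a / (u a + \<eta>)"
  have \<sigma>x: "\<phi> x / (u x + \<eta>) \<le> \<sigma>" using a(2)[OF xS] by (simp add: \<sigma>_def)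
  have "0 < \<phi> x / (u x + \<eta>)" using \<phi>pos[OF xp] upS[OF xS] by simp
  hence \<sigma>: "\<sigma> > 0" using \<sigma>x by linarith
  hence \<phi>a: "\<phi> a > 0" using upS[OF a(1)] by (simp add: \<sigma>_def zero_less_divide_iff)
  have ap: "x1 a > 0"
  proof (rule ccontr)
    assume "\<not> x1 a > 0"
    hence "x1 a = 0" using a(1) by (simp add: S_def)
    thus False using \<phi>a by (simp add: \<phi>)
  qed
  have ar: "norm a < r" using \<phi>neg[of a] \<phi>a ap by force
  have ab: "norm a \<le> \<rho>" "a \<in> ball 0 \<rho> \<inter> halfspace" using ar ap r by (auto simp: halfspace_def)
  define W where "W = (\<lambda>y. \<sigma> * (u y + \<eta>) - \<phi> y)"
  have Wa: "\<sigma> * (u a + \<eta>) = \<phi> a" using upS[OF a(1)] by (simp add: \<sigma>_def)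
  have W0: "W y \<ge> 0" if "x1 y > 0" for y
  proof (cases "y \<in> S")
    case True
    thus ?thesis using a(2)[OF True] upS[OF True] by (simp add: W_def \<sigma>_def[symmetric] pos_divide_le_eq)
  next
    case False
    hence "\<phi> y \<le> 0" using that \<phi>neg[of y] by (auto simp: S_def)
    moreover have "\<sigma> * (u y + \<eta>) \<ge> 0" using \<sigma> \<eta> upos'[of y] that by (intro mult_nonneg_nonneg) auto
    ultimately show ?thesis by (simp add: W_def)
  qed
  obtain E1 where E1: "\<And>e. 0 < e \<Longrightarrow> e < 1 \<Longrightarrow> e < x1 a \<Longrightarrow>
      \<bar>?c * trunc p (gau 1) a e + c_ns 1 s / s * gau 1 a * x1 a powr (- 2 * s)\<bar> \<le> C1 * x1 a + E1 * e"
    using G[OF ap ab(1)] unfolding p_def by blast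
  obtain E2 where E2: "\<And>e. 0 < e \<Longrightarrow> e < 1 \<Longrightarrow> e < x1 a \<Longrightarrow>
      \<bar>?c * trunc p (gau (1/4)) a e + c_ns 1 s / s * gau (1/4) a * x1 a powr (- 2 * s)\<bar> \<le> C2 * x1 a + E2 * e"
    using G'[OF ap ab(1)] unfolding p_def by blast
  obtain l where l: "(trunc p u a \<longlongrightarrow> l) (at_right 0)" "\<bar>?c * l + c_ns 1 s / s * u a * x1 a powr (- 2 * s)\<bar> \<le> M * u a"
    using ueq[OF ab(2)] by blast
  let ?q = "c_ns 1 s / s * x1 a powr (- 2 * s)"
  define V where "V = mass s (x1 :: real^'n::{finite,wellorder} \<Rightarrow> real)"
  have x1int: "set_integrable lebesgue halfspace (\<lambda>y::real^'n::{finite,wellorder}. wgt p y * x1 y)"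
    by (rule set_integrable_wgt[OF pn, where B = 1]) (auto intro: order.trans[OF abs_x1_le_norm])
  have Hm: "halfspace \<in> sets lebesgue" by (simp add: sets_completionI_sets)
  \<comment> \<open>\<open>W\<close> is nonnegative and vanishes at \<open>a\<close>, so its
    truncated operator there is minus the integral of \<open>ker p a y * W y\<close>. In this
    integral \<open>W\<close> is at least \<open>\<sigma> * u - x1\<close> and the kernel at least
    \<open>\<kappa> * x1 a\<close> times the weight: the mass of \<open>u\<close> appears, at the
    cost of the mass \<open>V\<close> of \<open>x1\<close>.\<close>
  have key: "\<sigma> * (?c * trunc p u a e + ?q * u a) \<le> (C1 + k * C2) * x1 a + (E1 + k * E2) * e
      - ?c * \<kappa> * x1 a * (\<sigma> * set_lebesgue_integral lebesgue (halfspace - ball a e) (\<lambda>y. wgt p y * u y) - V)"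
    if e: "0 < e" "e < 1" "e < x1 a" for e
  proof -
    let ?S = "halfspace - ball a e"
    have Sm: "?S \<in> sets lebesgue" by (intro sets_completionI_sets) auto
    have i1: "set_integrable lebesgue ?S (\<lambda>y. ker p a y * (gau 1 a - gau 1 y))"
      by (rule set_integrable_trunc[OF pn set_integrable_wgt_gau[OF pn] ap e(1)]) simp
    have i2: "set_integrable lebesgue ?S (\<lambda>y. ker p a y * (gau (1/4) a - gau (1/4) y))"
      by (rule set_integrable_trunc[OF pn set_integrable_wgt_gau[OF pn] ap e(1)]) simp
    have i3: "set_integrable lebesgue ?S (\<lambda>y. ker p a y * (u a - u y))"
      by (rule set_integrable_trunc[OF pn uint ap e(1)])
    have kW: "ker p a y * W y = ker p a y * (gau 1 a - gau 1 y) - k * (ker p a y * (gau (1/4) a - gau (1/4) y)) - \<sigma> * (ker p a y * (u a - u y))" for y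
    proof -
      have Wy: "W y = (gau 1 a - gau 1 y) - k * (gau (1/4) a - gau (1/4) y) - \<sigma> * (u a - u y)"
        using Wa by (simp add: W_def \<phi>_def algebra_simps)
      show ?thesis unfolding Wy by (simp add: algebra_simps)
    qed
    have iW: "set_integrable lebesgue ?S (\<lambda>y. ker p a y * W y)"
      unfolding kW using i1 i2 i3 by (intro set_integral_diff set_integrable_mult_right) auto
    have eqW: "set_lebesgue_integral lebesgue ?S (\<lambda>y. ker p a y * W y) = trunc p (gau 1) a e - k * trunc p (gau (1/4)) a e - \<sigma> * trunc p u a e"
      unfolding kW trunc_def using i1 i2 i3
      by (simp add: set_integral_diff set_integrable_mult_right set_integral_mult_right)
    have iu: "set_integrable lebesgue ?S (\<lambda>y. wgt p y * u y)" "set_integrable lebesgue ?S (\<lambda>y. wgt p y * x1 y)"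
      using uint x1int Sm by (auto intro: set_integrable_subset)
    have "\<kappa> * x1 a * (\<sigma> * set_lebesgue_integral lebesgue ?S (\<lambda>y. wgt p y * u y) - V) \<le>
      \<kappa> * x1 a * (\<sigma> * set_lebesgue_integral lebesgue ?S (\<lambda>y. wgt p y * u y) - set_lebesgue_integral lebesgue ?S (\<lambda>y. wgt p y * x1 y))"
    proof -
      have "set_lebesgue_integral lebesgue ?S (\<lambda>y. wgt p y * x1 y) \<le> V"
        unfolding V_def mass_def p_def[symmetric] set_lebesgue_integral_def
        using iu(2) x1int unfolding set_integrable_def
        by (intro integral_mono) (auto simp: halfspace_def split: split_indicator intro!: mult_nonneg_nonneg less_imp_le[OF wgt_pos])
      thus ?thesis using \<kappa> ap by (intro mult_left_mono) auto
    qed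
    also have "\<dots> = set_lebesgue_integral lebesgue ?S (\<lambda>y. \<kappa> * x1 a * (\<sigma> * (wgt p y * u y) - wgt p y * x1 y))"
      using iu by (simp add: set_integral_diff set_integrable_mult_right set_integral_mult_right)
    also have "\<dots> \<le> set_lebesgue_integral lebesgue ?S (\<lambda>y. ker p a y * W y)"
    proof (rule set_integral_mono[OF _ iW])
      show "set_integrable lebesgue ?S (\<lambda>y. \<kappa> * x1 a * (\<sigma> * (wgt p y * u y) - wgt p y * x1 y))"
        using iu by (intro set_integrable_mult_right set_integral_diff) auto
      fix y assume y: "y \<in> ?S"
      hence y': "x1 y > 0" "y \<noteq> a" using e by (auto simp: halfspace_def)
      have "\<sigma> * u y - x1 y \<le> W y" using \<phi>le[of y] y' mult_pos_pos[OF \<sigma> \<eta>] by (simp add: W_def distrib_left)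
      hence "(\<kappa> * x1 a * wgt p y) * (\<sigma> * u y - x1 y) \<le> (\<kappa> * x1 a * wgt p y) * W y"
        using \<kappa> ap wgt_pos[OF y'(1), of p] by (intro mult_left_mono) auto
      also have "\<dots> \<le> ker p a y * W y"
        using ker_ge_weight[OF ap ab(1) y' p1] W0[OF y'(1)] unfolding \<kappa>_def p_def wgt_def by (intro mult_right_mono) auto
      finally show "\<kappa> * x1 a * (\<sigma> * (wgt p y * u y) - wgt p y * x1 y) \<le> ker p a y * W y"
        by (simp add: algebra_simps)
    qed
    finally have kk: "\<kappa> * x1 a * (\<sigma> * set_lebesgue_integral lebesgue ?S (\<lambda>y. wgt p y * u y) - V) \<le>
      trunc p (gau 1) a e - k * trunc p (gau (1/4)) a e - \<sigma> * trunc p u a e" unfolding eqW .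
    have alg: "c * (A - k * B - T) + q * (g - k * h) = (c * A + q * g) - k * (c * B + q * h) - c * T" for c A k B T q g h :: real
      by (simp add: algebra_simps)
    define T where "T = \<kappa> * x1 a * (\<sigma> * set_lebesgue_integral lebesgue ?S (\<lambda>y. wgt p y * u y) - V)"
    have "?c * (\<sigma> * trunc p u a e) \<le> ?c * (trunc p (gau 1) a e - k * trunc p (gau (1/4)) a e - T)"
      using c kk by (intro mult_left_mono) (auto simp: T_def)
    \<comment> \<open>The favourable sign: \<open>\<sigma> * u a\<close> falls short of
      \<open>\<phi> a\<close> by \<open>\<sigma> * \<eta>\<close>, and the zero-order coefficient is
      nonnegative.\<close>
    moreover have "?q * (\<sigma> * u a) \<le> ?q * (gau 1 a - k * gau (1/4) a)"
    proof (rule mult_left_mono)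
      show "\<sigma> * u a \<le> gau 1 a - k * gau (1/4) a"
        using Wa mult_pos_pos[OF \<sigma> \<eta>] by (simp add: \<phi>_def distrib_left)
      show "?q \<ge> 0" using c1 by (intro mult_nonneg_nonneg) (auto intro: less_imp_le)
    qed
    moreover have "?c * trunc p (gau 1) a e + ?q * gau 1 a \<le> C1 * x1 a + E1 * e"
      using abs_le_D1[OF E1[OF e]] by (simp add: mult_ac)
    moreover have "- (k * (?c * trunc p (gau (1/4)) a e + ?q * gau (1/4) a)) \<le> k * (C2 * x1 a + E2 * e)"
    proof -
      have "- (?c * trunc p (gau (1/4)) a e + ?q * gau (1/4) a) \<le> C2 * x1 a + E2 * e"
        using abs_le_D2[OF E2[OF e]] by (simp add: mult_ac)
      from mult_left_mono[OF this less_imp_le[OF k]] show ?thesis by (simp only: mult_minus_right)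
    qed
    moreover have "\<sigma> * (?c * trunc p u a e + ?q * u a) = ?c * (\<sigma> * trunc p u a e) + ?q * (\<sigma> * u a)" by (simp add: algebra_simps)
    moreover have "?c * (trunc p (gau 1) a e - k * trunc p (gau (1/4)) a e - T) + ?q * (gau 1 a - k * gau (1/4) a) =
      (?c * trunc p (gau 1) a e + ?q * gau 1 a) - k * (?c * trunc p (gau (1/4)) a e + ?q * gau (1/4) a) - ?c * T"
      by (rule alg)
    moreover have "?c * T = ?c * \<kappa> * x1 a * (\<sigma> * set_lebesgue_integral lebesgue ?S (\<lambda>y. wgt p y * u y) - V)"
      by (simp add: T_def)
    moreover have "(C1 + k * C2) * x1 a + (E1 + k * E2) * e = (C1 * x1 a + E1 * e) + k * (C2 * x1 a + E2 * e)" by (simp add: algebra_simps)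
    ultimately show ?thesis by linarith
  qed
  define t where "t = (\<lambda>j. min 1 (x1 a) / real (Suc (Suc j)))"
  have t: "0 < t j" "t j < 1" "t j < x1 a" for j
  proof -
    have "t j < min 1 (x1 a) / 1"
      unfolding t_def using ap by (intro divide_strict_left_mono) auto
    thus "t j < 1" "t j < x1 a" by auto
    show "0 < t j" using ap by (simp add: t_def)
  qed
  have t0: "t \<longlonglongrightarrow> 0"
    using LIMSEQ_Suc[OF LIMSEQ_inverse_real_of_nat[THEN tendsto_mult_right, of "min 1 (x1 a)"]]
    by (simp add: t_def divide_inverse mult.commute)
  have tr: "filterlim t (at_right 0) sequentially"
  proof -
    have "t j \<noteq> 0" for j using t(1)[of j] by linarith
    thus ?thesis unfolding filterlim_at using t0 t by auto
  qed
  have "\<sigma> * (?c * l + ?q * u a) \<le> (C1 + k * C2) * x1 a + (E1 + k * E2) * 0 - ?c * \<kappa> * x1 a * (\<sigma> * mass s u - V)"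
  proof (rule LIMSEQ_le)
    show "(\<lambda>j. \<sigma> * (?c * trunc p u a (t j) + ?q * u a)) \<longlonglongrightarrow> \<sigma> * (?c * l + ?q * u a)"
      by (intro tendsto_intros filterlim_compose[OF l(1) tr])
    show "(\<lambda>j. (C1 + k * C2) * x1 a + (E1 + k * E2) * t j
      - ?c * \<kappa> * x1 a * (\<sigma> * set_lebesgue_integral lebesgue (halfspace - ball a (t j)) (\<lambda>y. wgt p y * u y) - V)) \<longlonglongrightarrow>
      (C1 + k * C2) * x1 a + (E1 + k * E2) * 0 - ?c * \<kappa> * x1 a * (\<sigma> * mass s u - V)"
      unfolding mass_def p_def[symmetric]
      by (intro tendsto_intros t0 set_integral_minus_ball_tendsto[OF uint Hm t0])
  qed (use key[OF t] in blast)
  moreover have "- (M * x1 a) \<le> \<sigma> * (?c * l + ?q * u a)"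
  proof -
    have "\<sigma> * u a \<le> \<phi> a" using Wa mult_pos_pos[OF \<sigma> \<eta>] by (simp add: distrib_left)
    also have "\<dots> \<le> x1 a" using \<phi>le ap by simp
    finally have "M * (\<sigma> * u a) \<le> M * x1 a" using M by (rule mult_left_mono)
    moreover have "\<sigma> * (- (M * u a)) \<le> \<sigma> * (?c * l + ?q * u a)"
      using abs_le_D2[OF l(2)] \<sigma> by (intro mult_left_mono) (simp_all add: mult_ac)
    ultimately show ?thesis by (simp add: mult_ac)
  qed
  \<comment> \<open>Every term now carries \<open>x1 a\<close>, which cancels; the remaining bound
    on \<open>\<sigma> * mass s u\<close> is free of \<open>\<eta>\<close>.\<close>
  ultimately have "x1 a * (?c * \<kappa> * (\<sigma> * mass s u - V)) \<le> x1 a * (C1 + k * C2 + M)"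
    by (simp add: algebra_simps)
  hence "?c * \<kappa> * (\<sigma> * mass s u - V) \<le> C1 + k * C2 + M" using ap by simp
  hence "\<sigma> * mass s u - V \<le> (C1 + k * C2 + M) / (?c * \<kappa>)"
    using c \<kappa> by (subst pos_le_divide_eq) (simp_all add: mult.commute)
  hence "\<sigma> * mass s u \<le> (C1 + k * C2 + M) / (?c * \<kappa>) + V" by simp
  moreover have "\<phi> x / (u x + \<eta>) * mass s u \<le> \<sigma> * mass s u"
  proof (rule mult_right_mono[OF \<sigma>x])
    show "mass s u \<ge> 0" by (rule mass_nonneg) (rule upos)
  qed
  ultimately have "\<phi> x / (u x + \<eta>) * mass s u \<le> (C1 + k * C2 + M) / (?c * \<kappa>) + V" by linarith
  from mult_right_mono[OF this less_imp_le[OF upS[OF xS]]] show ?thesis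
    using upS[OF xS] by (simp add: V_def \<phi>_def)
qed

lemma lower_bound:
  fixes s \<rho> M :: real
  assumes s: "0 < s" "s < 1" and \<rho>: "\<rho> > 0" and M: "M \<ge> 0"
  shows "\<exists>C>0. \<forall>u::real^'n::{finite,wellorder} \<Rightarrow> real. subsuper s \<rho> M u \<longrightarrow>
    (\<forall>x\<in>ball 0 (\<rho> / 2) \<inter> halfspace. C * mass s u * x1 x \<le> u x)"
proof -
  let ?p = "real CARD('n) + 2 * s"
  obtain C1 where C1: "C1 \<ge> 0" "\<And>a::real^'n::{finite,wellorder}. x1 a > 0 \<Longrightarrow> norm a \<le> \<rho> \<Longrightarrow> \<exists>E. \<forall>e. 0 < e \<and> e < 1 \<and> e < x1 a \<longrightarrow>
      \<bar>c_ns CARD('n) s * trunc ?p (gau 1) a e + c_ns 1 s / s * gau 1 a * x1 a powr (- 2 * s)\<bar> \<le> C1 * x1 a + E * e"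
    using trunc_gau_bound[OF s, of 1, where 'n = 'n and R = \<rho>] by auto
  obtain C2 where C2: "C2 \<ge> 0" "\<And>a::real^'n::{finite,wellorder}. x1 a > 0 \<Longrightarrow> norm a \<le> \<rho> \<Longrightarrow> \<exists>E. \<forall>e. 0 < e \<and> e < 1 \<and> e < x1 a \<longrightarrow>
      \<bar>c_ns CARD('n) s * trunc ?p (gau (1/4)) a e + c_ns 1 s / s * gau (1/4) a * x1 a powr (- 2 * s)\<bar> \<le> C2 * x1 a + E * e"
    using trunc_gau_bound[OF s, of "1/4", where 'n = 'n and R = \<rho>] by auto
  \<comment> \<open>A radius strictly between \<open>\<rho> / 2\<close> and \<open>\<rho>\<close>:
    the barrier must be bounded below relative to \<open>x1\<close> on the smaller half-ball, and
    the contact point must stay inside the domain.\<close>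
  define r where "r = 3 / 4 * \<rho>"
  have r: "0 < r" "r < \<rho>" "\<rho> / 2 < r" using \<rho> by (auto simp: r_def)
  define k where "k = exp (- (3 / 4) * r\<^sup>2)"
  define \<kappa> where "\<kappa> = 2 / (2 powr (?p + 2) * (1 + \<rho> powr (?p + 2)))"
  define D where "D = (C1 + k * C2 + M) / (c_ns CARD('n) s * \<kappa>) + mass s (x1 :: real^'n::{finite,wellorder} \<Rightarrow> real)"
  have \<kappa>: "\<kappa> > 0" unfolding \<kappa>_def by (intro divide_pos_pos mult_pos_pos) (auto intro: add_pos_nonneg)
  have D: "D \<ge> 0" unfolding D_def
  proof (intro add_nonneg_nonneg divide_nonneg_nonneg mult_nonneg_nonneg)
    show "mass s (x1 :: real^'n::{finite,wellorder} \<Rightarrow> real) \<ge> 0" by (rule mass_nonneg) (simp add: halfspace_def)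
  qed (use C1 C2 M \<kappa> c_ns_pos[OF s, of "CARD('n)"] in \<open>auto simp: k_def\<close>)
  \<comment> \<open>Lower bound for the barrier divided by \<open>x1\<close> when
    \<open>norm x < \<rho> / 2\<close>: both factors decrease in \<open>norm x\<close>, and their
    values at \<open>\<rho> / 2\<close> are taken.\<close>
  define m where "m = exp (- \<rho>\<^sup>2 / 16) * (exp (- (3 / 4) * (\<rho> / 2)\<^sup>2) - exp (- (3 / 4) * r\<^sup>2))"
  have m: "m > 0"
  proof -
    have "(\<rho> / 2)\<^sup>2 < r\<^sup>2" using r \<rho> by (intro power_strict_mono) auto
    thus ?thesis unfolding m_def by (intro mult_pos_pos) auto
  qed
  show ?thesis
  proof (intro exI[of _ "m / (D + 1)"] conjI allI impI ballI)
    show "m / (D + 1) > 0" using m D by simp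
    fix u :: "real^'n::{finite,wellorder} \<Rightarrow> real" and x :: "real^'n::{finite,wellorder}"
    assume u: "subsuper s \<rho> M u" and x: "x \<in> ball 0 (\<rho> / 2) \<inter> halfspace"
    have xr: "x \<in> ball 0 r \<inter> halfspace" using x r by auto
    have xp: "x1 x > 0" "norm x < \<rho> / 2" using x by (auto simp: halfspace_def)
    let ?\<phi> = "gau 1 x - k * gau (1/4) x"
    have "?\<phi> * mass s u \<le> D * (u x + \<eta>)" if "\<eta> > 0" for \<eta>
      unfolding D_def k_def \<kappa>_def by (rule lower_bound_shifted[OF refl s r(1,2) M C1(2) C2(2) u that xr])
    hence "?\<phi> * mass s u \<le> D * u x"
    proof -
      have lim: "((\<lambda>\<eta>. D * (u x + \<eta>)) \<longlongrightarrow> D * (u x + 0)) (at_right 0)" by (intro tendsto_intros)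
      have "eventually (\<lambda>\<eta>. ?\<phi> * mass s u \<le> D * (u x + \<eta>)) (at_right 0)"
        unfolding eventually_at_right_field using \<open>\<And>\<eta>. \<eta> > 0 \<Longrightarrow> _\<close> by (intro exI[of _ 1]) auto
      from tendsto_lowerbound[OF lim this trivial_limit_at_right_real] show ?thesis by simp
    qed
    also have "\<dots> \<le> (D + 1) * u x" using u x by (intro mult_right_mono) (auto simp: subsuper_def)
    finally have 1: "?\<phi> * mass s u \<le> (D + 1) * u x" .
    have "?\<phi> = x1 x * (exp (- (norm x)\<^sup>2 / 4) * (exp (- (3 / 4) * (norm x)\<^sup>2) - exp (- (3 / 4) * r\<^sup>2)))"
      by (simp add: gau_def k_def algebra_simps flip: exp_add)
    also have "\<dots> \<ge> x1 x * m"
    proof -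
      have n2: "(norm x)\<^sup>2 \<le> (\<rho> / 2)\<^sup>2" using xp by (intro power_mono) auto
      hence "- \<rho>\<^sup>2 / 16 \<le> - (norm x)\<^sup>2 / 4" by (simp add: power_divide)
      thus ?thesis unfolding m_def using n2 xp m[unfolded m_def] r \<rho>
        by (intro mult_left_mono mult_mono) (auto simp: zero_less_mult_iff)
    qed
    finally have "x1 x * m \<le> ?\<phi>" .
    moreover have "mass s u \<ge> 0" using u by (intro mass_nonneg) (simp add: subsuper_def)
    ultimately have "x1 x * m * mass s u \<le> (D + 1) * u x" using 1 mult_right_mono[of "x1 x * m" ?\<phi> "mass s u"] by linarith
    thus "m / (D + 1) * mass s u * x1 x \<le> u x" using D by (simp add: field_simps)
  qed
qed


section \<open>The upper bound\<close>

text \<open>Two regimes. For \<open>norm (a - y) \<le> x1 a\<close> the crude kernel bound suffices,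
  as \<open>x1 y \<le> 2 * x1 a\<close>; beyond that \<open>ker_le2\<close> supplies
  \<open>x1 a\<close>, and both factors \<open>x1 y\<close> are at most
  \<open>2 * norm (a - y)\<close>.\<close>

lemma ker_mult_le:
  fixes a y :: "real^'n::{finite,wellorder}"
  assumes a: "x1 a > 0" and y: "x1 y > 0" "y \<noteq> a" and p: "p > 1"
  shows "ker p a y * x1 y \<le> 8 * p * x1 a * norm (a - y) powr (- p)"
proof -
  define t where "t = norm (a - y)"
  have t: "t > 0" using y by (simp add: t_def)
  have yt: "x1 y \<le> x1 a + t" using abs_x1_le_norm[of "a - y"] by (simp add: t_def)
  show ?thesis
  proof (cases "t \<le> x1 a")
    case True
    have "ker p a y * x1 y \<le> t powr (- p) * (2 * x1 a)"
      using ker_le[OF a y(1) p] True yt y a unfolding t_def[symmetric] by (intro mult_mono) auto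
    also have "\<dots> \<le> t powr (- p) * (8 * p * x1 a)" using a p by (intro mult_left_mono mult_right_mono) auto
    finally show ?thesis by (simp add: t_def mult_ac)
  next
    case False
    have "ker p a y * x1 y \<le> (2 * p * x1 a * x1 y * t powr (- p - 2)) * x1 y"
      unfolding t_def using ker_le2[OF a y(1) p y(2)] y by (intro mult_right_mono) auto
    also have "\<dots> = 2 * p * x1 a * t powr (- p - 2) * (x1 y)\<^sup>2" by (simp add: power2_eq_square)
    also have "\<dots> \<le> 2 * p * x1 a * t powr (- p - 2) * (2 * t)\<^sup>2"
      using False yt y a p by (intro mult_left_mono power_mono) auto
    also have "\<dots> = 8 * p * x1 a * t powr (- p)"
      using t by (simp add: powr_diff power2_eq_square)
    finally show ?thesis by (simp add: t_def)
  qed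
qed

text \<open>Moments of the kernel times \<open>x1\<close> over an annulus, bounded uniformly in the
  inner radius \<open>e\<close>. The second moment converges since s < 1. The first would diverge in
  absolute value for s >= 1/2, so it is treated by two cancellations, one tangential and one normal
  to the hyperplane.\<close>

lemma near_error:
  fixes a :: "real^'n::{finite,wellorder}" and s e r :: real
  assumes p_def: "p = real CARD('n) + 2 * s" and s: "0 < s" "s < 1" and a: "x1 a > 0" and e: "0 < e" "e < r"
  defines "j \<equiv> \<lambda>z. indicator {z. e \<le> norm z \<and> norm z < r \<and> x1 z > - x1 a} z * (ker p a (a + z) * x1 (a + z))"
    and "\<Omega> \<equiv> real CARD('n) * unit_ball_vol CARD('n) * (r powr (2 - 2 * s) / (2 - 2 * s))"
  shows "integrable lborel (\<lambda>z. j z * (a \<bullet> z))" "\<bar>\<integral>z. j z * (a \<bullet> z) \<partial>lborel\<bar> \<le> 16 * p * x1 a * \<Omega>"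
    and "integrable lborel (\<lambda>z. j z * (norm z)\<^sup>2)" "(\<integral>z. j z * (norm z)\<^sup>2 \<partial>lborel) \<le> 8 * p * x1 a * \<Omega>"
proof -
  have n1: "real CARD('n) \<ge> 1" by (simp add: Suc_leI)
  have p1: "p > 1" unfolding p_def using s n1 by linarith
  have p2: "p - 2 < real CARD('n)" using s by (simp add: p_def)
  define w where "w = (\<lambda>z::real^'n::{finite,wellorder}. norm z powr (- (p - 2)) * indicator (ball 0 r) z)"
  have w_int: "integrable lborel w" and w_val: "(\<integral>z. w z \<partial>lborel) = \<Omega>"
    using integrable_norm_powr_ball[where 'a = "real^'n::{finite,wellorder}", of "p - 2" r]
      integral_norm_powr_ball[where 'a = "real^'n::{finite,wellorder}", of "p - 2" r] p2 e
    by (simp_all add: w_def \<Omega>_def p_def)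
  have w0: "w z \<ge> 0" for z by (simp add: w_def)
  have [measurable]: "j \<in> borel_measurable borel"
    unfolding j_def ker_def by measurable
  have j0: "j z \<ge> 0" for z
  proof (cases "e \<le> norm z \<and> norm z < r \<and> x1 z > - x1 a")
    case True
    hence "ker p a (a + z) \<ge> 0" using e by (intro ker_nonneg a p1) auto
    thus ?thesis using True by (simp add: j_def)
  qed (simp add: j_def)
  have jle: "j z \<le> 8 * p * x1 a * norm z powr (- p)" for z
  proof (cases "e \<le> norm z \<and> norm z < r \<and> x1 z > - x1 a")
    case True
    hence "ker p a (a + z) * x1 (a + z) \<le> 8 * p * x1 a * norm (a - (a + z)) powr (- p)"
      using e by (intro ker_mult_le a p1) auto
    thus ?thesis using True by (simp add: j_def)
  qed (use p1 a in \<open>simp add: j_def\<close>)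
  have jsupp: "j z = 0" if "\<not> (e \<le> norm z \<and> norm z < r)" for z using that by (auto simp: j_def)
  have w_eq: "norm z powr (- p) * (norm z)\<^sup>2 = w z" if "e \<le> norm z" "norm z < r" for z
    using that e by (auto simp: w_def powr_diff powr_minus field_simps power2_eq_square)
  have j2: "j z * (norm z)\<^sup>2 \<le> 8 * p * x1 a * w z" for z
  proof (cases "e \<le> norm z \<and> norm z < r")
    case True
    have "j z * (norm z)\<^sup>2 \<le> (8 * p * x1 a * norm z powr (- p)) * (norm z)\<^sup>2" by (intro mult_right_mono jle) auto
    thus ?thesis using True w_eq[of z] by (simp add: mult.assoc)
  qed (use p1 a w0 jsupp in auto)
  show i2: "integrable lborel (\<lambda>z. j z * (norm z)\<^sup>2)"
    by (rule Bochner_Integration.integrable_bound[OF integrable_mult_right[OF w_int, of "8 * p * x1 a"]])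
      (use j2 j0 in \<open>auto intro!: AE_I2 order.trans[OF _ abs_ge_self]\<close>)
  have "(\<integral>z. j z * (norm z)\<^sup>2 \<partial>lborel) \<le> (\<integral>z. 8 * p * x1 a * w z \<partial>lborel)"
    using i2 w_int j2 by (intro integral_mono) auto
  thus "(\<integral>z. j z * (norm z)\<^sup>2 \<partial>lborel) \<le> 8 * p * x1 a * \<Omega>" by (simp add: w_val)
  define f where "f = (\<lambda>z. j z * (a \<bullet> z))"
  have [measurable]: "f \<in> borel_measurable borel" unfolding f_def by measurable
  have f_int: "integrable lborel f"
  proof (rule Bochner_Integration.integrable_bound[OF integrable_mult_right[OF i2, of "norm a / e"]])
    have *: "\<bar>f z\<bar> \<le> norm a / e * (j z * (norm z)\<^sup>2)" for z
    proof (cases "e \<le> norm z")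
      case True
      have "\<bar>a \<bullet> z\<bar> \<le> norm a * norm z" by (rule Cauchy_Schwarz_ineq2)
      also have "\<dots> \<le> norm a * norm z * (norm z / e)" using True e mult_left_mono[of 1 "norm z / e" "norm a * norm z"] by simp
      finally have "j z * \<bar>a \<bullet> z\<bar> \<le> j z * (norm a * norm z * (norm z / e))" using j0 by (intro mult_left_mono)
      thus ?thesis using j0[of z] by (simp add: f_def abs_mult power2_eq_square mult_ac)
    qed (simp add: f_def jsupp)
    show "AE z in lborel. norm (f z) \<le> norm (norm a / e * (j z * (norm z)\<^sup>2))"
      unfolding real_norm_def by (intro AE_I2 order.trans[OF * abs_ge_self])
  qed simp
  thus "integrable lborel (\<lambda>z. j z * (a \<bullet> z))" by (simp add: f_def)
  \<comment> \<open>\<open>T\<close> keeps the first coordinate and reverses the others, so it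
    preserves \<open>j\<close>; averaging over it reduces \<open>a \<bullet> z\<close> to the normal
    part \<open>x1 a * x1 z\<close>.\<close>
  define T where "T = (\<lambda>z::real^'n::{finite,wellorder}. - reflect z)"
  have fT: "integrable lborel (\<lambda>z. f (T z))" "(\<integral>z. f (T z) \<partial>lborel) = (\<integral>z. f z \<partial>lborel)"
    using f_int integrable_reflect[of "\<lambda>z. f (- z)"] integral_reflect[of "\<lambda>z. f (- z)"]
    by (simp_all add: T_def integrable_uminus integral_uminus)
  have jT: "j (T z) = j z" for z
  proof -
    have "norm (reflect a - (a + T z)) = norm (reflect a - (a + z))"
    proof -
      have "reflect a - (a + T z) = reflect (a - reflect a + z)" by (simp add: T_def)
      moreover have "reflect (a - reflect a) = - (a - reflect a)" by simp
      ultimately have "norm (reflect a - (a + T z)) = norm (a - reflect a + z)" by (simp only: norm_reflect)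
      also have "\<dots> = norm (- (a - reflect a + z))" by (rule norm_minus_cancel[symmetric])
      also have "- (a - reflect a + z) = reflect a - (a + z)" by simp
      finally show ?thesis .
    qed
    thus ?thesis by (simp add: j_def ker_def T_def indicator_def)
  qed
  \<comment> \<open>An odd function, hence of integral zero, modelled on the normal part at
    distances below \<open>x1 a / 2\<close>: the reflected kernel is dropped and
    \<open>x1 (a + z)\<close> is frozen at \<open>x1 a\<close>. The remainder trades one factor
    \<open>x1 a\<close> for \<open>norm z\<close>, which restores integrability.\<close>
  define o1 where "o1 = (\<lambda>z. indicator {z. e \<le> norm z \<and> norm z < min r (x1 a / 2)} z * ((x1 a)\<^sup>2 * norm z powr (- p) * x1 (z::real^'n::{finite,wellorder})))"
  have [measurable]: "o1 \<in> borel_measurable borel" unfolding o1_def by measurable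
  have o1_int: "integrable lborel o1"
  proof (rule Bochner_Integration.integrable_bound[OF integrable_mult_right[OF w_int, of "(x1 a)\<^sup>2 / e"]])
    have *: "\<bar>o1 z\<bar> \<le> (x1 a)\<^sup>2 / e * w z" for z
    proof (cases "e \<le> norm z \<and> norm z < min r (x1 a / 2)")
      case True
      have "\<bar>x1 z\<bar> \<le> (norm z)\<^sup>2 / e"
      proof -
        have "norm z * e \<le> norm z * norm z" using True by (intro mult_left_mono) auto
        thus ?thesis using abs_x1_le_norm[of z] e by (simp add: power2_eq_square pos_le_divide_eq) (meson e less_imp_le mult_right_mono order.trans)
      qed
      hence "(x1 a)\<^sup>2 * norm z powr (- p) * \<bar>x1 z\<bar> \<le> (x1 a)\<^sup>2 * norm z powr (- p) * ((norm z)\<^sup>2 / e)"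
        by (intro mult_left_mono) auto
      also have "\<dots> = (x1 a)\<^sup>2 / e * w z" using True w_eq[of z] by (simp add: mult_ac flip: w_eq)
      finally show ?thesis using True by (simp add: o1_def abs_mult)
    qed (use w0 e in \<open>auto simp: o1_def\<close>)
    show "AE z in lborel. norm (o1 z) \<le> norm ((x1 a)\<^sup>2 / e * w z)"
      unfolding real_norm_def by (intro AE_I2 order.trans[OF * abs_ge_self])
  qed simp
  have o1_0: "(\<integral>z. o1 z \<partial>lborel) = 0"
  proof -
    have "(\<integral>z. o1 z \<partial>lborel) = (\<integral>z. o1 (- z) \<partial>lborel)" by (rule integral_uminus[symmetric]) simp
    also have "(\<lambda>z. o1 (- z)) = (\<lambda>z. - o1 z)" by (auto simp: o1_def fun_eq_iff indicator_def)
    finally show ?thesis by simp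
  qed
  have pt: "\<bar>f z + f (T z) - 2 * o1 z\<bar> \<le> 32 * p * x1 a * w z" for z
  proof (cases "e \<le> norm z \<and> norm z < r")
    case False
    thus ?thesis using p1 a w0[of z] jsupp[of z] by (auto simp: f_def jT o1_def indicator_def intro!: mult_nonneg_nonneg)
  next
    case z: True
    have zpos: "norm z > 0" using z e by linarith
    have "a \<bullet> T z = - (reflect z \<bullet> a)" by (simp add: T_def inner_commute)
    also have "\<dots> = - (z \<bullet> a) + 2 * x1 a * x1 z" unfolding inner_reflect by simp
    finally have "a \<bullet> z + a \<bullet> T z = 2 * (x1 a * x1 z)" by (simp add: inner_commute[of z a])
    hence sum: "f z + f (T z) = 2 * (j z * (x1 a * x1 z))"
      unfolding f_def jT distrib_left[symmetric] by simp
    have z1: "\<bar>x1 z\<bar> \<le> norm z" by (rule abs_x1_le_norm)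
    show ?thesis
    proof (cases "norm z < x1 a / 2")
      case False
      hence o0: "o1 z = 0" by (simp add: o1_def)
      have "\<bar>j z * (x1 a * x1 z)\<bar> = j z * (x1 a * \<bar>x1 z\<bar>)" using j0[of z] a by (simp add: abs_mult)
      also have "\<dots> \<le> j z * ((2 * norm z) * norm z)" using False a z1 j0[of z] by (intro mult_left_mono mult_mono) auto
      also have "\<dots> = 2 * (j z * (norm z)\<^sup>2)" by (simp add: power2_eq_square)
      also have "\<dots> \<le> 2 * (8 * p * x1 a * w z)" using j2[of z] by simp
      finally show ?thesis unfolding sum o0 by (simp add: abs_mult mult_ac)
    next
      case True
      let ?K = "norm (reflect a - (a + z))"
      have "x1 z > - x1 a" using z1 True a by linarith
      hence j: "j z = (norm z powr (- p) - ?K powr (- p)) * (x1 a + x1 z)"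
        using z by (simp add: j_def ker_def)
      have o: "o1 z = (x1 a)\<^sup>2 * norm z powr (- p) * x1 z" using z True by (simp add: o1_def)
      have K1: "x1 a + x1 z \<le> ?K" "norm z \<le> ?K"
        using abs_x1_le_norm[of "reflect a - (a + z)"] z1 True a by auto
      have "x1 a + x1 z \<ge> 0" using \<open>x1 z > - x1 a\<close> by simp
      have "?K powr (- p) * (x1 a + x1 z) \<le> ?K powr (- p) * ?K"
        using K1 by (intro mult_left_mono) auto
      also have "\<dots> = ?K powr (1 - p)" using K1 zpos by (simp add: powr_diff powr_minus field_simps)
      also have "\<dots> \<le> norm z powr (1 - p)" using K1 zpos p1 by (intro powr_mono2') auto
      finally have B1: "?K powr (- p) * (x1 a + x1 z) \<le> norm z powr (1 - p)" .
      have B0: "?K powr (- p) * (x1 a + x1 z) \<ge> 0" using \<open>x1 a + x1 z \<ge> 0\<close> by simp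
      have "\<bar>x1 z * norm z powr (- p)\<bar> \<le> norm z * norm z powr (- p)" using z1 by (simp add: abs_mult mult_right_mono)
      also have "\<dots> = norm z powr (1 - p)" using zpos by (simp add: powr_diff powr_minus field_simps)
      finally have B2: "\<bar>x1 z * norm z powr (- p)\<bar> \<le> norm z powr (1 - p)" .
      have "j z * (x1 a * x1 z) - o1 z = x1 a * x1 z * (x1 z * norm z powr (- p) - ?K powr (- p) * (x1 a + x1 z))"
        unfolding j o by (simp add: algebra_simps power2_eq_square)
      also have "\<bar>\<dots>\<bar> \<le> (x1 a * norm z) * (2 * norm z powr (1 - p))"
        unfolding abs_mult using z1 a B0 B1 B2 by (intro mult_mono) auto
      also have "\<dots> = 2 * x1 a * w z"
        using z e by (simp add: w_def powr_diff powr_minus field_simps power2_eq_square)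
      also have "\<dots> \<le> (16 * p) * x1 a * w z" using p1 a w0[of z] by (intro mult_right_mono) auto
      finally show ?thesis using sum by simp
    qed
  qed
  have "2 * (\<integral>z. f z \<partial>lborel) = (\<integral>z. f z + f (T z) - 2 * o1 z \<partial>lborel)"
    using f_int fT o1_int o1_0 by simp
  also have "\<bar>\<dots>\<bar> \<le> (\<integral>z. 32 * p * x1 a * w z \<partial>lborel)"
    unfolding real_norm_def[symmetric]
  proof (rule Bochner_Integration.integral_norm_bound_integral)
    show "norm (f z + f (T z) - 2 * o1 z) \<le> 32 * p * x1 a * w z" for z using pt[of z] by simp
  qed (use f_int fT o1_int w_int in auto)
  also have "\<dots> = 32 * p * x1 a * \<Omega>" by (simp add: w_val)
  finally show "\<bar>\<integral>z. j z * (a \<bullet> z) \<partial>lborel\<bar> \<le> 16 * p * x1 a * \<Omega>" by (simp add: f_def)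
qed

text \<open>Bernoulli's inequality gives \<open>(1 - \<xi>) ^ N \<ge> 1 - N \<xi>\<close>, and \<open>1 / (1 - t) \<le> 1 + t + 2 t\<^sup>2\<close> for \<open>\<bar>t\<bar> \<le> 1 / 2\<close>.\<close>

lemma barrier_expansion:
  fixes a z :: "'a::real_inner"
  assumes N: "N \<ge> (1::nat)" and a: "norm a \<le> \<rho>" "(norm a)\<^sup>2 < R" and R: "R \<le> \<rho>\<^sup>2" and \<rho>: "\<rho> > 0"
    and z: "norm z \<le> \<rho>" "6 * real N * \<rho> * norm z \<le> R - (norm a)\<^sup>2"
  defines "D \<equiv> R - (norm a)\<^sup>2"
    and "P \<equiv> 1 + 2 * real N / (R - (norm a)\<^sup>2) * (a \<bullet> z) + (real N * \<rho>\<^sup>2 + 18 * (real N)\<^sup>2 * \<rho>\<^sup>2) / (R - (norm a)\<^sup>2)\<^sup>2 * (norm z)\<^sup>2"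
  shows "(norm (a + z))\<^sup>2 < R" "D ^ N / (R - (norm (a + z))\<^sup>2) ^ N \<le> P" "P \<ge> 1 / 2"
proof -
  have D: "D > 0" "D \<le> \<rho>\<^sup>2" using a R by (auto simp: D_def) (smt (verit) zero_le_power2)
  define q where "q = 2 * (a \<bullet> z) + (norm z)\<^sup>2"
  define \<xi> where "\<xi> = q / D"
  define t where "t = real N * \<xi>"
  have az: "\<bar>a \<bullet> z\<bar> \<le> \<rho> * norm z"
    using Cauchy_Schwarz_ineq2[of a z] a mult_right_mono[of "norm a" \<rho> "norm z"] by simp
  have "(norm z)\<^sup>2 \<le> \<rho> * norm z" using z mult_right_mono[of "norm z" \<rho> "norm z"] by (simp add: power2_eq_square)
  hence q: "\<bar>q\<bar> \<le> 3 * \<rho> * norm z" using az zero_le_power2[of "norm z"] unfolding q_def by linarith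
  \<comment> \<open>The factor 6 in the smallness condition is 3 from the bound on \<open>q\<close>
    times 2 for \<open>\<bar>t\<bar> \<le> 1 / 2\<close>.\<close>
  have "real N * \<bar>q\<bar> \<le> real N * (3 * \<rho> * norm z)" using q by (intro mult_left_mono) auto
  also have "\<dots> \<le> D / 2" using z by (simp add: D_def)
  finally have Nq: "real N * \<bar>q\<bar> \<le> D / 2" .
  have t: "\<bar>t\<bar> \<le> 1 / 2" using Nq D by (simp add: t_def \<xi>_def abs_mult field_simps)
  have "\<bar>\<xi>\<bar> \<le> \<bar>t\<bar>" using N by (simp add: t_def abs_mult mult_le_cancel_right1)
  hence \<xi>: "\<bar>\<xi>\<bar> \<le> 1 / 2" using t by linarith
  have "(norm (a + z))\<^sup>2 = (norm a)\<^sup>2 + q"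
    by (simp add: q_def power2_norm_eq_inner inner_add_left inner_add_right inner_commute[of z a])
  moreover have "D * \<xi> = q" using D by (simp add: \<xi>_def)
  ultimately have Req: "R - (norm (a + z))\<^sup>2 = D * (1 - \<xi>)" by (simp add: D_def right_diff_distrib)
  have x0: "1 - \<xi> > 0" using \<xi> by linarith
  have "D * (1 - \<xi>) > 0" using D x0 by simp
  thus "(norm (a + z))\<^sup>2 < R" using Req by simp
  have "1 - t \<le> (1 - \<xi>) ^ N" using Bernoulli_inequality[of "- \<xi>" N] \<xi> by (simp add: t_def)
  moreover have "1 - t > 0" using t by linarith
  ultimately have "1 / (1 - \<xi>) ^ N \<le> 1 / (1 - t)" by (intro divide_left_mono mult_pos_pos) auto
  also have "\<dots> \<le> 1 + t + 2 * t\<^sup>2"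
  proof -
    have "0 \<le> t\<^sup>2 * (1 - 2 * t)" using t by (intro mult_nonneg_nonneg) auto
    hence "1 \<le> (1 + t + 2 * t\<^sup>2) * (1 - t)" by (simp add: algebra_simps power2_eq_square)
    thus ?thesis using \<open>1 - t > 0\<close> by (simp add: pos_divide_le_eq)
  qed
  also have "\<dots> \<le> P"
  proof -
    \<comment> \<open>As \<open>D \<le> \<rho>\<^sup>2\<close>, the quadratic part of
      \<open>t\<close> can be put over \<open>D\<^sup>2\<close> as well, so that it shares one
      coefficient with \<open>2 * t\<^sup>2\<close>; the 18 in that coefficient is 2 times the
      square of 3.\<close>
    have "(real N / D) * (norm z)\<^sup>2 \<le> (real N * \<rho>\<^sup>2 / D\<^sup>2) * (norm z)\<^sup>2"
    proof (intro mult_right_mono)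
      have "real N * D * D \<le> real N * \<rho>\<^sup>2 * D" using D by (intro mult_right_mono mult_left_mono) auto
      thus "real N / D \<le> real N * \<rho>\<^sup>2 / D\<^sup>2" using D by (simp add: field_simps power2_eq_square)
    qed simp
    moreover have "2 * t\<^sup>2 \<le> (18 * (real N)\<^sup>2 * \<rho>\<^sup>2) / D\<^sup>2 * (norm z)\<^sup>2"
    proof -
      have "q\<^sup>2 \<le> (3 * \<rho> * norm z)\<^sup>2" using q by (simp add: abs_le_square_iff[symmetric] abs_mult \<rho> less_imp_le)
      hence "2 * ((real N)\<^sup>2 * q\<^sup>2) / D\<^sup>2 \<le> 2 * ((real N)\<^sup>2 * (3 * \<rho> * norm z)\<^sup>2) / D\<^sup>2"
        by (intro divide_right_mono mult_left_mono) auto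
      thus ?thesis by (simp add: t_def \<xi>_def power_mult_distrib power_divide)
    qed
    moreover have "t = 2 * real N / D * (a \<bullet> z) + (real N / D) * (norm z)\<^sup>2"
      by (simp add: t_def \<xi>_def q_def add_divide_distrib distrib_left)
    moreover have "P = 1 + 2 * real N / D * (a \<bullet> z) + ((real N * \<rho>\<^sup>2 / D\<^sup>2) * (norm z)\<^sup>2 + (18 * (real N)\<^sup>2 * \<rho>\<^sup>2) / D\<^sup>2 * (norm z)\<^sup>2)"
      by (simp add: P_def D_def add_divide_distrib distrib_right)
    ultimately show ?thesis by linarith
  qed
  finally show "D ^ N / (R - (norm (a + z))\<^sup>2) ^ N \<le> P"
    unfolding Req using D by (simp add: power_mult_distrib)
  have "2 * real N / D * \<bar>a \<bullet> z\<bar> \<le> 2 * real N / D * (\<rho> * norm z)" using az D by (intro mult_left_mono) auto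
  also have "\<dots> \<le> 1 / 3" using z D by (simp add: D_def field_simps)
  finally have l1: "2 * real N / D * \<bar>a \<bullet> z\<bar> \<le> 1 / 3" .
  have "- (2 * real N / D * \<bar>a \<bullet> z\<bar>) \<le> 2 * real N / D * (a \<bullet> z)"
    using D mult_left_mono[of "- \<bar>a \<bullet> z\<bar>" "a \<bullet> z" "2 * real N / D"] by simp
  moreover have "0 \<le> (real N * \<rho>\<^sup>2 + 18 * (real N)\<^sup>2 * \<rho>\<^sup>2) / D\<^sup>2 * (norm z)\<^sup>2" by simp
  moreover have "1 + X + Y \<ge> 1 / 2" if "- W \<le> X" "0 \<le> Y" "W \<le> 1 / 3" for W X Y :: real using that by linarith
  ultimately show "P \<ge> 1 / 2" using l1 unfolding P_def D_def[symmetric] by blast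
qed


text \<open>Here \<open>V * (R - \<bar>a\<bar>\<^sup>2) ^ N * x1 y / (R - \<bar>y\<bar>\<^sup>2) ^ N + \<delta>\<close> touches \<open>u\<close> from above at \<open>a\<close>. On the ball of
  radius \<open>r / 4\<close> around \<open>a + (r / 2) e\<^sub>1\<close> the barrier dominates \<open>u\<close> on average unless \<open>V\<close> is controlled
  by the mass of \<open>u\<close>; this gain is of order \<open>r powr (- 2 * s)\<close> and beats all error terms for small \<open>r\<close>.\<close>

lemma upper_contact:
  fixes u :: "real^'n::{finite,wellorder} \<Rightarrow> real" and N :: nat
  assumes p_def: "p = real CARD('n) + 2 * s" and s: "0 < s" "s < 1" and \<rho>: "\<rho> > 0" and M: "M \<ge> 0"
    and R: "R < \<rho>\<^sup>2" and N: "N \<ge> 1" and Cg: "Cg \<ge> 0"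
    and G: "\<And>e. 0 < e \<Longrightarrow> e < 1 \<Longrightarrow> e < x1 a \<Longrightarrow>
      \<bar>c_ns CARD('n) s * trunc p (gau 1) a e + c_ns 1 s / s * gau 1 a * x1 a powr (- 2 * s)\<bar> \<le> Cg * x1 a + E * e"
    and C5: "\<And>t. t > 0 \<Longrightarrow> M - c_ns 1 s / s * t powr (- 2 * s) \<le> C5 * t"
    and u: "subsuper s \<rho> M u" and \<delta>: "\<delta> > 0" and a: "x1 a > 0" "(norm a)\<^sup>2 < R"
    and V: "V \<ge> 0" "u a - \<delta> = V * x1 a"
    and max: "\<And>y. x1 y > 0 \<Longrightarrow> (norm y)\<^sup>2 < R \<Longrightarrow> (u y - \<delta>) * (R - (norm y)\<^sup>2) ^ N \<le> V * (R - (norm a)\<^sup>2) ^ N * x1 y"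
    and r: "0 < r" "r \<le> \<rho>" "6 * real N * \<rho> * r \<le> R - (norm a)\<^sup>2"
  defines "D \<equiv> R - (norm a)\<^sup>2"
  defines "\<beta> \<equiv> 2 + 2 * real N / D"
    and "C' \<equiv> 1 + (real N * \<rho>\<^sup>2 + 18 * (real N)\<^sup>2 * \<rho>\<^sup>2) / D\<^sup>2"
    and "\<Omega> \<equiv> real CARD('n) * unit_ball_vol CARD('n) * (r powr (2 - 2 * s) / (2 - 2 * s))"
    and "B \<equiv> V / 2 * (r powr (- p) / 8 * (unit_ball_vol CARD('n) * (r / 4) ^ CARD('n)))
      - 2 * p * (1 + (2 * \<rho>) powr (p + 2)) * (r / 4) powr (- p - 2) * mass s u"
  shows "c_ns CARD('n) s * (B - V * (8 * p * (2 * \<beta> + C') * \<Omega>)) - V * (exp (\<rho>\<^sup>2) * Cg + M) \<le> C5 * \<delta>"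
proof -
  let ?c = "c_ns CARD('n) s"
  let ?q = "c_ns 1 s / s * x1 a powr (- 2 * s)"
  have c: "?c > 0" using c_ns_pos[OF s] .
  have pn: "p > real CARD('n)" using s by (simp add: p_def)
  have p1: "p > 1"
  proof -
    have "real CARD('n) \<ge> 1" by (simp add: Suc_leI)
    thus ?thesis using pn by linarith
  qed
  have upos: "\<And>y. y \<in> halfspace \<Longrightarrow> u y \<ge> 0"
    and uint: "set_integrable lebesgue halfspace (\<lambda>y. wgt p y * u y)"
    and ueq: "\<And>a. a \<in> ball 0 \<rho> \<inter> halfspace \<Longrightarrow> \<exists>l. (trunc p u a \<longlongrightarrow> l) (at_right 0) \<and>
      \<bar>?c * l + c_ns 1 s / s * u a * x1 a powr (- 2 * s)\<bar> \<le> M * u a"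
    using u unfolding subsuper_def p_def by blast+
  have an: "norm a < \<rho>"
    by (rule power_less_imp_less_base[of _ 2]) (use a R \<rho> in auto)
  have D: "D > 0" using a by (simp add: D_def)
  have \<beta>: "\<beta> \<ge> 0" and C': "C' \<ge> 0" using D by (auto simp: \<beta>_def C'_def intro!: add_nonneg_nonneg divide_nonneg_nonneg)
  \<comment> \<open>\<open>V'\<close> is fixed by \<open>V' * gau 1 a = V * x1 a\<close>. The
    operator on this Gaussian is controlled by \<open>G\<close>, while the algebraic barrier enters
    only as a pointwise upper bound for \<open>u\<close>.\<close>
  define V' where "V' = V * exp ((norm a)\<^sup>2)"
  have V': "V' \<ge> 0" "V' \<le> V * exp (\<rho>\<^sup>2)"
    using V(1) an by (auto simp: V'_def intro!: mult_left_mono power_mono)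
  have ga: "V' * gau 1 a = V * x1 a"
    by (simp add: V'_def gau_def mult_ac flip: exp_add)
  define X where "X = (\<lambda>y. V' * gau 1 y - (u y - \<delta>))"
  \<comment> \<open>The ball is shifted away from the hyperplane. On it \<open>4 * x1 y\<close>
    exceeds the distance from \<open>y\<close> to \<open>reflect a\<close>, so
    \<open>ker p a y * x1 y\<close> keeps the size \<open>x1 a * r powr (- p)\<close> however close
    \<open>a\<close> is to the hyperplane; it also avoids \<open>ball a (r / 4)\<close>.\<close>
  let ?G = "ball (a + (r / 2) *\<^sub>R axis idx1 1) (r / 4)"
  let ?T = "halfspace - ball a (r / 4)"
  have x1e: "x1 (axis idx1 1 :: real^'n::{finite,wellorder}) = 1" by (simp add: x1_def axis_def)
  have Gpt: "x1 y > x1 a + r / 4" "norm (a - y) < 3 * r / 4" "norm (a - y) > r / 4" if "y \<in> ?G" for y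
  proof -
    let ?m = "a + (r / 2) *\<^sub>R axis idx1 1 :: real^'n::{finite,wellorder}"
    have d: "norm (?m - y) < r / 4" using that by (simp add: dist_norm)
    have "\<bar>x1 (?m - y)\<bar> < r / 4" using d abs_x1_le_norm[of "?m - y"] by linarith
    moreover have "x1 (?m - y) = x1 a + r / 2 - x1 y" using x1e by simp
    ultimately show x: "x1 y > x1 a + r / 4" by linarith
    have "norm (a - y) \<le> norm (a - ?m) + norm (?m - y)" using norm_triangle_ineq[of "a - ?m" "?m - y"] by simp
    moreover have "norm (a - ?m) = r / 2" using r by (simp add: norm_axis_1)
    ultimately show "norm (a - y) < 3 * r / 4" using d by linarith
    show "norm (a - y) > r / 4" using abs_x1_le_norm[of "a - y"] x by simp
  qed
  have Gker: "x1 a * (r powr (- p) / 8) \<le> ker p a y * x1 y" if "y \<in> ?G" for y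
  proof -
    let ?Z = "norm (reflect a - y)"
    have y: "x1 y > 0" "y \<noteq> a" using Gpt[OF that] a r by auto
    have Z: "?Z > 0" by (rule norm_reflect_diff_pos[OF a(1) y(1) p1])
    have "?Z \<le> norm (reflect a - a) + norm (a - y)" using norm_triangle_ineq[of "reflect a - a" "a - y"] by simp
    also have "norm (reflect a - a) = 2 * x1 a" using a by (simp add: reflect_eq norm_axis_1)
    finally have Zle: "?Z \<le> 2 * x1 a + r" using Gpt(2)[OF that] r by linarith
    have "?Z \<le> 4 * x1 y" using Zle Gpt(1)[OF that] a by linarith
    hence "?Z\<^sup>2 \<le> (4 * x1 y)\<^sup>2" by (intro power_mono) auto
    hence Zy: "1 / 16 \<le> (x1 y)\<^sup>2 * ?Z powr (- 2)"
      using Z by (simp add: powr_minus divide_simps power2_eq_square)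
    have "x1 a * (r powr (- p) / 8) = 2 * x1 a * r powr (- p) * (1 / 16)" by simp
    also have "\<dots> \<le> 2 * x1 a * norm (a - y) powr (- p) * ((x1 y)\<^sup>2 * ?Z powr (- 2))"
      using Zy a Gpt[OF that] r p1 by (intro mult_mono mult_left_mono powr_mono2') auto
    also have "\<dots> = (2 * x1 a * x1 y * norm (a - y) powr (- p) * ?Z powr (- 2)) * x1 y"
      by (simp add: power2_eq_square)
    also have "\<dots> \<le> ker p a y * x1 y"
      using ker_ge[OF a(1) y(1) p1 y(2)] y by (intro mult_right_mono) auto
    finally show ?thesis .
  qed
  have T_int: "set_integrable lebesgue ?T (\<lambda>y. ker p a y * u y)"
    and T_le: "set_lebesgue_integral lebesgue ?T (\<lambda>y. ker p a y * u y) \<le>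
      2 * p * (1 + (2 * \<rho>) powr (p + 2)) * (r / 4) powr (- p - 2) * x1 a * mass s u"
    using ker_far[OF p1 a(1) less_imp_le[OF an], of "r / 4" u] r uint upos unfolding mass_def p_def[symmetric] by auto
  have key: "\<exists>I. trunc p u a e = V' * trunc p (gau 1) a e + I \<and> x1 a * (B - V * (8 * p * (2 * \<beta> + C') * \<Omega>)) \<le> I"
    if e: "0 < e" "e < r / 4" for e
  proof -
    let ?S = "halfspace - ball a e"
    have Sm: "?S \<in> sets lebesgue" by (intro sets_completionI_sets) auto
    have i1: "set_integrable lebesgue ?S (\<lambda>y. ker p a y * (gau 1 a - gau 1 y))"
      by (rule set_integrable_trunc[OF pn set_integrable_wgt_gau[OF pn] a(1) e(1)]) simp
    have i3: "set_integrable lebesgue ?S (\<lambda>y. ker p a y * (u a - u y))"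
      by (rule set_integrable_trunc[OF pn uint a(1) e(1)])
    have kX: "ker p a y * X y = ker p a y * (u a - u y) - V' * (ker p a y * (gau 1 a - gau 1 y))" for y
    proof -
      have Xy: "X y = (u a - u y) - V' * (gau 1 a - gau 1 y)" using ga V(2) by (simp add: X_def algebra_simps)
      show ?thesis unfolding Xy by (simp add: algebra_simps)
    qed
    have iX: "set_integrable lebesgue ?S (\<lambda>y. ker p a y * X y)"
      unfolding kX using i1 i3 by (intro set_integral_diff set_integrable_mult_right) auto
    have eqX: "set_lebesgue_integral lebesgue ?S (\<lambda>y. ker p a y * X y) = trunc p u a e - V' * trunc p (gau 1) a e"
      unfolding kX trunc_def using i1 i3
      by (simp add: set_integral_diff set_integrable_mult_right set_integral_mult_right)
    define j where "j = (\<lambda>z. indicator {z. e \<le> norm z \<and> norm z < r \<and> x1 z > - x1 a} z * (ker p a (a + z) * x1 (a + z)))"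
    have er: "e < r" using e r by simp
    define f1 where "f1 = (\<lambda>z. j z * (a \<bullet> z))"
    define f2 where "f2 = (\<lambda>z. j z * (norm z)\<^sup>2)"
    have [measurable]: "j \<in> borel_measurable borel" unfolding j_def ker_def by measurable
    have [measurable]: "f1 \<in> borel_measurable borel" "f2 \<in> borel_measurable borel" unfolding f1_def f2_def by measurable
    have ne: "integrable lborel f1" "\<bar>\<integral>z. f1 z \<partial>lborel\<bar> \<le> 16 * p * x1 a * \<Omega>"
      "integrable lborel f2" "(\<integral>z. f2 z \<partial>lborel) \<le> 8 * p * x1 a * \<Omega>"
      unfolding f1_def f2_def j_def \<Omega>_def using near_error[OF p_def s a(1) e(1) er] by blast+
    have F1: "integrable lebesgue (\<lambda>y. f1 (y - a))" "(\<integral>y. f1 (y - a) \<partial>lebesgue) = (\<integral>z. f1 z \<partial>lborel)"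
      using ne(1) integrable_shift[of f1 "- a"] integral_shift[of f1 "- a"]
      by (simp_all add: integrable_completion integral_completion)
    have F2: "integrable lebesgue (\<lambda>y. f2 (y - a))" "(\<integral>y. f2 (y - a) \<partial>lebesgue) = (\<integral>z. f2 z \<partial>lborel)"
      using ne(3) integrable_shift[of f2 "- a"] integral_shift[of f2 "- a"]
      by (simp_all add: integrable_completion integral_completion)
    have F1le: "(\<integral>z. f1 z \<partial>lborel) \<le> 16 * p * x1 a * \<Omega>" by (rule abs_le_D1[OF ne(2)])
    have F2le: "(\<integral>z. f2 z \<partial>lborel) \<le> 8 * p * x1 a * \<Omega>" by (rule ne(4))
    have iG: "integrable lebesgue (indicat_real ?G)" "(\<integral>y. indicat_real ?G y \<partial>lebesgue) = unit_ball_vol CARD('n) * (r / 4) ^ CARD('n)"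
    proof -
      have [measurable]: "?G \<in> sets borel" by simp
      have "integrable lborel (indicat_real ?G)" by (intro integrable_real_indicator) (auto simp: emeasure_ball r less_imp_le)
      thus "integrable lebesgue (indicat_real ?G)" by (simp add: integrable_completion)
      show "(\<integral>y. indicat_real ?G y \<partial>lebesgue) = unit_ball_vol CARD('n) * (r / 4) ^ CARD('n)"
        using r by (simp add: integral_completion content_ball)
    qed
    \<comment> \<open>\<open>X\<close> has no sign, so its integrand is bounded below by three
      integrable pieces: the gain on \<open>?G\<close>, the far field of \<open>u\<close> charged to
      the mass, and the moments of the mismatch between Gaussian and barrier.\<close>
    define Q where "Q = (\<lambda>y. V / 2 * (x1 a * (r powr (- p) / 8)) * indicat_real ?G y
      - indicat_real ?T y *\<^sub>R (ker p a y * u y) - V * (\<beta> * f1 (y - a) + C' * f2 (y - a)))"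
    have iT: "integrable lebesgue (\<lambda>y. indicat_real ?T y *\<^sub>R (ker p a y * u y))" using T_int unfolding set_integrable_def .
    have Q_int: "integrable lebesgue Q" unfolding Q_def
      using iG(1) iT F1(1) F2(1) by (intro Bochner_Integration.integrable_diff integrable_mult_right Bochner_Integration.integrable_add)
    have "x1 a * (B - V * (8 * p * (2 * \<beta> + C') * \<Omega>)) \<le> (\<integral>y. Q y \<partial>lebesgue)"
    proof -
      have "(\<integral>y. Q y \<partial>lebesgue) = V / 2 * (x1 a * (r powr (- p) / 8)) * (unit_ball_vol CARD('n) * (r / 4) ^ CARD('n))
        - set_lebesgue_integral lebesgue ?T (\<lambda>y. ker p a y * u y) - V * (\<beta> * (\<integral>z. f1 z \<partial>lborel) + C' * (\<integral>z. f2 z \<partial>lborel))"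
        unfolding Q_def set_lebesgue_integral_def using iG iT F1 F2 by simp
      moreover have "V * (\<beta> * (\<integral>z. f1 z \<partial>lborel) + C' * (\<integral>z. f2 z \<partial>lborel)) \<le> V * (\<beta> * (16 * p * x1 a * \<Omega>) + C' * (8 * p * x1 a * \<Omega>))"
        using F1le F2le \<beta> C' V(1) by (intro mult_left_mono add_mono) auto
      moreover have "x1 a * (B - V * (8 * p * (2 * \<beta> + C') * \<Omega>)) = V / 2 * (x1 a * (r powr (- p) / 8)) * (unit_ball_vol CARD('n) * (r / 4) ^ CARD('n))
        - 2 * p * (1 + (2 * \<rho>) powr (p + 2)) * (r / 4) powr (- p - 2) * x1 a * mass s u - V * (\<beta> * (16 * p * x1 a * \<Omega>) + C' * (8 * p * x1 a * \<Omega>))"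
      proof -
        have "x1 a * (V / 2 * (w / 8 * v) - m * k - V * (8 * p * (2 * \<beta> + C') * \<Omega>)) =
          V / 2 * (x1 a * (w / 8)) * v - m * x1 a * k - V * (\<beta> * (16 * p * x1 a * \<Omega>) + C' * (8 * p * x1 a * \<Omega>))" for w v m k :: real
          by (simp add: algebra_simps)
        thus ?thesis unfolding B_def by blast
      qed
      ultimately show ?thesis using T_le by linarith
    qed
    also have "(\<integral>y. Q y \<partial>lebesgue) \<le> set_lebesgue_integral lebesgue ?S (\<lambda>y. ker p a y * X y)"
      unfolding set_lebesgue_integral_def
    proof (rule integral_mono[OF Q_int])
      show "integrable lebesgue (\<lambda>y. indicat_real ?S y *\<^sub>R (ker p a y * X y))" using iX unfolding set_integrable_def .
      fix y
      show "Q y \<le> indicat_real ?S y *\<^sub>R (ker p a y * X y)"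
      proof (cases "y \<in> ?S")
        case False
        hence "y \<notin> ?G" using Gpt[of y] e a r by (auto simp: halfspace_def dist_norm)
        moreover have "y \<notin> ?T" using False e by auto
        moreover have "j (y - a) = 0" using False by (auto simp: j_def halfspace_def dist_norm norm_minus_commute indicator_def)
        ultimately show ?thesis using False by (simp add: Q_def f1_def f2_def)
      next
        case True
        define z where "z = y - a"
        have y: "x1 y > 0" "y \<noteq> a" "y \<in> halfspace" using True e by (auto simp: halfspace_def)
        have kp: "ker p a y \<ge> 0" by (rule ker_nonneg[OF a(1) y(1) p1 y(2)])
        have up: "u y \<ge> 0" using upos y by simp
        have gp: "V' * gau 1 y \<ge> 0" using V' y by (simp add: gau_def)
        show ?thesis
        proof (cases "norm z < r")
          case far: False
          hence "y \<notin> ?G" using Gpt(2)[of y] r by (auto simp: z_def norm_minus_commute)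
          moreover have "y \<in> ?T" using far r y by (auto simp: z_def dist_norm norm_minus_commute)
          moreover have "j (y - a) = 0" using far by (simp add: j_def z_def)
          ultimately have "Q y = - (ker p a y * u y)" by (simp add: Q_def f1_def f2_def)
          also have "\<dots> = ker p a y * (- u y)" by simp
          also have "\<dots> \<le> ker p a y * X y" using kp gp \<delta> by (intro mult_left_mono) (auto simp: X_def)
          finally show ?thesis using True by simp
        next
          case near: True
          have yz: "y = a + z" by (simp add: z_def)
          have "6 * real N * \<rho> * norm z \<le> 6 * real N * \<rho> * r" using near \<rho> by (intro mult_left_mono) auto
          hence z6: "6 * real N * \<rho> * norm z \<le> R - (norm a)\<^sup>2" using r(3) by linarith
          define P where "P = 1 + 2 * real N / D * (a \<bullet> z) + (real N * \<rho>\<^sup>2 + 18 * (real N)\<^sup>2 * \<rho>\<^sup>2) / D\<^sup>2 * (norm z)\<^sup>2"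
          have bar: "(norm y)\<^sup>2 < R" "D ^ N / (R - (norm y)\<^sup>2) ^ N \<le> P" "P \<ge> 1 / 2"
            using barrier_expansion[OF N less_imp_le[OF an] a(2) less_imp_le[OF R] \<rho> _ z6] near r
            unfolding P_def D_def yz by auto
          have pw: "(R - (norm y)\<^sup>2) ^ N > 0" using bar(1) by simp
          have "u y - \<delta> \<le> V * x1 y * (D ^ N / (R - (norm y)\<^sup>2) ^ N)"
            using max[OF y(1) bar(1)] pw by (simp add: D_def pos_le_divide_eq mult_ac)
          also have "\<dots> \<le> V * x1 y * P" using V(1) y bar(2) by (intro mult_left_mono) auto
          finally have Y0: "V * x1 y * P - (u y - \<delta>) \<ge> 0" by simp
          have "(norm y)\<^sup>2 = (norm a)\<^sup>2 + 2 * (a \<bullet> z) + (norm z)\<^sup>2"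
            unfolding yz by (simp add: power2_norm_eq_inner inner_add_left inner_add_right inner_commute[of z a])
          hence "V' * gau 1 y = V * x1 y * exp (- 2 * (a \<bullet> z) - (norm z)\<^sup>2)"
            by (simp add: V'_def gau_def mult_ac flip: exp_add)
          also have "\<dots> \<ge> V * x1 y * (1 - 2 * (a \<bullet> z) - (norm z)\<^sup>2)"
          proof (intro mult_left_mono)
            show "1 - 2 * (a \<bullet> z) - (norm z)\<^sup>2 \<le> exp (- 2 * (a \<bullet> z) - (norm z)\<^sup>2)"
              using exp_ge_add_one_self[of "- 2 * (a \<bullet> z) - (norm z)\<^sup>2"] by linarith
          qed (use V(1) y in auto)
          finally have gl: "V' * gau 1 y \<ge> V * x1 y * (1 - 2 * (a \<bullet> z) - (norm z)\<^sup>2)" .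
          \<comment> \<open>Origin of \<open>\<beta>\<close> and \<open>C'\<close>: the summands 2
            and 1 come from the expansion of the Gaussian, the others from \<open>P\<close>.\<close>
          have "1 - 2 * (a \<bullet> z) - (norm z)\<^sup>2 = P - (\<beta> * (a \<bullet> z) + C' * (norm z)\<^sup>2)"
            by (simp add: P_def \<beta>_def C'_def algebra_simps)
          hence Xl: "X y \<ge> (V * x1 y * P - (u y - \<delta>)) - V * x1 y * (\<beta> * (a \<bullet> z) + C' * (norm z)\<^sup>2)"
            using gl unfolding X_def by (simp only: right_diff_distrib)
          have jz: "j z = ker p a y * x1 y"
            using True near y by (auto simp: j_def z_def dist_norm norm_minus_commute)
          have kXl: "ker p a y * X y \<ge> ker p a y * (V * x1 y * P - (u y - \<delta>)) - V * (\<beta> * f1 z + C' * f2 z)"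
          proof -
            have "ker p a y * ((V * x1 y * P - (u y - \<delta>)) - V * x1 y * (\<beta> * (a \<bullet> z) + C' * (norm z)\<^sup>2)) \<le> ker p a y * X y"
              by (intro mult_left_mono Xl kp)
            moreover have "k * (W - V * x * (\<beta> * b + C' * d)) = k * W - V * (\<beta> * (k * x * b) + C' * (k * x * d))" for k W x b d :: real
              by (simp add: algebra_simps)
            ultimately show ?thesis unfolding f1_def f2_def jz by simp
          qed
          show ?thesis
          proof (cases "y \<in> ?G")
            case inG: True
            have yT: "y \<in> ?T" using Gpt(3)[OF inG] y by (auto simp: dist_norm)
            \<comment> \<open>On \<open>?G\<close> at least half of \<open>V * x1 y\<close>
              survives, because \<open>P \<ge> 1 / 2\<close>, while \<open>u\<close> is subtracted
              in full and paid for by the far-field term.\<close>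
            have "V / 2 * (x1 a * (r powr (- p) / 8)) - ker p a y * u y \<le> V / 2 * (ker p a y * x1 y) - ker p a y * u y"
              using Gker[OF inG] V(1) by (intro diff_right_mono mult_left_mono) auto
            also have "\<dots> = ker p a y * (V * x1 y * (1 / 2) - u y)" by (simp add: algebra_simps)
            also have "\<dots> \<le> ker p a y * (V * x1 y * P - (u y - \<delta>))"
            proof (intro mult_left_mono kp)
              have "V * x1 y * (1 / 2) \<le> V * x1 y * P" using V(1) y bar(3) by (intro mult_left_mono) auto
              thus "V * x1 y * (1 / 2) - u y \<le> V * x1 y * P - (u y - \<delta>)" using \<delta> by linarith
            qed
            finally show ?thesis using kXl True inG yT by (simp add: Q_def z_def)
          next
            case outG: False
            have "- (indicat_real ?T y *\<^sub>R (ker p a y * u y)) \<le> 0" using kp up by (auto split: split_indicator)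
            also have "0 \<le> ker p a y * (V * x1 y * P - (u y - \<delta>))" using kp Y0 by simp
            finally show ?thesis using kXl True outG by (simp add: Q_def z_def)
          qed
        qed
      qed
    qed
    finally show ?thesis using eqX by (intro exI[of _ "set_lebesgue_integral lebesgue ?S (\<lambda>y. ker p a y * X y)"]) simp
  qed
  define B0 where "B0 = B - V * (8 * p * (2 * \<beta> + C') * \<Omega>)"
  obtain l where l: "(trunc p u a \<longlongrightarrow> l) (at_right 0)" "\<bar>?c * l + c_ns 1 s / s * u a * x1 a powr (- 2 * s)\<bar> \<le> M * u a"
    using ueq[of a] an a by (auto simp: halfspace_def)
  have ineq: "- (V' * (Cg * x1 a + E * e)) + ?q * \<delta> + ?c * (x1 a * B0) \<le> ?c * trunc p u a e + ?q * u a"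
    if e: "0 < e" "e < 1" "e < x1 a" "e < r / 4" for e
  proof -
    obtain I where I: "trunc p u a e = V' * trunc p (gau 1) a e + I" "x1 a * B0 \<le> I"
      using key[OF e(1,4)] unfolding B0_def by blast
    have "- (Cg * x1 a + E * e) \<le> ?c * trunc p (gau 1) a e + ?q * gau 1 a"
      using abs_le_D2[OF G[OF e(1-3)]] by (simp add: mult_ac)
    from mult_left_mono[OF this V'(1)]
    have 1: "- (V' * (Cg * x1 a + E * e)) \<le> V' * (?c * trunc p (gau 1) a e + ?q * gau 1 a)" by (simp only: mult_minus_right)
    have 2: "?c * (x1 a * B0) \<le> ?c * I" using I(2) c by (intro mult_left_mono) auto
    have alg: "V' * (c * A + q * g) + q * \<delta> + c * I = c * (V' * A + I) + q * (V' * g + \<delta>)" for c A q g :: real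
      by (simp add: algebra_simps)
    have "V' * gau 1 a + \<delta> = u a" using ga V(2) by simp
    hence "V' * (?c * trunc p (gau 1) a e + ?q * gau 1 a) + ?q * \<delta> + ?c * I = ?c * trunc p u a e + ?q * u a"
      using alg[of ?c "trunc p (gau 1) a e" ?q "gau 1 a"] I(1) by simp
    thus ?thesis using 1 2 by linarith
  qed
  have lim: "- (V' * (Cg * x1 a + E * 0)) + ?q * \<delta> + ?c * (x1 a * B0) \<le> ?c * l + ?q * u a"
  proof (rule tendsto_le[OF trivial_limit_at_right_real])
    show "((\<lambda>e. ?c * trunc p u a e + ?q * u a) \<longlongrightarrow> ?c * l + ?q * u a) (at_right 0)"
      by (intro tendsto_intros l(1))
    show "((\<lambda>e. - (V' * (Cg * x1 a + E * e)) + ?q * \<delta> + ?c * (x1 a * B0)) \<longlongrightarrow> - (V' * (Cg * x1 a + E * 0)) + ?q * \<delta> + ?c * (x1 a * B0)) (at_right 0)"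
      by (intro tendsto_intros)
    show "\<forall>\<^sub>F e in at_right 0. - (V' * (Cg * x1 a + E * e)) + ?q * \<delta> + ?c * (x1 a * B0) \<le> ?c * trunc p u a e + ?q * u a"
      unfolding eventually_at_right_field
    proof (intro exI[of _ "min (min 1 (x1 a)) (r / 4)"] conjI allI impI)
      show "min (min 1 (x1 a)) (r / 4) > 0" using a r by simp
    qed (rule ineq, auto)
  qed
  have up: "?c * l + ?q * u a \<le> M * (V * x1 a + \<delta>)"
    using abs_le_D1[OF l(2)] V(2) by (simp add: mult_ac) (simp add: algebra_simps)
  have V'C: "V' * (Cg * x1 a) \<le> V * exp (\<rho>\<^sup>2) * (Cg * x1 a)" using V' Cg a by (intro mult_right_mono) auto
  \<comment> \<open>The constant \<open>\<delta>\<close> contributes \<open>M * \<delta>\<close>,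
    which lacks the factor \<open>x1 a\<close>. Near the hyperplane its own zero-order term
    \<open>?q * \<delta>\<close> outweighs it, and away from there \<open>x1 a\<close> is bounded
    below; \<open>C5\<close> records both.\<close>
  have "\<delta> * (M - ?q) \<le> \<delta> * (C5 * x1 a)" using C5[OF a(1)] \<delta> by (intro mult_left_mono) auto
  hence C5': "M * \<delta> - ?q * \<delta> \<le> C5 * \<delta> * x1 a" by (simp add: algebra_simps)
  have "?c * (x1 a * B0) - V * exp (\<rho>\<^sup>2) * (Cg * x1 a) - M * (V * x1 a) \<le> C5 * \<delta> * x1 a"
    using lim up V'C C5' by (simp add: distrib_left)
  hence "x1 a * (?c * B0 - V * (exp (\<rho>\<^sup>2) * Cg + M)) \<le> x1 a * (C5 * \<delta>)"
    by (simp add: algebra_simps)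
  thus ?thesis using a(1) unfolding B0_def by simp
qed

text \<open>\<open>t0\<close> is the crossing point, where
  \<open>\<kappa> * t powr (- 2 * s)\<close> equals \<open>M\<close>. Up to it the left-hand side is
  not positive, and beyond it \<open>M\<close> is at most \<open>M / t0 * t\<close>.\<close>

lemma powr_deficit_linear_bound:
  fixes s \<kappa> M :: real
  assumes "s > 0" "\<kappa> > 0" "M \<ge> 0"
  shows "\<exists>C\<ge>0. \<forall>t>0. M - \<kappa> * t powr (- 2 * s) \<le> C * t"
proof (cases "M = 0")
  case False
  hence M: "M > 0" using assms by simp
  define t0 where "t0 = (\<kappa> / M) powr (1 / (2 * s))"
  have t0: "t0 > 0" using assms M by (simp add: t0_def)
  have t0p: "\<kappa> * t0 powr (- 2 * s) = M"
    using assms M by (simp add: t0_def powr_powr powr_minus field_simps)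
  show ?thesis
  proof (intro exI[of _ "M / t0"] conjI allI impI)
    show "M / t0 \<ge> 0" using M t0 by simp
    fix t :: real assume t: "t > 0"
    show "M - \<kappa> * t powr (- 2 * s) \<le> M / t0 * t"
    proof (cases "t \<le> t0")
      case True
      have "\<kappa> * t0 powr (- 2 * s) \<le> \<kappa> * t powr (- 2 * s)"
        using True t assms by (intro mult_left_mono powr_mono2') auto
      moreover have "M / t0 * t \<ge> 0" using M t0 t by simp
      ultimately show ?thesis using t0p by linarith
    next
      case False
      have "M * 1 \<le> M * (t / t0)" using False t0 M by (intro mult_left_mono) auto
      moreover have "\<kappa> * t powr (- 2 * s) \<ge> 0" using assms by simp
      ultimately show ?thesis by simp
    qed
  qed
qed (use assms in \<open>auto intro!: exI[of _ 0]\<close>)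

lemma upper_bound:
  fixes s \<rho> M :: real
  assumes s: "0 < s" "s < 1" and \<rho>: "\<rho> > 0" and M: "M \<ge> 0"
  shows "\<exists>C>0. \<forall>u::real^'n::{finite,wellorder} \<Rightarrow> real. subsuper s \<rho> M u \<longrightarrow>
    (\<forall>x\<in>ball 0 (\<rho> / 2) \<inter> halfspace. u x \<le> C * mass s u * x1 x)"
proof -
  define p where "p = real CARD('n) + 2 * s"
  \<comment> \<open>The exponent for which \<open>r powr (- 2 * s) * r powr (p + 2) = r ^ N\<close>.
    As \<open>r\<close> will be \<open>\<theta>\<close> times \<open>D\<close>, a bound for
    \<open>V * r ^ N\<close> is one for the maximal quotient \<open>V * D ^ N\<close>.\<close>
  define N where "N = CARD('n) + 2"
  define v where "v = unit_ball_vol (real CARD('n))"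
  let ?c = "c_ns CARD('n) s"
  have c: "?c > 0" using c_ns_pos[OF s] .
  have v: "v > 0" by (simp add: v_def)
  have p: "p > 0" using s by (simp add: p_def add_pos_pos)
  have N1: "N \<ge> 1" by (simp add: N_def)
  obtain Cg where Cg: "Cg \<ge> 0" "\<And>a::real^'n::{finite,wellorder}. x1 a > 0 \<Longrightarrow> norm a \<le> \<rho> \<Longrightarrow> \<exists>E. \<forall>e. 0 < e \<and> e < 1 \<and> e < x1 a \<longrightarrow>
      \<bar>?c * trunc p (gau 1) a e + c_ns 1 s / s * gau 1 a * x1 a powr (- 2 * s)\<bar> \<le> Cg * x1 a + E * e"
    using trunc_gau_bound[OF s, of 1, where 'n = 'n and R = \<rho>] unfolding p_def by auto
  have "c_ns 1 s / s > 0" using c_ns_pos[OF s] s by simp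
  from powr_deficit_linear_bound[OF s(1) this M] obtain C5 where C5: "C5 \<ge> 0" "\<And>t. t > 0 \<Longrightarrow> M - c_ns 1 s / s * t powr (- 2 * s) \<le> C5 * t"
    by auto
  define CP where "CP = real N * \<rho>\<^sup>2 + 18 * (real N)\<^sup>2 * \<rho>\<^sup>2"
  define c3 where "c3 = v / (8 * 4 ^ CARD('n))"
  define C4 where "C4 = 2 * p * (1 + (2 * \<rho>) powr (p + 2)) * 4 powr (p + 2)"
  define C6 where "C6 = 5 * (\<rho>\<^sup>2)\<^sup>2 + 4 * real N * \<rho>\<^sup>2 + CP"
  define C7 where "C7 = 8 * p * C6 * (real CARD('n) * v / (2 - 2 * s))"
  define C8 where "C8 = exp (\<rho>\<^sup>2) * Cg + M"
  have c3: "c3 > 0" using v by (simp add: c3_def)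
  have C4: "C4 \<ge> 0" using p by (simp add: C4_def add_nonneg_nonneg)
  have C8: "C8 \<ge> 0" using Cg M by (simp add: C8_def)
  have CP: "CP \<ge> 0" by (simp add: CP_def)
  have C6: "C6 \<ge> 0" using CP by (simp add: C6_def add_nonneg_nonneg)
  \<comment> \<open>\<open>\<theta>\<close> is the ratio of the working radius to \<open>D\<close>.
    The moment constants grow like the inverse square of \<open>D\<close>, so that error is of order
    \<open>\<theta>\<^sup>2\<close> relative to the gain; the terms in \<open>C8\<close> are small
    relative to it because \<open>r powr (2 * s)\<close> is. Two errors of one eighth, taken from a
    gain of one half, leave one quarter.\<close>
  have "eventually (\<lambda>\<theta>. ?c * (C7 * \<theta>\<^sup>2) < ?c * c3 / 8) (at_right 0)"
  proof (rule order_tendstoD(2))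
    have "((\<lambda>\<theta>. ?c * (C7 * \<theta>\<^sup>2)) \<longlongrightarrow> ?c * (C7 * 0\<^sup>2)) (at_right 0)" by (intro tendsto_intros)
    thus "((\<lambda>\<theta>. ?c * (C7 * \<theta>\<^sup>2)) \<longlongrightarrow> 0) (at_right 0)" by simp
  qed (use c c3 in simp)
  moreover have "eventually (\<lambda>\<theta>. C8 * (\<theta> * \<rho>\<^sup>2) powr (2 * s) < ?c * c3 / 8) (at_right 0)"
  proof (rule order_tendstoD(2))
    have "((\<lambda>\<theta>. C8 * (\<theta> * \<rho>\<^sup>2) powr (2 * s)) \<longlongrightarrow> C8 * (0 * \<rho>\<^sup>2) powr (2 * s)) (at_right 0)"
      using s by (intro tendsto_intros tendsto_powr') (auto simp: eventually_at_right_field intro!: exI[of _ 1])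
    thus "((\<lambda>\<theta>. C8 * (\<theta> * \<rho>\<^sup>2) powr (2 * s)) \<longlongrightarrow> 0) (at_right 0)" using s by simp
  qed (use c c3 in simp)
  moreover have "eventually (\<lambda>\<theta>. \<theta> < 1 / (6 * real N * \<rho>)) (at_right 0)"
    unfolding eventually_at_right_field using \<rho> N1 by (intro exI[of _ "1 / (6 * real N * \<rho>)"]) auto
  moreover have "eventually (\<lambda>\<theta>. \<theta> > (0::real)) (at_right 0)"
    unfolding eventually_at_right_field by (intro exI[of _ 1]) auto
  ultimately have "eventually (\<lambda>\<theta>. ?c * (C7 * \<theta>\<^sup>2) < ?c * c3 / 8 \<and> C8 * (\<theta> * \<rho>\<^sup>2) powr (2 * s) < ?c * c3 / 8 \<and>
      \<theta> < 1 / (6 * real N * \<rho>) \<and> \<theta> > 0) (at_right 0)"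
    by eventually_elim auto
  from eventually_happens[OF this] obtain \<theta> where \<theta>: "?c * (C7 * \<theta>\<^sup>2) < ?c * c3 / 8" "C8 * (\<theta> * \<rho>\<^sup>2) powr (2 * s) < ?c * c3 / 8"
      "\<theta> < 1 / (6 * real N * \<rho>)" "\<theta> > 0" by auto
  define K where "K = (C5 * \<rho> powr (p + 2) + ?c * C4) * (4 / (?c * c3 * \<theta> ^ N))"
  have K: "K \<ge> 0" using C5 C4 c c3 \<theta> by (simp add: K_def)
  \<comment> \<open>The barrier blows up on the sphere of radius \<open>3 / 4 * \<rho>\<close>,
    strictly between the half-ball of the claim and the boundary of the domain.\<close>
  define R where "R = (3 / 4 * \<rho>)\<^sup>2"
  have R: "R < \<rho>\<^sup>2" using \<rho> by (simp add: R_def power_mult_distrib power_divide)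
  have contact: "V * (R - (norm a)\<^sup>2) ^ N \<le> K * (mass s u + \<delta>)"
    if u: "subsuper s \<rho> M u" and \<delta>: "\<delta> > 0" and a: "x1 a > 0" "(norm a)\<^sup>2 < R"
      and V: "V \<ge> 0" "u a - \<delta> = V * x1 a"
      and max: "\<And>y. x1 y > 0 \<Longrightarrow> (norm y)\<^sup>2 < R \<Longrightarrow> (u y - \<delta>) * (R - (norm y)\<^sup>2) ^ N \<le> V * (R - (norm a)\<^sup>2) ^ N * x1 y"
    for u :: "real^'n::{finite,wellorder} \<Rightarrow> real" and a \<delta> V
  proof -
    define D where "D = R - (norm a)\<^sup>2"
    have D: "D > 0" "D \<le> \<rho>\<^sup>2" using a R by (auto simp: D_def) (smt (verit) zero_le_power2)
    define r where "r = \<theta> * D"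
    have r0: "r > 0" using \<theta> D by (simp add: r_def)
    have rD: "6 * real N * \<rho> * r \<le> D"
    proof -
      have "6 * real N * \<rho> * \<theta> \<le> 1" using \<theta>(3) \<rho> N1 by (simp add: field_simps)
      from mult_right_mono[OF this, of D] D show ?thesis by (simp add: r_def mult_ac)
    qed
    have r\<theta>: "r \<le> \<theta> * \<rho>\<^sup>2" using D \<theta> by (simp add: r_def)
    have rr: "r \<le> \<rho>"
    proof -
      have "\<rho> * r \<le> 6 * real N * \<rho> * r" using N1 \<rho> r0 by simp
      also have "\<dots> \<le> \<rho> * \<rho>" using rD D by (simp add: power2_eq_square)
      finally show ?thesis using \<rho> by simp
    qed
    define \<beta> where "\<beta> = 2 + 2 * real N / D"
    define C' where "C' = 1 + CP / D\<^sup>2"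
    define \<Omega> where "\<Omega> = real CARD('n) * v * (r powr (2 - 2 * s) / (2 - 2 * s))"
    have an: "norm a \<le> \<rho>" by (rule power2_le_imp_le) (use a R \<rho> in linarith)+
    obtain E where E: "\<And>e. 0 < e \<Longrightarrow> e < 1 \<Longrightarrow> e < x1 a \<Longrightarrow>
      \<bar>?c * trunc p (gau 1) a e + c_ns 1 s / s * gau 1 a * x1 a powr (- 2 * s)\<bar> \<le> Cg * x1 a + E * e"
      using Cg(2)[OF a(1) an] by blast
    let ?w = "r powr (- 2 * s)"
    have main: "?c * (V / 2 * (r powr (- p) / 8 * (v * (r / 4) ^ CARD('n)))
      - 2 * p * (1 + (2 * \<rho>) powr (p + 2)) * (r / 4) powr (- p - 2) * mass s u - V * (8 * p * (2 * \<beta> + C') * \<Omega>)) - V * C8 \<le> C5 * \<delta>"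
      unfolding v_def C8_def \<beta>_def C'_def CP_def D_def \<Omega>_def
      by (rule upper_contact[OF p_def s \<rho> M R N1 Cg(1) E C5(2) u \<delta> a V max r0 rr rD[unfolded D_def]])
    have e1: "r powr (- p) / 8 * (v * (r / 4) ^ CARD('n)) = c3 * ?w"
    proof -
      have "r powr (- p) * r ^ CARD('n) = ?w"
        using r0 by (simp add: p_def flip: powr_realpow powr_add)
      thus ?thesis by (simp add: c3_def power_divide)
    qed
    have e2: "2 * p * (1 + (2 * \<rho>) powr (p + 2)) * (r / 4) powr (- p - 2) = C4 * r powr (- p - 2)"
    proof -
      have "(r / 4) powr (- p - 2) = r powr (- p - 2) * 4 powr (p + 2)"
        using r0 powr_minus_divide[of 4 "p + 2"] by (simp add: powr_divide)
      thus ?thesis by (simp add: C4_def)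
    qed
    have e3: "8 * p * (2 * \<beta> + C') * \<Omega> \<le> C7 * \<theta>\<^sup>2 * ?w"
    proof -
      have "(2 * \<beta> + C') * D\<^sup>2 = 5 * D\<^sup>2 + 4 * real N * D + CP"
        using D by (simp add: \<beta>_def C'_def field_simps power2_eq_square)
      also have "\<dots> \<le> C6"
        unfolding C6_def using D by (intro add_mono mult_left_mono power_mono) auto
      finally have 1: "(2 * \<beta> + C') * D\<^sup>2 \<le> C6" .
      have "r powr (2 - 2 * s) = r\<^sup>2 * ?w" using r0 by (simp add: powr_diff powr_minus field_simps)
      hence "8 * p * (2 * \<beta> + C') * \<Omega> = 8 * p * ((2 * \<beta> + C') * D\<^sup>2) * (real CARD('n) * v / (2 - 2 * s)) * \<theta>\<^sup>2 * ?w"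
        by (simp add: \<Omega>_def r_def power_mult_distrib)
      also have "\<dots> \<le> 8 * p * C6 * (real CARD('n) * v / (2 - 2 * s)) * \<theta>\<^sup>2 * ?w"
        using 1 p v s by (intro mult_right_mono mult_left_mono) auto
      finally show ?thesis by (simp add: C7_def)
    qed
    have e4: "C8 \<le> ?c * c3 / 8 * ?w"
    proof -
      have "1 = r powr (2 * s) * ?w" using r0 by (simp flip: powr_add)
      also have "\<dots> \<le> (\<theta> * \<rho>\<^sup>2) powr (2 * s) * ?w"
        using r\<theta> r0 s by (intro mult_right_mono powr_mono2) auto
      finally have "C8 * 1 \<le> C8 * ((\<theta> * \<rho>\<^sup>2) powr (2 * s) * ?w)" using C8 by (intro mult_left_mono)
      also have "\<dots> = (C8 * (\<theta> * \<rho>\<^sup>2) powr (2 * s)) * ?w" by simp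
      also have "\<dots> \<le> ?c * c3 / 8 * ?w" using \<theta>(2) by (intro mult_right_mono) auto
      finally show ?thesis by simp
    qed
    have e5: "?c * (8 * p * (2 * \<beta> + C') * \<Omega>) \<le> ?c * c3 / 8 * ?w"
    proof -
      have "?c * (8 * p * (2 * \<beta> + C') * \<Omega>) \<le> ?c * (C7 * \<theta>\<^sup>2 * ?w)" using e3 c by (intro mult_left_mono) auto
      also have "\<dots> = ?c * (C7 * \<theta>\<^sup>2) * ?w" by simp
      also have "\<dots> \<le> ?c * c3 / 8 * ?w" using \<theta>(1) by (intro mult_right_mono) auto
      finally show ?thesis .
    qed
    have "V * (?c * (8 * p * (2 * \<beta> + C') * \<Omega>)) \<le> V * (?c * c3 / 8 * ?w)" "V * C8 \<le> V * (?c * c3 / 8 * ?w)"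
      by (rule mult_left_mono[OF e5 V(1)], rule mult_left_mono[OF e4 V(1)])
    moreover have "?c * (V / 2 * (c3 * ?w) - C4 * r powr (- p - 2) * mass s u - V * (8 * p * (2 * \<beta> + C') * \<Omega>)) =
      V * (?c * c3 * ?w) / 2 - ?c * C4 * r powr (- p - 2) * mass s u - V * (?c * (8 * p * (2 * \<beta> + C') * \<Omega>))"
      by (simp add: right_diff_distrib)
    moreover have "V * (?c * c3 / 8 * ?w) = V * (?c * c3 * ?w) / 8" by simp
    ultimately have "V * (?c * c3 * ?w) / 4 \<le> C5 * \<delta> + ?c * C4 * r powr (- p - 2) * mass s u"
      using main unfolding e1 e2 by linarith
    hence mX: "V * (?c * c3 * ?w) / 4 * r powr (p + 2) \<le> (C5 * \<delta> + ?c * C4 * r powr (- p - 2) * mass s u) * r powr (p + 2)"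
      by (rule mult_right_mono) simp
    have "V * (?c * c3 * (?w * r powr (p + 2))) / 4 \<le> C5 * \<delta> * r powr (p + 2) + ?c * C4 * (r powr (- p - 2) * r powr (p + 2)) * mass s u"
    proof -
      have "V * (c * c3 * w) / 4 * X = V * (c * c3 * (w * X)) / 4"
        "(C5 * \<delta> + c * C4 * k * m) * X = C5 * \<delta> * X + c * C4 * (k * X) * m" for c w X k m :: real
        by (simp_all add: algebra_simps)
      thus ?thesis using mX by (simp only:)
    qed
    moreover have "?w * r powr (p + 2) = r ^ N"
    proof -
      have "?w * r powr (p + 2) = r powr (- 2 * s + (p + 2))" by (rule powr_add[symmetric])
      also have "- 2 * s + (p + 2) = real N" by (simp add: p_def N_def)
      also have "r powr real N = r ^ N" using r0 by (rule powr_realpow)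
      finally show ?thesis .
    qed
    moreover have "r powr (- p - 2) * r powr (p + 2) = 1" using r0 by (simp flip: powr_add)
    moreover have "C5 * \<delta> * r powr (p + 2) \<le> C5 * \<delta> * \<rho> powr (p + 2)"
      using C5 \<delta> r0 rr p by (intro mult_left_mono powr_mono2) auto
    moreover have "C5 * \<delta> * \<rho> powr (p + 2) = C5 * \<rho> powr (p + 2) * \<delta>" by simp
    ultimately have "V * (?c * c3 * r ^ N) / 4 \<le> C5 * \<rho> powr (p + 2) * \<delta> + ?c * C4 * mass s u"
      by (simp only: mult_1_right)
    also have "\<dots> \<le> (C5 * \<rho> powr (p + 2) + ?c * C4) * (mass s u + \<delta>)"
    proof -
      have "mass s u \<ge> 0" using u by (intro mass_nonneg) (simp add: subsuper_def)
      moreover have "A * \<delta> + B * m \<le> (A + B) * (m + \<delta>)" if "A \<ge> 0" "B \<ge> 0" "m \<ge> 0" for A B m :: real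
        using that \<delta> by (simp add: algebra_simps)
      ultimately show ?thesis using C5 C4 c by simp
    qed
    finally have "V * (?c * c3 * r ^ N) / 4 * (4 / (?c * c3 * \<theta> ^ N)) \<le> (C5 * \<rho> powr (p + 2) + ?c * C4) * (mass s u + \<delta>) * (4 / (?c * c3 * \<theta> ^ N))"
      using c c3 \<theta> by (intro mult_right_mono) auto
    moreover have "V * (?c * c3 * r ^ N) / 4 * (4 / (?c * c3 * \<theta> ^ N)) = V * D ^ N"
      using c c3 \<theta> by (simp add: r_def power_mult_distrib)
    ultimately show ?thesis by (simp add: K_def D_def mult_ac)
  qed
  have shifted: "(u x - \<delta>) * (R - (norm x)\<^sup>2) ^ N \<le> K * (mass s u + \<delta>) * x1 x"
    if u: "subsuper s \<rho> M u" and \<delta>: "\<delta> > 0" and x: "x1 x > 0" "(norm x)\<^sup>2 < R"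
    for u :: "real^'n::{finite,wellorder} \<Rightarrow> real" and x \<delta>
  proof -
    have m0: "mass s u \<ge> 0" using u by (intro mass_nonneg) (simp add: subsuper_def)
    have ucont: "continuous_on (ball 0 \<rho>) u" and u0: "\<And>y. x1 y = 0 \<Longrightarrow> u y = 0" using u by (auto simp: subsuper_def)
    show ?thesis
    proof (cases "u x \<le> \<delta>")
      case True
      have "(u x - \<delta>) * (R - (norm x)\<^sup>2) ^ N \<le> 0" using True x by (intro mult_nonpos_nonneg) auto
      also have "0 \<le> K * (mass s u + \<delta>) * x1 x" using K m0 \<delta> x by simp
      finally show ?thesis .
    next
      case ux: False
      let ?B = "cball 0 (3 / 4 * \<rho>) \<inter> {y::real^'n::{finite,wellorder}. 0 \<le> x1 y}"
      \<comment> \<open>Only points with \<open>u \<ge> \<delta>\<close> compete. As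
        \<open>u\<close> vanishes on the hyperplane, they form a compact subset of the open
        half-space, on which division by \<open>x1\<close> is continuous.\<close>
      define S where "S = {y \<in> ?B. \<delta> \<le> u y}"
      have inB: "y \<in> ?B" if "0 \<le> x1 y" "(norm y)\<^sup>2 < R" for y
        using that \<rho> power_less_imp_less_base[of "norm y" 2 "3 / 4 * \<rho>"] by (auto simp: R_def)
      have Bsub: "?B \<subseteq> ball 0 \<rho>" using \<rho> by auto
      have B: "compact ?B" unfolding x1_inner
        by (intro compact_Int_closed compact_cball closed_Collect_le continuous_intros)
      have "closed S" unfolding S_def
        by (rule continuous_on_closed_Collect_le[OF continuous_on_const continuous_on_subset[OF ucont Bsub] compact_imp_closed[OF B]])
      moreover have "S = ?B \<inter> S" by (auto simp: S_def)
      ultimately have S: "compact S" using compact_Int_closed[OF B, of S] by simp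
      have Spos: "x1 y > 0" if "y \<in> S" for y
        using that u0[of y] \<delta> by (cases "x1 y = 0") (auto simp: S_def)
      have Ssub: "S \<subseteq> ball 0 \<rho>" using Bsub by (auto simp: S_def)
      have xS: "x \<in> S" using inB[of x] x ux by (auto simp: S_def)
      let ?q = "\<lambda>y. (u y - \<delta>) * (R - (norm y)\<^sup>2) ^ N / x1 y"
      have "continuous_on S ?q"
        by (intro continuous_intros continuous_on_subset[OF ucont Ssub]) (use Spos in force)
      then obtain a where a: "a \<in> S" "\<And>y. y \<in> S \<Longrightarrow> ?q y \<le> ?q a"
        using continuous_attains_sup[OF S] xS by blast
      have ap: "x1 a > 0" using Spos a(1) .
      have "?q x > 0" using x ux by simp
      hence qa: "?q a > 0" using a(2)[OF xS] by linarith
      have "norm a \<le> 3 / 4 * \<rho>" using a(1) by (simp add: S_def)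
      hence "(norm a)\<^sup>2 \<le> R" unfolding R_def by (intro power_mono) auto
      moreover have "(norm a)\<^sup>2 \<noteq> R" using qa N1 by (auto simp: power_0_left)
      ultimately have aR: "(norm a)\<^sup>2 < R" by simp
      define V where "V = (u a - \<delta>) / x1 a"
      have V: "V \<ge> 0" "u a - \<delta> = V * x1 a" using a(1) ap by (auto simp: V_def S_def)
      have qaV: "?q a = V * (R - (norm a)\<^sup>2) ^ N" by (simp add: V_def)
      have max: "(u y - \<delta>) * (R - (norm y)\<^sup>2) ^ N \<le> V * (R - (norm a)\<^sup>2) ^ N * x1 y" if y: "x1 y > 0" "(norm y)\<^sup>2 < R" for y
      proof (cases "\<delta> \<le> u y")
        case True
        hence "?q y \<le> ?q a" using inB[of y] y by (intro a(2)) (auto simp: S_def)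
        thus ?thesis unfolding qaV using y by (simp add: pos_divide_le_eq)
      next
        case False
        have "(u y - \<delta>) * (R - (norm y)\<^sup>2) ^ N \<le> 0" using False y by (intro mult_nonpos_nonneg) auto
        also have "0 \<le> V * (R - (norm a)\<^sup>2) ^ N * x1 y" using V aR y by (intro mult_nonneg_nonneg) auto
        finally show ?thesis .
      qed
      have "(u x - \<delta>) * (R - (norm x)\<^sup>2) ^ N \<le> V * (R - (norm a)\<^sup>2) ^ N * x1 x" by (rule max[OF x])
      also have "\<dots> \<le> K * (mass s u + \<delta>) * x1 x"
        using contact[OF u \<delta> ap aR V max] x by (intro mult_right_mono) auto
      finally show ?thesis .
    qed
  qed
  \<comment> \<open>For \<open>norm x < \<rho> / 2\<close> the factor
    \<open>R - (norm x)\<^sup>2\<close> is at least (9/16 - 1/4) times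
    \<open>\<rho>\<^sup>2\<close>.\<close>
  define m where "m = (5 / 16 * \<rho>\<^sup>2) ^ N"
  have m: "m > 0" using \<rho> by (simp add: m_def)
  show ?thesis
  proof (intro exI[of _ "(K + 1) / m"] conjI allI impI ballI)
    show "(K + 1) / m > 0" using K m by simp
    fix u :: "real^'n::{finite,wellorder} \<Rightarrow> real" and x :: "real^'n::{finite,wellorder}"
    assume u: "subsuper s \<rho> M u" and x: "x \<in> ball 0 (\<rho> / 2) \<inter> halfspace"
    have xp: "x1 x > 0" "norm x < \<rho> / 2" using x by (auto simp: halfspace_def)
    have m0: "mass s u \<ge> 0" using u by (intro mass_nonneg) (simp add: subsuper_def)
    have ux: "u x \<ge> 0" using u x by (simp add: subsuper_def)
    have "(norm x)\<^sup>2 \<le> (\<rho> / 2)\<^sup>2" using xp by (intro power_mono) auto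
    hence Rx: "5 / 16 * \<rho>\<^sup>2 \<le> R - (norm x)\<^sup>2" by (simp add: R_def power_mult_distrib power_divide)
    moreover have "5 / 16 * \<rho>\<^sup>2 > 0" using \<rho> by simp
    ultimately have xR: "(norm x)\<^sup>2 < R" by linarith
    have lim1: "((\<lambda>\<delta>. (u x - \<delta>) * (R - (norm x)\<^sup>2) ^ N) \<longlongrightarrow> (u x - 0) * (R - (norm x)\<^sup>2) ^ N) (at_right 0)" by (intro tendsto_intros)
    have lim2: "((\<lambda>\<delta>. K * (mass s u + \<delta>) * x1 x) \<longlongrightarrow> K * (mass s u + 0) * x1 x) (at_right 0)" by (intro tendsto_intros)
    have "eventually (\<lambda>\<delta>. (u x - \<delta>) * (R - (norm x)\<^sup>2) ^ N \<le> K * (mass s u + \<delta>) * x1 x) (at_right 0)"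
      unfolding eventually_at_right_field using shifted[OF u _ xp(1) xR] by (intro exI[of _ 1]) auto
    from tendsto_le[OF trivial_limit_at_right_real lim2 lim1 this]
    have 1: "u x * (R - (norm x)\<^sup>2) ^ N \<le> K * mass s u * x1 x" by simp
    have "u x * m \<le> u x * (R - (norm x)\<^sup>2) ^ N"
      unfolding m_def using Rx \<rho> ux by (intro mult_left_mono power_mono) auto
    also note 1
    also have "K * mass s u * x1 x \<le> (K + 1) * mass s u * x1 x" using m0 xp by (intro mult_right_mono) auto
    finally show "u x \<le> (K + 1) / m * mass s u * x1 x" using m by (simp add: field_simps)
  qed
qed


section \<open>Assembling the Harnack inequality\<close>

lemma solution_subsuper:
  fixes u c :: "real^'n::{finite,wellorder} \<Rightarrow> real"
  assumes s: "0 < s" "s < 1" and c: "Linf_on (ball 0 \<rho> \<inter> halfspace) c" "Linf_norm (ball 0 \<rho> \<inter> halfspace) c < M"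
    and \<alpha>: "0 < \<alpha>" "2 * s + \<alpha> \<notin> \<int>" and C: "C_beta (2 * s + \<alpha>) (ball 0 \<rho>) u" and u: "in_As s u"
    and pos: "\<And>x. x \<in> halfspace \<Longrightarrow> u x \<ge> 0"
    and eq: "\<And>x. x \<in> ball 0 \<rho> \<inter> halfspace \<Longrightarrow> fraclap s u x + c x * u x = 0"
  shows "subsuper s \<rho> M u" "As_norm s u = mass s u"
proof -
  let ?B = "ball 0 \<rho> \<inter> halfspace :: (real^'n::{finite,wellorder}) set"
  let ?S = "{M. M \<ge> 0 \<and> (AE x in lebesgue. x \<in> ?B \<longrightarrow> \<bar>c x\<bar> \<le> M)}"
  obtain M0 where M0: "AE x in lebesgue. x \<in> ?B \<longrightarrow> \<bar>c x\<bar> \<le> M0" using c(1) unfolding Linf_on_def by blast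
  have "AE x in lebesgue. x \<in> ?B \<longrightarrow> \<bar>c x\<bar> \<le> max M0 0"
    using M0 by eventually_elim auto
  hence "max M0 0 \<in> ?S" by simp
  hence "?S \<noteq> {}" by blast
  \<comment> \<open>\<open>Linf_norm\<close> is an infimum; the strict inequality yields an
    admissible essential bound below \<open>M\<close> without deciding whether the infimum is
    attained.\<close>
  with c(2) obtain m where m: "m \<in> ?S" "m < M"
    unfolding Linf_norm_def using cInf_lessD[of ?S M] by blast
  hence AE: "AE x in lebesgue. x \<in> ?B \<longrightarrow> \<bar>c x\<bar> \<le> M"
    by (auto elim!: eventually_mono)
  have cont: "continuous_on (ball 0 \<rho>) u"
  proof -
    have "continuous_on (ball 0 \<rho>) (pds [] u)"
      using C unfolding C_beta_def Holder_on_def Ck_on_def by (metis le0 list.size(3))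
    thus ?thesis by simp
  qed
  have zero: "u x = 0" if "x1 x = 0" for x
  proof -
    have "reflect x = x" using that by (simp add: reflect_eq)
    moreover have "u (reflect x) = - u x" using u unfolding in_As_def antisymmetric_def by blast
    ultimately show ?thesis by simp
  qed
  show "subsuper s \<rho> M u"
    unfolding subsuper_def
    using cont pos zero in_As_wgt(1)[OF u pos] fraclap_bound[OF s C \<alpha> u pos AE eq] by blast
  show "As_norm s u = mass s u"
    unfolding mass_def by (rule in_As_wgt(2)[OF u pos])
qed

text \<open>The constants are chosen after n, s, \<open>\<rho>\<close> and \<open>M\<close> but
  before \<open>c\<close>, \<open>u\<close> and \<open>\<alpha>\<close>, which expresses their
  dependence. Supremum and infimum are taken in \<open>ereal\<close>, so that finiteness of the
  supremum is part of the claim and not a tacit assumption.\<close>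

theorem mainTheorem3:
  fixes s \<rho> M :: real
  assumes "0 < s" "s < 1" "0 < \<rho>"
  shows "\<exists>C>0. \<exists>C1>0. \<exists>C2>0. \<forall>(c :: real^'n::{finite,wellorder} \<Rightarrow> real) (u :: real^'n::{finite,wellorder} \<Rightarrow> real) \<alpha>.
     Linf_on (ball 0 \<rho> \<inter> halfspace) c \<and> Linf_norm (ball 0 \<rho> \<inter> halfspace) c = M \<and>
     0 < \<alpha> \<and> 2 * s + \<alpha> \<notin> \<int> \<and> C_beta (2 * s + \<alpha>) (ball 0 \<rho>) u \<and> in_As s u \<and>
     (\<forall>x\<in>halfspace. u x \<ge> 0) \<and>
     (\<forall>x\<in>ball 0 \<rho> \<inter> halfspace. fraclap s u x + c x * u x = 0)
     \<longrightarrow>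
     (SUP x\<in>ball 0 (\<rho>/2) \<inter> halfspace. ereal (u x / x1 x))
        \<le> ereal C * (INF x\<in>ball 0 (\<rho>/2) \<inter> halfspace. ereal (u x / x1 x)) \<and>
     ereal (C1 * As_norm s u) \<le> (INF x\<in>ball 0 (\<rho>/2) \<inter> halfspace. ereal (u x / x1 x)) \<and>
     (INF x\<in>ball 0 (\<rho>/2) \<inter> halfspace. ereal (u x / x1 x)) \<le> ereal (C2 * As_norm s u) \<and>
     ereal (C1 * As_norm s u) \<le> (SUP x\<in>ball 0 (\<rho>/2) \<inter> halfspace. ereal (u x / x1 x)) \<and>
     (SUP x\<in>ball 0 (\<rho>/2) \<inter> halfspace. ereal (u x / x1 x)) \<le> ereal (C2 * As_norm s u)"
proof -
  \<comment> \<open>A nonnegative number strictly above the norm of the potential and determined by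
    \<open>M\<close> alone.\<close>
  let ?M = "\<bar>M\<bar> + 1"
  have M: "0 \<le> ?M" "M < ?M" by linarith+
  obtain C1 where C1: "C1 > 0" "\<And>u x. subsuper s \<rho> ?M u \<Longrightarrow> x \<in> ball 0 (\<rho> / 2) \<inter> halfspace \<Longrightarrow> C1 * mass s (u :: real^'n::{finite,wellorder} \<Rightarrow> real) * x1 x \<le> u x"
    using lower_bound[OF assms M(1), where 'n = 'n] by blast
  obtain C2 where C2: "C2 > 0" "\<And>u x. subsuper s \<rho> ?M u \<Longrightarrow> x \<in> ball 0 (\<rho> / 2) \<inter> halfspace \<Longrightarrow> u x \<le> C2 * mass s (u :: real^'n::{finite,wellorder} \<Rightarrow> real) * x1 x"
    using upper_bound[OF assms M(1), where 'n = 'n] by blast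
  show ?thesis
  proof (rule exI[of _ "C2 / C1"], rule conjI, goal_cases)
    case 1 show ?case using C1 C2 by simp
  next
    case 2 show ?case
    proof (rule exI[of _ C1], rule conjI[OF C1(1)], rule exI[of _ C2], rule conjI[OF C2(1)], intro allI impI, elim conjE)
      fix c u :: "real^'n::{finite,wellorder} \<Rightarrow> real" and \<alpha> :: real
      assume h: "Linf_on (ball 0 \<rho> \<inter> halfspace) c" "Linf_norm (ball 0 \<rho> \<inter> halfspace) c = M"
        "0 < \<alpha>" "2 * s + \<alpha> \<notin> \<int>" "C_beta (2 * s + \<alpha>) (ball 0 \<rho>) u" "in_As s u"
        "\<forall>x\<in>halfspace. u x \<ge> 0" "\<forall>x\<in>ball 0 \<rho> \<inter> halfspace. fraclap s u x + c x * u x = 0"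
      have "Linf_norm (ball 0 \<rho> \<inter> halfspace) c < ?M" using h(2) M by simp
      from solution_subsuper[OF assms(1,2) h(1) this h(3-6)] h(7,8)
      have u: "subsuper s \<rho> ?M u" and A: "As_norm s u = mass s u" by blast+
      let ?B = "ball 0 (\<rho>/2) \<inter> halfspace :: (real^'n::{finite,wellorder}) set"
      let ?I = "INF x\<in>?B. ereal (u x / x1 x)" and ?S = "SUP x\<in>?B. ereal (u x / x1 x)"
      have "x1 (axis idx1 1 :: real^'n::{finite,wellorder}) = 1" by (simp add: x1_def axis_def)
      hence "(\<rho> / 4) *\<^sub>R axis idx1 1 \<in> ?B"
        using assms(3) by (simp add: halfspace_def norm_axis_1)
      hence ne: "?B \<noteq> {}" by blast
      have lo: "ereal (C1 * As_norm s u) \<le> ?I"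
      proof (rule INF_greatest)
        fix x assume x: "x \<in> ?B"
        hence "x1 x > 0" by (simp add: halfspace_def)
        thus "ereal (C1 * As_norm s u) \<le> ereal (u x / x1 x)"
          using C1(2)[OF u x] unfolding A by (simp add: pos_le_divide_eq)
      qed
      have hi: "?S \<le> ereal (C2 * As_norm s u)"
      proof (rule SUP_least)
        fix x assume x: "x \<in> ?B"
        hence "x1 x > 0" by (simp add: halfspace_def)
        thus "ereal (u x / x1 x) \<le> ereal (C2 * As_norm s u)"
          using C2(2)[OF u x] unfolding A by (simp add: pos_divide_le_eq)
      qed
      have IS: "?I \<le> ?S" by (rule INF_le_SUP[OF ne])
      \<comment> \<open>Supremum and infimum are compared through the norm, hence the Harnack
        constant \<open>C2 / C1\<close>.\<close>
      have "ereal (C2 * As_norm s u) = ereal (C2 / C1) * ereal (C1 * As_norm s u)" using C1(1) by simp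
      also have "\<dots> \<le> ereal (C2 / C1) * ?I" using C1(1) C2(1) by (intro ereal_mult_left_mono lo) simp
      finally have H: "?S \<le> ereal (C2 / C1) * ?I" using hi by (rule order.trans[rotated])
      show "?S \<le> ereal (C2 / C1) * ?I \<and> ereal (C1 * As_norm s u) \<le> ?I \<and> ?I \<le> ereal (C2 * As_norm s u) \<and>
        ereal (C1 * As_norm s u) \<le> ?S \<and> ?S \<le> ereal (C2 * As_norm s u)"
        using H lo hi IS order.trans[OF lo IS] order.trans[OF IS hi] by blast
    qed
  qed
qed

end
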